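(* Let $M=S^r$ be the $r$-dimensional sphere with $r\ge1$, and let $f_0:M\to[0,1]$ be a surjective Morse function with exactly two critical points. Let $\Gamma$ be a free abelian group with basis $\gamma_1,\dots,\gamma_n$, and let $\epsilon(c)$ and $b(c)$ be the dynamical Morse entropy and Betti entropy of $f_0$ as defined in the context. Then for all $0\le c\le1$, $$\epsilon(c)=b(c)=-c\log c-(1-c)\log(1-c)$$ (with the convention $0\log0=0$).
   Context: For a finite non-empty $\Omega\subset\Gamma$, define $f_\Omega:M^\Omega\to[0,1]$ by $f_\Omega(x)=\frac{1}{|\Omega|}\sum_{\gamma\in\Omega}f_0(x_\gamma)$. For $i=1,2,\dots$ let $\Omega_i=\{a_1\gamma_1+\dots+a_n\gamma_n : a_j\in\mathbb{Z},\ |a_j|\le i,\ 1\le j\le n\}$. Dynamical Morse entropy: let $N_i(c,\delta)$ be the number of critical points of $f_{\Omega_i}$ lying in $f_{\Omega_i}^{-1}[c-\delta,c+\delta]$, and put $\epsilon(c)=\lim_{\delta\to0^+}\liminf_{i\to\infty}\frac{\log N_i(c,\delta)}{|\Omega_i|}$ (with $\log 0=-\infty$). Cohomology with support in an open set: $H^*(X,\mathbb{R})$ is the total singular cohomology of $X$. For a compact oriented manifold $X$ and an open set $U\subset X$, $H^*_X(U)$ is the linear subspace of all $a\in H^*(X,\mathbb{R})$ with $\operatorname{supp}a\subset U$, meaning that there is an open $V\subset X$ with $X=U\cup V$ and $a|_V=0$. Betti entropy: for continuous $f:X\to\mathbb{R}$, $c\in\mathbb{R}$, $\delta>0$, put $b'_{c,\delta}(f)=\dim\big(H^*_X(f^{-1}(-\infty,c+\delta))/H^*_X(f^{-1}(-\infty,c-\delta))\big)$.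 Let $b'_i(c,\delta)=b'_{c,\delta}(f_{\Omega_i})$ (with $X=M^{\Omega_i}$), and $b(c)=\lim_{\delta\to0^+}\liminf_{i\to\infty}\frac{\log b'_i(c,\delta)}{|\Omega_i|}$. *)

theory Defs
  imports
    "HOL-Analysis.Analysis"
    "HOL-Homology.Homology"
    "Jordan_Normal_Form.VS_Connect"
begin

section \<open>Quotients of real vector spaces\<close>

text \<open>The quotient \<open>V / U\<close>, with the cosets of \<open>U\<close> as elements (compare \<open>FactRing\<close>).\<close>

definition quotient_space :: "(real, 'v, 'm) module_scheme \<Rightarrow> 'v set \<Rightarrow> (real, 'v set) module" where
  "quotient_space V U =
     \<lparr>carrier = a_rcosets\<^bsub>V\<^esub> U, mult = undefined, one = undefined, zero = U, add = set_add V,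
      smult = (\<lambda>r A. \<Union>x\<in>A. U +>\<^bsub>V\<^esub> (r \<odot>\<^bsub>V\<^esub> x))\<rparr>"


section \<open>Singular cohomology with real coefficients\<close>

type_synonym 'x cochain = "((nat \<Rightarrow> real) \<Rightarrow> 'x) \<Rightarrow> real"

definition cochains :: "nat \<Rightarrow> 'x topology \<Rightarrow> (real, 'x cochain) module" where
  "cochains p X = ring.func_space class_ring {\<sigma>. singular_simplex p X \<sigma>}"

definition coboundary :: "nat \<Rightarrow> 'x topology \<Rightarrow> 'x cochain \<Rightarrow> 'x cochain" where
  "coboundary p X \<phi> =
     (\<lambda>\<sigma>\<in>{\<sigma>. singular_simplex (Suc p) X \<sigma>}. \<Sum>k\<le>Suc p. (-1) ^ k * \<phi> (singular_face (Suc p) k \<sigma>))"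

definition cocycles :: "nat \<Rightarrow> 'x topology \<Rightarrow> 'x cochain set" where
  "cocycles p X =
     {\<phi> \<in> carrier (cochains p X). coboundary p X \<phi> = \<zero>\<^bsub>cochains (Suc p) X\<^esub>}"

definition coboundaries :: "nat \<Rightarrow> 'x topology \<Rightarrow> 'x cochain set" where
  "coboundaries p X =
     (case p of 0 \<Rightarrow> {\<zero>\<^bsub>cochains 0 X\<^esub>} | Suc q \<Rightarrow> coboundary q X ` carrier (cochains q X))"

definition cohomology :: "nat \<Rightarrow> 'x topology \<Rightarrow> (real, 'x cochain set) module" where
  "cohomology p X = quotient_space (cochains p X\<lparr>carrier := cocycles p X\<rparr>) (coboundaries p X)"

text \<open>The direct sum of the cohomology spaces of all degrees.\<close>

definition total_cohomology :: "'x topology \<Rightarrow> (real, nat \<Rightarrow> 'x cochain set) module" where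
  "total_cohomology X =
     \<lparr>carrier = {a. (\<forall>p. a p \<in> carrier (cohomology p X)) \<and> finite {p. a p \<noteq> \<zero>\<^bsub>cohomology p X\<^esub>}},
      mult = undefined, one = undefined,
      zero = (\<lambda>p. \<zero>\<^bsub>cohomology p X\<^esub>),
      add = (\<lambda>a b p. a p \<oplus>\<^bsub>cohomology p X\<^esub> b p),
      smult = (\<lambda>r a p. r \<odot>\<^bsub>cohomology p X\<^esub> a p)\<rparr>"

text \<open>
  The restriction \<open>H\<^sup>p(X) \<rightarrow> H\<^sup>p(V)\<close>. The cosets in the union are all equal when \<open>A\<close> is a
  cohomology class of \<open>X\<close>, since its representatives differ by coboundaries.
\<close>

definition restrict_class :: "nat \<Rightarrow> 'x topology \<Rightarrow> 'x set \<Rightarrow> 'x cochain set \<Rightarrow> 'x cochain set" where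
  "restrict_class p X V A =
     (\<Union>\<phi>\<in>A. coboundaries p (subtopology X V) +>\<^bsub>cochains p (subtopology X V)\<^esub>
              restrict \<phi> {\<sigma>. singular_simplex p (subtopology X V) \<sigma>})"

definition supported_cohomology :: "'x topology \<Rightarrow> 'x set \<Rightarrow> (nat \<Rightarrow> 'x cochain set) set" where
  "supported_cohomology X U =
     {a \<in> carrier (total_cohomology X).
        \<exists>V. openin X V \<and> topspace X = U \<union> V \<and>
            (\<forall>p. restrict_class p X V (a p) = \<zero>\<^bsub>cohomology p (subtopology X V)\<^esub>)}"

definition sublevel_betti :: "'x topology \<Rightarrow> ('x \<Rightarrow> real) \<Rightarrow> real \<Rightarrow> real \<Rightarrow> nat" where
  "sublevel_betti X f c \<delta> =
     vectorspace.dim class_ring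
       (quotient_space
         (total_cohomology X\<lparr>carrier := supported_cohomology X {x \<in> topspace X. f x < c + \<delta>}\<rparr>)
         (supported_cohomology X {x \<in> topspace X. f x < c - \<delta>}))"


section \<open>Smooth and Morse functions on the sphere\<close>

text \<open>
  For \<open>'b\<close> of dimension \<open>r\<close>, the unit sphere of \<open>'b \<times> real\<close> is \<open>S\<^sup>r\<close> (and \<open>r \<ge> 1\<close> holds in every
  Euclidean space). For \<open>s = 1\<close> and \<open>s = -1\<close>, \<open>stereo s\<close> is the inverse of the stereographic
  projection from the pole \<open>(0, s)\<close>; these two parametrizations give the smooth structure.
\<close>

abbreviation unit_sphere :: "('b::euclidean_space \<times> real) set" where
  "unit_sphere \<equiv> sphere 0 1"

definition stereo :: "real \<Rightarrow> 'b::euclidean_space \<Rightarrow> 'b \<times> real" where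
  "stereo s y =
     ((2 / ((norm y)\<^sup>2 + 1)) *\<^sub>R y, s * (((norm y)\<^sup>2 - 1) / ((norm y)\<^sup>2 + 1)))"

primrec Ck :: "nat \<Rightarrow> ('b::euclidean_space \<Rightarrow> real) \<Rightarrow> bool" where
  "Ck 0 g \<longleftrightarrow> continuous_on UNIV g"
| "Ck (Suc k) g \<longleftrightarrow>
     (\<forall>y. g differentiable at y) \<and> (\<forall>v. Ck k (\<lambda>y. frechet_derivative g (at y) v))"

definition smooth_on_sphere :: "('b::euclidean_space \<times> real \<Rightarrow> real) \<Rightarrow> bool" where
  "smooth_on_sphere f \<longleftrightarrow> (\<forall>s\<in>{-1, 1}. \<forall>k. Ck k (f \<circ> stereo s))"

definition sphere_critical :: "('b::euclidean_space \<times> real \<Rightarrow> real) \<Rightarrow> 'b \<times> real \<Rightarrow> bool" where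
  "sphere_critical f x \<longleftrightarrow>
     (\<exists>s\<in>{-1, 1}. \<exists>y. x = stereo s y \<and> ((f \<circ> stereo s) has_derivative (\<lambda>v. 0)) (at y))"

definition hessian :: "('b::euclidean_space \<Rightarrow> real) \<Rightarrow> 'b \<Rightarrow> 'b \<Rightarrow> 'b \<Rightarrow> real" where
  "hessian g y v w = frechet_derivative (\<lambda>z. frechet_derivative g (at z) v) (at y) w"

definition morse_on_sphere :: "('b::euclidean_space \<times> real \<Rightarrow> real) \<Rightarrow> bool" where
  "morse_on_sphere f \<longleftrightarrow>
     smooth_on_sphere f \<and>
     (\<forall>s\<in>{-1, 1}. \<forall>y. ((f \<circ> stereo s) has_derivative (\<lambda>v. 0)) (at y) \<longrightarrow>
        (\<forall>v. (\<forall>w. hessian (f \<circ> stereo s) y v w = 0) \<longrightarrow> v = 0))"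


section \<open>The product manifold and the functions on it\<close>

definition sphere_power :: "'g set \<Rightarrow> ('g \<Rightarrow> 'b::euclidean_space \<times> real) topology" where
  "sphere_power \<Omega> = product_topology (\<lambda>_. top_of_set unit_sphere) \<Omega>"

text \<open>
  Critical points of a smooth function \<open>F\<close> on the product manifold: in a product parametrization,
  all directional derivatives of \<open>F\<close> vanish.
\<close>

definition power_critical ::
    "'g set \<Rightarrow> (('g \<Rightarrow> 'b::euclidean_space \<times> real) \<Rightarrow> real) \<Rightarrow> ('g \<Rightarrow> 'b \<times> real) \<Rightarrow> bool" where
  "power_critical \<Omega> F x \<longleftrightarrow>
     (\<exists>s\<in>\<Omega> \<rightarrow> {-1, 1}. \<exists>y. x = (\<lambda>g\<in>\<Omega>. stereo (s g) (y g)) \<and>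
        (\<forall>v. ((\<lambda>t. F (\<lambda>g\<in>\<Omega>. stereo (s g) (y g + t *\<^sub>R v g))) has_real_derivative 0) (at 0)))"

definition average :: "('m \<Rightarrow> real) \<Rightarrow> 'g set \<Rightarrow> ('g \<Rightarrow> 'm) \<Rightarrow> real" where
  "average f0 \<Omega> x = (1 / real (card \<Omega>)) * (\<Sum>g\<in>\<Omega>. f0 (x g))"


section \<open>Free abelian groups and their boxes\<close>

text \<open>HOL-Algebra writes abelian groups multiplicatively.\<close>

definition int_combination :: "('g, 'z) monoid_scheme \<Rightarrow> nat \<Rightarrow> (nat \<Rightarrow> 'g) \<Rightarrow> (nat \<Rightarrow> int) \<Rightarrow> 'g" where
  "int_combination \<Gamma> n \<gamma> a = (\<Otimes>\<^bsub>\<Gamma>\<^esub>j\<in>{1..n}. \<gamma> j [^]\<^bsub>\<Gamma>\<^esub> a j)"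

definition free_abelian_basis :: "('g, 'z) monoid_scheme \<Rightarrow> nat \<Rightarrow> (nat \<Rightarrow> 'g) \<Rightarrow> bool" where
  "free_abelian_basis \<Gamma> n \<gamma> \<longleftrightarrow>
     comm_group \<Gamma> \<and> \<gamma> \<in> {1..n} \<rightarrow> carrier \<Gamma> \<and>
     bij_betw (int_combination \<Gamma> n \<gamma>) ({1..n} \<rightarrow>\<^sub>E UNIV) (carrier \<Gamma>)"

definition box_set :: "('g, 'z) monoid_scheme \<Rightarrow> nat \<Rightarrow> (nat \<Rightarrow> 'g) \<Rightarrow> nat \<Rightarrow> 'g set" where
  "box_set \<Gamma> n \<gamma> i = {int_combination \<Gamma> n \<gamma> a | a. \<forall>j\<in>{1..n}. \<bar>a j\<bar> \<le> int i}"


section \<open>The two entropies\<close>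

definition log_nat :: "nat \<Rightarrow> ereal" where
  "log_nat N = (if N = 0 then -\<infinity> else ereal (ln (real N)))"

definition exponential_rate :: "(nat \<Rightarrow> 'g set) \<Rightarrow> (nat \<Rightarrow> real \<Rightarrow> nat) \<Rightarrow> ereal" where
  "exponential_rate \<Omega> N =
     Lim (at_right 0) (\<lambda>\<delta>. liminf (\<lambda>i. log_nat (N i \<delta>) / ereal (real (card (\<Omega> i)))))"

definition morse_entropy ::
    "('g, 'z) monoid_scheme \<Rightarrow> nat \<Rightarrow> (nat \<Rightarrow> 'g) \<Rightarrow> ('b::euclidean_space \<times> real \<Rightarrow> real) \<Rightarrow> real \<Rightarrow> ereal"
  where
  "morse_entropy \<Gamma> n \<gamma> f0 c =
     (let \<Omega> = box_set \<Gamma> n \<gamma> in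
      exponential_rate \<Omega> (\<lambda>i \<delta>.
        card {x \<in> topspace (sphere_power (\<Omega> i)).
                power_critical (\<Omega> i) (average f0 (\<Omega> i)) x \<and>
                average f0 (\<Omega> i) x \<in> {c - \<delta>..c + \<delta>}}))"

definition betti_entropy ::
    "('g, 'z) monoid_scheme \<Rightarrow> nat \<Rightarrow> (nat \<Rightarrow> 'g) \<Rightarrow> ('b::euclidean_space \<times> real \<Rightarrow> real) \<Rightarrow> real \<Rightarrow> ereal"
  where
  "betti_entropy \<Gamma> n \<gamma> f0 c =
     (let \<Omega> = box_set \<Gamma> n \<gamma> in
      exponential_rate \<Omega> (\<lambda>i \<delta>. sublevel_betti (sphere_power (\<Omega> i)) (average f0 (\<Omega> i)) c \<delta>))"

end

theory Submission
  imports Defs "HOL-Real_Asymp.Real_Asymp"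
begin

text \<open>
  The two critical points of \<open>f\<^sub>0\<close> are its minimum \<open>a\<close> and its maximum \<open>b\<close>, with values \<open>0\<close> and \<open>1\<close>.
  Hence the critical points of \<open>f\<^sub>\<Omega>\<close> are the points with all coordinates in \<open>{a, b}\<close>, and
  \<open>N choose k\<close> of them have the value \<open>k / N\<close>, where \<open>N = |\<Omega>|\<close>.

  The Betti side gives the same numbers. Write \<open>M = S\<^sup>r\<close>. The cohomology of \<open>M\<^sup>\<Omega>\<close> has a basis of
  classes \<open>e\<^sub>S\<close> of degree \<open>r |S|\<close>, indexed by the subsets \<open>S\<close> of \<open>\<Omega>\<close>, such that \<open>e\<^sub>S\<close> vanishes on the
  open set \<open>{x. \<exists>g\<in>S. x g \<noteq> a}\<close>, and the dual homology class \<open>z\<^sub>S\<close> comes from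
  \<open>{x. \<forall>g\<in>\<Omega> - S. x g = b}\<close>. On the complement of the former set \<open>f\<^sub>\<Omega> \<le> (N - |S|) / N\<close>, on the latter
  set \<open>f\<^sub>\<Omega> \<ge> (N - |S|) / N\<close>, so the classes supported in \<open>{f\<^sub>\<Omega> < t}\<close> are exactly the span of the \<open>e\<^sub>S\<close>
  with \<open>(N - |S|) / N < t\<close>.

  The basis is built by induction on \<open>|\<Omega>|\<close> from an isomorphism
  \<open>H\<^sub>p\<^sub>+\<^sub>r(Y \<times> M, Y \<times> (M - {a})) \<cong> H\<^sub>p(Y)\<close>, natural in \<open>Y\<close>; naturality and excision
  control the supports, and no products in cohomology are needed. As the real numbers are a
  divisible group, real cohomology classes are the same as additive functions on integral homology.
\<close>

section \<open>Natural isomorphisms and products with contractible spaces\<close>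

text \<open>A Kunneth formula would give the size of the cohomology, but the Betti entropy asks
  which classes can be pushed into a sublevel set. So each basis class carries two certificates: an
  open set on which \<open>e S\<close> dies, which produces supports, and a small set carrying
  \<open>z S\<close>, which obstructs them, since a class vanishing near that set has coefficient 0
  at \<open>S\<close>. The points \<open>a\<close> and \<open>b\<close> have different tasks. As M -
  {a} is contractible, the pair (M, M - {a}) isolates what happens at \<open>a\<close>; and
  \<open>b\<close> lies in M - {a}, so y \<mapsto> (y, b) represents the homology of Y \<times> (M -
  {a}) and splits the exact sequence of the pair. Torsion in integral homology is harmless because
  only additive functionals into the reals are tested. On the counting side, a binomial coefficient
  N choose k agrees with exp (N H(k/N)) up to the factor N + 1, where H is the entropy function, and
  a window contains at most N + 1 of them. Both losses vanish after taking logarithms and dividing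
  by N. What remains is governed by H on the window, and continuity of H gives H(c) as the window
  shrinks.\<close>

definition natural_iso ::
    "('y topology \<Rightarrow> 'c monoid) \<Rightarrow> ('y topology \<Rightarrow> 'y topology \<Rightarrow> ('y \<Rightarrow> 'y) \<Rightarrow> 'c \<Rightarrow> 'c) \<Rightarrow>
     ('y topology \<Rightarrow> 'd monoid) \<Rightarrow> ('y topology \<Rightarrow> 'y topology \<Rightarrow> ('y \<Rightarrow> 'y) \<Rightarrow> 'd \<Rightarrow> 'd) \<Rightarrow>
     ('y topology \<Rightarrow> 'c \<Rightarrow> 'd) \<Rightarrow> bool" where
  "natural_iso F Fm G Gm \<eta> \<longleftrightarrow>
     (\<forall>Y. \<eta> Y \<in> iso (F Y) (G Y)) \<and>
     (\<forall>Y Y' f. continuous_map Y Y' f \<longrightarrow> (\<forall>c\<in>carrier (F Y). \<eta> Y' (Fm Y Y' f c) = Gm Y Y' f (\<eta> Y c)))"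

lemma natural_iso_compose:
  fixes F :: "'y topology \<Rightarrow> 'c monoid"
  assumes "natural_iso F Fm G Gm \<eta>" "natural_iso G Gm K Km \<theta>"
  shows "natural_iso F Fm K Km (\<lambda>Y. \<theta> Y \<circ> \<eta> Y)"
  unfolding natural_iso_def
proof (intro conjI allI impI ballI)
  fix Y show "\<theta> Y \<circ> \<eta> Y \<in> iso (F Y) (K Y)"
    using assms by (auto simp: natural_iso_def intro: iso_set_trans)
next
  fix Y Y' :: "'y topology" and f c assume "continuous_map Y Y' f" "c \<in> carrier (F Y)"
  moreover from this have "\<eta> Y c \<in> carrier (G Y)"
    using assms(1) by (auto simp: natural_iso_def iso_def hom_def)
  ultimately show "(\<theta> Y' \<circ> \<eta> Y') (Fm Y Y' f c) = Km Y Y' f ((\<theta> Y \<circ> \<eta> Y) c)"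
    using assms by (simp add: natural_iso_def)
qed

text \<open>Excision maps the smaller pair into the larger one, against the direction in which the
  isomorphisms are chained later, so it enters through its inverse.\<close>

lemma natural_iso_inverse:
  fixes F :: "'y topology \<Rightarrow> 'c monoid" and G :: "'y topology \<Rightarrow> 'd monoid"
  assumes \<eta>: "natural_iso F Fm G Gm \<eta>" and grp: "\<And>Y. group (F Y)"
    and Fm: "\<And>Y Y' f c. continuous_map Y Y' f \<Longrightarrow> c \<in> carrier (F Y) \<Longrightarrow> Fm Y Y' f c \<in> carrier (F Y')"
  shows "natural_iso G Gm F Fm (\<lambda>Y. inv_into (carrier (F Y)) (\<eta> Y))"
  unfolding natural_iso_def
proof (intro conjI allI impI ballI)
  fix Y show "inv_into (carrier (F Y)) (\<eta> Y) \<in> iso (G Y) (F Y)"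
    using \<eta> grp by (simp add: natural_iso_def group.iso_set_sym)
next
  fix Y Y' :: "'y topology" and f d assume f: "continuous_map Y Y' f" and d: "d \<in> carrier (G Y)"
  have b: "bij_betw (\<eta> Z) (carrier (F Z)) (carrier (G Z))" for Z
    using \<eta> by (simp add: natural_iso_def iso_def)
  obtain c where c: "c \<in> carrier (F Y)" "d = \<eta> Y c"
    using b[of Y] d by (auto simp: bij_betw_def)
  have "Gm Y Y' f d = \<eta> Y' (Fm Y Y' f c)"
    using \<eta> c f by (simp add: natural_iso_def)
  then show "inv_into (carrier (F Y')) (\<eta> Y') (Gm Y Y' f d) =
      Fm Y Y' f (inv_into (carrier (F Y)) (\<eta> Y) d)"
    using c b Fm[OF f c(1)] by (metis bij_betw_def inv_into_f_eq)
qed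

section \<open>Relative homology of product pairs as a functor of the first factor\<close>

abbreviation homology_map :: "int \<Rightarrow> 'x topology \<Rightarrow> 'y topology \<Rightarrow>
    ('x \<Rightarrow> 'y) \<Rightarrow> 'x chain set \<Rightarrow> 'y chain set" where
  "homology_map p X Y f \<equiv> hom_induced p X {} Y {} f"

abbreviation homology_inclusion :: "int \<Rightarrow> 'x topology \<Rightarrow> 'x set \<Rightarrow> 'x chain set \<Rightarrow> 'x chain set" where
  "homology_inclusion p X S \<equiv> homology_map p (subtopology X S) X id"

text \<open>Relative homology only sees the part of \<open>UNIV \<times> L\<close> inside the space,
  so this is the pair (Y \<times> K, Y \<times> L). With \<open>UNIV\<close> the subset is the same
  for all \<open>Y\<close>, and \<open>map_prod f id\<close> preserves it for every
  \<open>f\<close>.\<close>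

abbreviation prod_homology ::
  "int \<Rightarrow> 'k::topological_space set \<Rightarrow> 'k set \<Rightarrow> 'y topology \<Rightarrow> (('y \<times> 'k) chain) set monoid" where
  "prod_homology p K L Y \<equiv> relative_homology_group p (prod_topology Y (top_of_set K)) (UNIV \<times> L)"

abbreviation prod_induced ::
  "int \<Rightarrow> 'k::topological_space set \<Rightarrow> 'k set \<Rightarrow> 'y topology \<Rightarrow> 'y topology \<Rightarrow> ('y \<Rightarrow> 'y) \<Rightarrow>
   (('y \<times> 'k) chain) set \<Rightarrow> (('y \<times> 'k) chain) set" where
  "prod_induced p K L Y Y' f \<equiv>
     hom_induced p (prod_topology Y (top_of_set K)) (UNIV \<times> L)
       (prod_topology Y' (top_of_set K)) (UNIV \<times> L) (map_prod f id)"

abbreviation natural_prod_iso ::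
  "int \<Rightarrow> 'k::topological_space set \<Rightarrow> 'k set \<Rightarrow> int \<Rightarrow> 'l::topological_space set \<Rightarrow> 'l set \<Rightarrow>
   ('y topology \<Rightarrow> ('y \<times> 'k) chain set \<Rightarrow> ('y \<times> 'l) chain set) \<Rightarrow> bool" where
  "natural_prod_iso p K L q K' L' \<equiv>
     natural_iso (prod_homology p K L) (prod_induced p K L) (prod_homology q K' L') (prod_induced q K' L')"

abbreviation natural_base_iso ::
  "int \<Rightarrow> 'k::topological_space set \<Rightarrow> 'k set \<Rightarrow> int \<Rightarrow>
   ('y topology \<Rightarrow> ('y \<times> 'k) chain set \<Rightarrow> 'y chain set) \<Rightarrow> bool" where
  "natural_base_iso p K L q \<equiv>
     natural_iso (prod_homology p K L) (prod_induced p K L)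
       (homology_group q) (homology_map q)"

lemma continuous_map_map_prod:
  assumes "continuous_map X X' f" "continuous_map Y Y' g"
  shows "continuous_map (prod_topology X Y) (prod_topology X' Y') (map_prod f g)"
  using assms unfolding map_prod_def by (simp add: continuous_map_prod_top)

text \<open>A map of the first factor commutes with a map of the second: both composites are induced
  by \<open>map_prod f g\<close>. Only bijectivity has to be supplied.\<close>

lemma natural_iso_second_factor:
  fixes g :: "'k::topological_space \<Rightarrow> 'k2::topological_space"
  assumes "continuous_map (top_of_set K) (top_of_set K') g" "g \<in> L \<rightarrow> L'"
    and iso: "\<And>Y :: 'y topology. hom_induced p (prod_topology Y (top_of_set K)) (UNIV \<times> L)
             (prod_topology Y (top_of_set K')) (UNIV \<times> L') (map_prod id g)
           \<in> iso (prod_homology p K L Y) (prod_homology p K' L' Y)"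
  shows "natural_prod_iso p K L p K' L'
           (\<lambda>Y :: 'y topology. hom_induced p (prod_topology Y (top_of_set K)) (UNIV \<times> L)
             (prod_topology Y (top_of_set K')) (UNIV \<times> L') (map_prod id g))"
  unfolding natural_iso_def
proof (intro conjI allI impI ballI)
  fix Y Y' :: "'y topology" and f c assume "continuous_map Y Y' f"
  then show "hom_induced p (prod_topology Y' (top_of_set K)) (UNIV \<times> L) (prod_topology Y' (top_of_set K'))
        (UNIV \<times> L') (map_prod id g) (prod_induced p K L Y Y' f c) =
       prod_induced p K' L' Y Y' f
        (hom_induced p (prod_topology Y (top_of_set K)) (UNIV \<times> L) (prod_topology Y (top_of_set K'))
          (UNIV \<times> L') (map_prod id g) c)"
    using assms(1,2)
    by (subst (1 2) hom_induced_compose')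
      (auto intro!: continuous_map_map_prod simp: map_prod.comp Pi_iff simp del:
          continuous_map_subtopology_eu)
qed (rule iso)

lemma homotopic_with_map_prod_pairs:
  assumes "homotopic_with (\<lambda>h. h \<in> L \<rightarrow> L) (top_of_set K) (top_of_set K) g id"
  shows "homotopic_with (\<lambda>h. h \<in> UNIV \<times> L \<rightarrow> UNIV \<times> L) (prod_topology Y (top_of_set K))
      (prod_topology Y (top_of_set K))
           (map_prod id g) id"
proof -
  have Y: "homotopic_with (\<lambda>h. True) Y Y id id" by simp
  have "homotopic_with (\<lambda>h. h \<in> UNIV \<times> L \<rightarrow> UNIV \<times> L) (prod_topology Y (top_of_set K))
      (prod_topology Y (top_of_set K))
       (\<lambda>z. (id (fst z), g (snd z))) (\<lambda>z. (id (fst z), id (snd z)))"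
    by (rule homotopic_with_prod_topology[OF Y assms]) (auto simp: Pi_iff)
  then show ?thesis by (simp add: map_prod_def case_prod_unfold id_def)
qed

lemma homotopic_with_map_prod_id:
  assumes "homotopic_with (\<lambda>h. True) (top_of_set K) (top_of_set K) g id"
  shows "homotopic_with (\<lambda>h. True) (prod_topology Y (top_of_set K)) (prod_topology Y (top_of_set K))
           (map_prod id g) id"
  using homotopic_with_map_prod_pairs[of UNIV K g Y] assms by simp

text \<open>The projection has the homotopy inverse y \<mapsto> (y, a), where \<open>a\<close> is
  the point to which \<open>C\<close> contracts.\<close>

lemma iso_contractible_factor:
  assumes "contractible C" "C \<noteq> {}"
  shows "homology_map p (prod_topology Y (top_of_set C)) Y fst
           \<in> iso (homology_group p (prod_topology Y (top_of_set C))) (homology_group p Y)"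
proof -
  obtain a where h: "homotopic_with_canon (\<lambda>x. True) C C id (\<lambda>x. a)"
    using assms(1) by (auto simp: contractible_def)
  then have a: "a \<in> C"
    using assms(2) homotopic_with_imp_funspace2 by fastforce
  show ?thesis
  proof (rule homotopy_equivalence_homology_group_isomorphism)
    show "continuous_map (prod_topology Y (top_of_set C)) Y fst" by (rule continuous_map_fst)
    show "continuous_map Y (prod_topology Y (top_of_set C)) (\<lambda>y. (y, a))"
      using a by (auto intro: continuous_map_pairedI)
    have "homotopic_with (\<lambda>x. True) (top_of_set C) (top_of_set C) (\<lambda>x. a) id"
      using h by (simp add: homotopic_with_sym)
    from homotopic_with_map_prod_id[OF this]
    show "homotopic_with (\<lambda>h. True) (prod_topology Y (top_of_set C)) (prod_topology Y (top_of_set C))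
       ((\<lambda>y. (y, a)) \<circ> fst) id"
      by (simp add: map_prod_def case_prod_unfold comp_def)
    show "homotopic_with (\<lambda>k. True) Y Y (fst \<circ> (\<lambda>y. (y, a))) id"
      by (simp add: comp_def id_def[symmetric])
  qed
qed

lemma prod_topology_subset_factor:
  assumes "L \<subseteq> K"
  shows "subtopology (prod_topology Y (top_of_set K)) (UNIV \<times> L) = prod_topology Y (top_of_set L)"
  using assms by (simp add: subtopology_Times subtopology_subtopology inf.absorb2)

text \<open>Two out of three: \<open>h\<close> is \<open>f\<close> followed by the inverse of
  \<open>g\<close>.\<close>

lemma iso_of_comp_iso:
  assumes f: "f \<in> iso A C" and g: "g \<in> iso B C" and h: "h \<in> hom A B"
    and e: "\<And>x. x \<in> carrier A \<Longrightarrow> g (h x) = f x"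
  shows "h \<in> iso A B"
proof -
  have bf: "bij_betw f (carrier A) (carrier C)" and bg: "bij_betw g (carrier B) (carrier C)"
    using f g by (auto simp: iso_def)
  have im: "h ` carrier A \<subseteq> carrier B" using h by (auto simp: hom_def)
  have "bij_betw h (carrier A) (carrier B)"
  proof (rule bij_betw_imageI)
    show "inj_on h (carrier A)"
      using bf e by (metis bij_betw_def inj_on_def)
    show "h ` carrier A = carrier B"
    proof (intro equalityI subsetI)
      fix x assume x: "x \<in> carrier B"
      then have "g x \<in> f ` carrier A"
        using bf bg by (auto simp: bij_betw_def)
      then obtain c where c: "c \<in> carrier A" "g x = g (h c)" using e by auto
      then have "x = h c"
        using bg x im by (auto simp: bij_betw_def inj_on_def)
      then show "x \<in> h ` carrier A" using c by blast
    qed (use im in auto)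
  qed
  then show ?thesis using h by (simp add: iso_def)
qed

text \<open>In the long exact sequence of the pair the relative group sits between inclusions Y
  \<times> D \<rightarrow> Y \<times> C that are isomorphisms, since both spaces project
  isomorphically to \<open>Y\<close> in homology.\<close>

lemma trivial_prod_homology:
  assumes C: "contractible C" "C \<noteq> {}" and D: "contractible D" "D \<noteq> {}" and "D \<subseteq> C"
  shows "trivial_group (prod_homology p C D Y)"
proof (rule exact_seq_imp_triviality)
  let ?X = "prod_topology Y (top_of_set C)" and ?Z = "prod_topology Y (top_of_set D)"
  let ?S = "UNIV \<times> D"
  show "exact_seq ([homology_group (p-1) ?X,
                    homology_group (p-1) (subtopology ?X ?S),
                    relative_homology_group p ?X ?S, homology_group p ?X, homology_group p
                        (subtopology ?X ?S)],
                   [homology_map (p-1) (subtopology ?X ?S) ?X id,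
                    hom_boundary p ?X ?S,
                    hom_induced p ?X {} ?X ?S id,
                    homology_map p (subtopology ?X ?S) ?X id])"
    using homology_exactness_axiom_1[of p ?X ?S] homology_exactness_axiom_2[of p ?X ?S]
      homology_exactness_axiom_3[of p ?X ?S] unfolding exact_seq_cons_iff by blast
  have sub: "subtopology ?X ?S = ?Z" using assms by (simp add: prod_topology_subset_factor)
  have incl: "homology_map q ?Z ?X id \<in> iso (homology_group q ?Z) (homology_group q ?X)" for q
  proof -
    have ci: "continuous_map ?Z ?X id"
      using continuous_map_from_subtopology[OF continuous_map_id, of ?X ?S] by (simp only: sub)
    show ?thesis
    proof (rule iso_of_comp_iso)
      show "homology_map q ?X Y fst (homology_map q ?Z ?X id c) = homology_map q ?Z Y fst c" for c
        by (subst hom_induced_compose'[OF ci]) (auto simp: continuous_map_fst)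
    qed (rule iso_contractible_factor[OF D] iso_contractible_factor[OF C] hom_induced_hom)+
  qed
  show "homology_inclusion p ?X ?S
        \<in> iso (homology_group p (subtopology ?X ?S)) (homology_group p ?X)"
       "homology_inclusion (p-1) ?X ?S
        \<in> iso (homology_group (p-1) (subtopology ?X ?S)) (homology_group (p-1) ?X)"
    unfolding sub by (rule incl)+
qed

text \<open>The homotopies respect \<open>L\<close> and \<open>L'\<close>; multiplied by the
  constant homotopy of \<open>Y\<close> they become homotopies of pairs.\<close>

lemma natural_iso_homotopy_equivalence:
  fixes g :: "'k::topological_space \<Rightarrow> 'k2::topological_space"
  assumes g: "continuous_map (top_of_set K) (top_of_set K') g" "g \<in> L \<rightarrow> L'"
    and h: "continuous_map (top_of_set K') (top_of_set K) h" "h \<in> L' \<rightarrow> L"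
    and hg: "homotopic_with (\<lambda>f. f \<in> L \<rightarrow> L) (top_of_set K) (top_of_set K) (h \<circ> g) id"
    and gh: "homotopic_with (\<lambda>f. f \<in> L' \<rightarrow> L') (top_of_set K') (top_of_set K') (g \<circ> h) id"
  shows "\<exists>\<eta>. natural_prod_iso p K L p K' L' (\<eta> :: 'y topology \<Rightarrow> _)"
proof
  show "natural_prod_iso p K L p K' L'
           (\<lambda>Y :: 'y topology. hom_induced p (prod_topology Y (top_of_set K)) (UNIV \<times> L)
             (prod_topology Y (top_of_set K')) (UNIV \<times> L') (map_prod id g))"
  proof (rule natural_iso_second_factor[OF g])
    fix Y :: "'y topology"
    show "hom_induced p (prod_topology Y (top_of_set K)) (UNIV \<times> L)
             (prod_topology Y (top_of_set K')) (UNIV \<times> L') (map_prod id g)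
           \<in> iso (prod_homology p K L Y) (prod_homology p K' L' Y)"
    proof (rule homotopy_equivalence_relative_homology_group_isomorphism)
      show "continuous_map (prod_topology Y (top_of_set K)) (prod_topology Y (top_of_set K'))
          (map_prod id g)"
        "continuous_map (prod_topology Y (top_of_set K')) (prod_topology Y (top_of_set K)) (map_prod id h)"
        by (intro continuous_map_map_prod continuous_map_id g h)+
      show "homotopic_with (\<lambda>f. f \<in> UNIV \<times> L \<rightarrow> UNIV \<times> L) (prod_topology Y (top_of_set K))
          (prod_topology Y (top_of_set K)) (map_prod id h \<circ> map_prod id g) id"
        "homotopic_with (\<lambda>f. f \<in> UNIV \<times> L' \<rightarrow> UNIV \<times> L') (prod_topology Y (top_of_set K'))
          (prod_topology Y (top_of_set K')) (map_prod id g \<circ> map_prod id h) id"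
        using homotopic_with_map_prod_pairs[OF hg] homotopic_with_map_prod_pairs[OF gh]
        by (simp_all add: map_prod.comp)
    qed (use g h in auto)
  qed
qed

text \<open>As \<open>C\<close> is closed and \<open>N\<close> open in \<open>S\<close>, the closure
  of Y \<times> C stays inside the interior of Y \<times> N, for every \<open>Y\<close>. Naturality
  is the case of the identity on the second factor.\<close>

lemma natural_iso_excision:
  fixes S :: "'k::topological_space set"
  assumes C: "closedin (top_of_set S) C" and N: "openin (top_of_set S) N" and "C \<subseteq> N"
  shows "\<exists>\<eta>. natural_prod_iso p (S - C) (N - C) p S N (\<eta> :: 'y topology \<Rightarrow> _)"
proof
  have NS: "N \<subseteq> S" using N openin_subset by fastforce
  show "natural_prod_iso p (S - C) (N - C) p S N
           (\<lambda>Y :: 'y topology. hom_induced p (prod_topology Y (top_of_set (S - C))) (UNIV \<times> (N - C))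
             (prod_topology Y (top_of_set S)) (UNIV \<times> N) (map_prod id id))"
  proof (rule natural_iso_second_factor)
    fix Y :: "'y topology"
    let ?X = "prod_topology Y (top_of_set S)"
    have "Y interior_of UNIV = topspace Y"
      by (metis Int_UNIV_right interior_of_restrict interior_of_topspace)
    then have 1: "?X closure_of (UNIV \<times> C) \<subseteq> ?X interior_of (UNIV \<times> N)"
      using assms
      by (auto simp: closure_of_Times interior_of_Times closure_of_closedin interior_of_openin
        dest: in_closure_of[THEN iffD1])
    have 2: "subtopology ?X (UNIV - UNIV \<times> C) = prod_topology Y (top_of_set (S - C))"
    proof -
      have "UNIV - UNIV \<times> C = (UNIV :: 'y set) \<times> - C" by auto
      then show ?thesis by (simp add: subtopology_Times subtopology_subtopology Diff_eq)
    qed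
    have 3: "UNIV \<times> N - UNIV \<times> C = (UNIV :: 'y set) \<times> (N - C)" by auto
    show "hom_induced p (prod_topology Y (top_of_set (S - C))) (UNIV \<times> (N - C))
             ?X (UNIV \<times> N) (map_prod id id) \<in> iso (prod_homology p (S - C) (N - C) Y)
                 (prod_homology p S N Y)"
      using homology_excision_axiom[OF 1, of UNIV p] unfolding 2 3 prod.map_id0 by simp
  qed auto
qed

text \<open>In the exact sequence of the triple, both groups of (Y \<times> K, Y \<times> N) next to
  the boundary map vanish because \<open>K\<close> and \<open>N\<close> are contractible.\<close>

lemma natural_iso_triple:
  fixes N L K :: "'k::topological_space set"
  assumes K: "contractible K" "K \<noteq> {}" and N: "contractible N" "N \<noteq> {}" and "N \<subseteq> L" "L \<subseteq> K"
  shows "\<exists>\<eta>. natural_prod_iso p K L (p-1) L N (\<eta> :: 'y topology \<Rightarrow> _)"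
proof
  show "natural_prod_iso p K L (p-1) L N
           (\<lambda>Y :: 'y topology. hom_relboundary p (prod_topology Y (top_of_set K)) (UNIV \<times> L) (UNIV \<times> N))"
    unfolding natural_iso_def
  proof (intro conjI allI impI ballI)
    fix Y :: "'y topology"
    let ?X = "prod_topology Y (top_of_set K)"
    have sub: "(UNIV :: 'y set) \<times> N \<subseteq> UNIV \<times> L" using assms by auto
    have e: "subtopology ?X (UNIV \<times> L) = prod_topology Y (top_of_set L)"
      using assms by (simp add: prod_topology_subset_factor)
    have "hom_relboundary p ?X (UNIV \<times> L) (UNIV \<times> N) \<in>
        iso (prod_homology p K L Y) (relative_homology_group (p-1) (subtopology ?X (UNIV \<times> L)) (UNIV \<times> N))"
    proof (rule very_short_exact_sequence)
      show "exact_seq ([prod_homology (p-1) K N Y,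
           relative_homology_group (p-1) (subtopology ?X (UNIV \<times> L)) (UNIV \<times> N),
           prod_homology p K L Y, prod_homology p K N Y],
          [hom_induced (p-1) (subtopology ?X (UNIV \<times> L)) (UNIV \<times> N) ?X (UNIV \<times> N) id,
           hom_relboundary p ?X (UNIV \<times> L) (UNIV \<times> N), hom_induced p ?X (UNIV \<times> N) ?X (UNIV \<times> L) id])"
        using homology_exactness_triple_1[OF sub, of p ?X] homology_exactness_triple_2[OF sub, of p ?X]
        unfolding exact_seq_cons_iff by blast
    qed (use assms in \<open>auto intro!: trivial_prod_homology\<close>)
    then show "hom_relboundary p ?X (UNIV \<times> L) (UNIV \<times> N) \<in> iso (prod_homology p K L Y)
        (prod_homology (p-1) L N Y)"
      unfolding e .
  next
    fix Y Y' :: "'y topology" and f c assume f: "continuous_map Y Y' f"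
    have "continuous_map (prod_topology Y (top_of_set K)) (prod_topology Y' (top_of_set K)) (map_prod f id)"
      by (intro continuous_map_map_prod f continuous_map_id)
    from fun_cong[OF naturality_hom_induced_relboundary[OF this, of "UNIV \<times> L" "UNIV \<times> L" "UNIV \<times> N"
        "UNIV \<times> N" p], of c]
    show "hom_relboundary p (prod_topology Y' (top_of_set K)) (UNIV \<times> L) (UNIV \<times> N)
        (prod_induced p K L Y Y' f c) =
       prod_induced (p - 1) L N Y Y' f
        (hom_relboundary p (prod_topology Y (top_of_set K)) (UNIV \<times> L) (UNIV \<times> N) c)"
      using assms by (simp add: prod_topology_subset_factor Pi_iff)
  qed
qed

text \<open>Euclidean space of dimension \<open>card B\<close>, kept inside one fixed type so that
  the dimension can vary in an induction.\<close>

definition coord_space :: "'b::euclidean_space set \<Rightarrow> 'b set" where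
  "coord_space B = {x. \<forall>i\<in>Basis - B. x \<bullet> i = 0}"

lemma convex_coord_space: "convex (coord_space B)"
  unfolding coord_space_def convex_def by (auto simp: inner_simps)

text \<open>
  Let \<open>K\<close> be the larger coordinate space and \<open>N\<close> the complement in \<open>K\<close> of the ray from the origin in the direction \<open>b\<close>.
  Both are contractible, so the boundary of the triple \<open>(K, K - {0}, N)\<close> is an isomorphism. Then the
  points with \<open>x \<bullet> b \<le> 0\<close> are excised and the rest is projected along \<open>b\<close>.
\<close>

lemma natural_iso_coord_step:
  fixes b :: "'b::euclidean_space"
  assumes b: "b \<in> Basis" "b \<notin> B" and B: "B \<subseteq> Basis"
  shows "\<exists>\<eta>. natural_prod_iso p (coord_space (insert b B)) (coord_space (insert b B) - {0}) (p-1)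
      (coord_space B) (coord_space B - {0}) (\<eta> :: 'y topology \<Rightarrow> _)"
proof -
  define K where "K = coord_space (insert b B)"
  define \<pi> where "\<pi> x = x - (x \<bullet> b) *\<^sub>R b" for x :: 'b
  define N where "N = {x \<in> K. x \<bullet> b < 0 \<or> \<pi> x \<noteq> 0}"
  define C where "C = {x \<in> K - {0}. x \<bullet> b \<le> 0}"
  define K' where "K' = coord_space B"
  have bb: "b \<bullet> b = 1" using b by simp
  have cont\<pi>: "continuous_on S \<pi>" for S unfolding \<pi>_def by (intro continuous_intros)
  have \<pi>K: "\<pi> x \<in> K'" if "x \<in> K" for x
    using that b by (auto simp: K_def K'_def coord_space_def \<pi>_def inner_simps inner_Basis)
  have K'K: "x + c *\<^sub>R b \<in> K" "x \<bullet> b = 0" if "x \<in> K'" for x c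
    using that b by (auto simp: K_def K'_def coord_space_def inner_simps inner_Basis)
  have \<pi>K': "\<pi> (x + c *\<^sub>R b) = x" if "x \<in> K'" for x c
    using K'K[OF that] bb by (simp add: \<pi>_def inner_simps)
  have convK: "convex K" unfolding K_def by (rule convex_coord_space)
  have K0: "0 \<in> K" by (simp add: K_def coord_space_def)
  have mbK: "- b \<in> K" using b by (auto simp: K_def coord_space_def inner_Basis)
  have NL: "N \<subseteq> K - {0}" by (auto simp: N_def \<pi>_def)
  have mbN: "- b \<in> N" using mbK bb by (simp add: N_def)
  \<comment> \<open>The centre is \<open>- b\<close>. Along a segment from \<open>- b\<close> to
    \<open>x\<close> the component off the axis is scaled by \<open>u\<close>, so it stays non-zero
    if it is non-zero at \<open>x\<close> and \<open>u > 0\<close>; otherwise the coordinate along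
    \<open>b\<close> is negative on the whole segment.\<close>
  have "starlike N"
    unfolding starlike_def
  proof (intro bexI[of _ "- b"] ballI subsetI)
    fix x y assume x: "x \<in> N" and "y \<in> closed_segment (- b) x"
    then obtain u where u: "0 \<le> u" "u \<le> 1" and y: "y = (1 - u) *\<^sub>R (- b) + u *\<^sub>R x"
      by (auto simp: closed_segment_def)
    have yK: "y \<in> K" unfolding y using convexD[OF convK mbK, of x "1 - u" u] x u by (auto simp: N_def)
    have yb: "y \<bullet> b = - (1 - u) + u * (x \<bullet> b)" by (simp add: y inner_simps bb)
    have \<pi>y: "\<pi> y = u *\<^sub>R \<pi> x" unfolding \<pi>_def yb by (simp add: y algebra_simps)
    show "y \<in> N"
    proof (cases "u > 0 \<and> \<pi> x \<noteq> 0")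
      case True then show ?thesis using yK by (simp add: N_def \<pi>y)
    next
      case False
      then consider "u = 0" | "u > 0" "x \<bullet> b < 0"
        using x u by (cases "u = 0") (auto simp: N_def order_less_le)
      then have "y \<bullet> b < 0"
      proof cases
        case 2 then have "u * (x \<bullet> b) < 0" by (simp add: mult_pos_neg)
        then show ?thesis using yb u by linarith
      qed (use yb in simp)
      then show ?thesis using yK by (simp add: N_def)
    qed
  qed (use mbN in auto)
  then have cN: "contractible N" by (rule starlike_imp_contractible)
  have cK: "contractible K" using convK by (rule convex_imp_contractible)
  have closedC: "closedin (top_of_set (K - {0})) C"
  proof -
    have "C = (K - {0}) \<inter> {x. x \<bullet> b \<le> 0}" by (auto simp: C_def)
    moreover have "closed {x. x \<bullet> b \<le> 0}" using closed_halfspace_le[of b 0] by (simp add: inner_commute)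
    ultimately show ?thesis by (simp add: closedin_closed_Int)
  qed
  have openN: "openin (top_of_set (K - {0})) N"
  proof -
    have "N = (K - {0}) \<inter> ({x. x \<bullet> b < 0} \<union> \<pi> -` (- {0}))" by (auto simp: N_def \<pi>_def)
    moreover have "open {x. x \<bullet> b < 0}" using open_halfspace_lt[of b 0] by (simp add: inner_commute)
    moreover have "open (\<pi> -` (- {0}))" using cont\<pi>[of UNIV] by (intro open_vimage) auto
    ultimately show ?thesis by (simp add: openin_open_Int open_Un)
  qed
  have CN: "C \<subseteq> N"
  proof
    fix x assume x: "x \<in> C"
    show "x \<in> N"
    proof (cases "x \<bullet> b = 0")
      case True then have "\<pi> x = x" by (simp add: \<pi>_def)
      then show ?thesis using x by (auto simp: N_def C_def)
    qed (use x in \<open>auto simp: N_def C_def\<close>)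
  qed
  \<comment> \<open>After excision: \<open>P\<close> is the open half-space and \<open>Q\<close> its
    points off the axis, so \<open>\<pi>\<close> compares (P, Q) with the smaller coordinate space
    and its complement of 0.\<close>
  define P where "P = K - {0} - C"
  define Q where "Q = N - C"
  have P: "P = {x \<in> K. x \<bullet> b > 0}" by (auto simp: P_def C_def)
  have Q: "Q = {x \<in> P. \<pi> x \<noteq> 0}" by (auto simp: P Q_def C_def N_def \<pi>_def)
  have "\<exists>\<eta>. natural_prod_iso (p-1) P Q (p-1) K' (K' - {0}) (\<eta> :: 'y topology \<Rightarrow> _)"
  proof (rule natural_iso_homotopy_equivalence)
    show "continuous_map (top_of_set P) (top_of_set K') \<pi>"
      using cont\<pi> \<pi>K by (auto simp: P)
    show "\<pi> \<in> Q \<rightarrow> K' - {0}" using \<pi>K by (auto simp: Q P)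
    show "continuous_map (top_of_set K') (top_of_set P) (\<lambda>x. x + 1 *\<^sub>R b)"
      using K'K(1)[of _ 1] K'K(2) bb by (auto simp: P inner_simps intro!: continuous_intros)
    show "(\<lambda>x. x + 1 *\<^sub>R b) \<in> K' - {0} \<rightarrow> Q"
      using K'K(1)[of _ 1] K'K(2) \<pi>K'[of _ 1] bb by (auto simp: Q P inner_simps)
    show "homotopic_with (\<lambda>f. f \<in> K' - {0} \<rightarrow> K' - {0}) (top_of_set K') (top_of_set K') (\<pi> \<circ>
        (\<lambda>x. x + 1 *\<^sub>R b)) id"
      using \<pi>K'[of _ 1] by (intro homotopic_with_equal) (auto intro: continuous_map_eq[OF
          continuous_map_id])
    show "homotopic_with (\<lambda>f. f \<in> Q \<rightarrow> Q) (top_of_set P) (top_of_set P) ((\<lambda>x. x + 1 *\<^sub>R b) \<circ> \<pi>) id"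
      unfolding homotopic_with_def
    proof (intro exI conjI allI ballI)
      \<comment> \<open>The straight-line homotopy changes only the coordinate along
        \<open>b\<close>, which stays positive as a convex combination of 1 and
        \<open>x \<bullet> b\<close>. Since \<open>\<pi>\<close> is constant along it,
        \<open>Q\<close> is preserved.\<close>
      let ?h = "\<lambda>(t::real, x). (1 - t) *\<^sub>R (\<pi> x + b) + t *\<^sub>R x"
      have h: "?h (t, x) = \<pi> x + ((1 - t) + t * (x \<bullet> b)) *\<^sub>R b" for t x
        by (simp add: \<pi>_def algebra_simps)
      have hP: "?h (t, x) \<in> P" "\<pi> (?h (t, x)) = \<pi> x" if "x \<in> P" "t \<in> {0..1}" for x t
      proof -
        have x: "x \<in> K" "x \<bullet> b > 0" using that by (auto simp: P)
        have "(1 - t) + t * (x \<bullet> b) > 0"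
          using x that by (cases "t = 0") (auto intro: add_nonneg_pos)
        moreover have "?h (t, x) \<bullet> b = (1 - t) + t * (x \<bullet> b)"
          unfolding h using K'K(2)[OF \<pi>K[OF x(1)]] bb by (simp add: inner_simps)
        ultimately show "?h (t, x) \<in> P"
          unfolding P using K'K(1)[OF \<pi>K[OF x(1)]] h by auto
        show "\<pi> (?h (t, x)) = \<pi> x" unfolding h using \<pi>K'[OF \<pi>K[OF x(1)]] .
      qed
      show "continuous_map (prod_topology (top_of_set {0..1}) (top_of_set P)) (top_of_set P) ?h"
        using hP(1) by (auto simp: case_prod_unfold \<pi>_def intro!: continuous_intros)
      show "?h (0, x) = ((\<lambda>x. x + 1 *\<^sub>R b) \<circ> \<pi>) x" "?h (1, x) = id x" for x by auto
      show "(\<lambda>x. ?h (t, x)) \<in> Q \<rightarrow> Q" if "t \<in> {0..1}" for t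
        using hP[OF _ that] by (auto simp: Q)
    qed
  qed
  then obtain \<eta>3 :: "'y topology \<Rightarrow> _" where \<eta>3: "natural_prod_iso (p-1) P Q (p-1) K' (K' - {0}) \<eta>3" ..
  from natural_iso_excision[OF closedC openN CN, of "p-1"]
  obtain \<eta>2 :: "'y topology \<Rightarrow> _" where "natural_prod_iso (p-1) P Q (p-1) (K - {0}) N \<eta>2"
    unfolding P_def Q_def ..
  then have \<eta>2: "natural_prod_iso (p-1) (K - {0}) N (p-1) P Q
     (\<lambda>Y. inv_into (carrier (prod_homology (p-1) P Q Y)) (\<eta>2 Y))"
    by (rule natural_iso_inverse) (auto simp: hom_induced_carrier)
  have "\<exists>\<eta>. natural_prod_iso p K (K - {0}) (p-1) (K - {0}) N (\<eta> :: 'y topology \<Rightarrow> _)"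
    using cK cN NL K0 mbN by (intro natural_iso_triple) auto
  then obtain \<eta>1 :: "'y topology \<Rightarrow> _" where \<eta>1: "natural_prod_iso p K (K - {0}) (p-1) (K - {0}) N \<eta>1" ..
  from natural_iso_compose[OF natural_iso_compose[OF \<eta>1 \<eta>2] \<eta>3]
  show ?thesis unfolding K_def K'_def by blast
qed

section \<open>The Thom isomorphism of a sphere factor\<close>

text \<open>Each coordinate removed lowers the degree by one. At the end the second factor is the
  pair of a point and the empty set, where the projection to \<open>Y\<close> is an
  isomorphism.\<close>

lemma natural_iso_coord_space:
  fixes B :: "'b::euclidean_space set"
  assumes "B \<subseteq> Basis"
  shows "\<exists>\<eta>. natural_base_iso (p + int (card B)) (coord_space B) (coord_space B - {0}) p
      (\<eta> :: 'y topology \<Rightarrow> _)"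
  using finite_subset[OF assms finite_Basis] assms
proof (induction B rule: finite_induct)
  case empty
  have e: "coord_space {} = {0 :: 'b}"
    by (auto simp: coord_space_def intro: euclidean_eqI)
  show ?case
    unfolding e natural_iso_def
    by (rule exI[of _ "\<lambda>Y. homology_map p (prod_topology Y (top_of_set {0})) Y fst"])
      (auto simp: iso_contractible_factor hom_induced_compose' continuous_map_fst continuous_map_map_prod
        fst_comp_map_prod)
next
  case (insert b B)
  then have "B \<subseteq> Basis" by blast
  from insert.IH[OF this] obtain \<theta> :: "'y topology \<Rightarrow> _" where \<theta>: "natural_base_iso (p + int
      (card B)) (coord_space B) (coord_space B - {0}) p \<theta>" ..
  have p: "p + int (card (insert b B)) - 1 = p + int (card B)" using insert by simp
  obtain \<eta> :: "'y topology \<Rightarrow> _" where "natural_prod_iso (p + int (card (insert b B))) (coord_space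
      (insert b B)) (coord_space (insert b B) - {0}) (p + int (card B)) (coord_space B)
      (coord_space B - {0}) \<eta>"
    using natural_iso_coord_step[of b B "p + int (card (insert b B))"] insert unfolding p by auto
  from natural_iso_compose[OF this \<theta>] show ?case by blast
qed

text \<open>Excising the antipode of \<open>a\<close> leaves a punctured sphere, which is Euclidean
  space with \<open>a\<close> in the place of the origin.\<close>

lemma natural_iso_sphere:
  fixes a :: "'b::euclidean_space \<times> real"
  assumes a: "a \<in> sphere 0 1"
  shows "\<exists>\<eta>. natural_base_iso (p + int DIM('b)) (sphere 0 1) (sphere 0 1 - {a}) p (\<eta> :: 'y topology \<Rightarrow> _)"
proof -
  let ?M = "sphere 0 1 :: ('b \<times> real) set" and ?p = "p + int DIM('b)"
  have "a \<noteq> 0" using a by auto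
  then have "- a \<noteq> a" by (metis add.right_inverse scaleR_2 scaleR_eq_0_iff zero_neq_numeral)
  then have ma: "- a \<in> ?M" "- a \<noteq> a" using a by auto
  have "(?M - {- a}) homeomorphic (UNIV :: 'b set)"
    using ma by (intro homeomorphic_punctured_sphere_affine) auto
  then obtain g h where gh: "homeomorphism (?M - {- a}) (UNIV :: 'b set) g h"
    by (auto simp: homeomorphic_def)
  \<comment> \<open>The translation moves the image of \<open>a\<close> to 0.\<close>
  define g' where "g' = (\<lambda>x. g x - g a)"
  define h' where "h' = (\<lambda>y. h (y + g a))"
  have hm: "h y \<in> ?M - {- a}" for y using gh rangeI[of h y] by (simp add: homeomorphism_def)
  have gh': "g (h y) = y" for y using gh by (auto simp: homeomorphism_def)
  have hg': "h (g x) = x" if "x \<in> ?M - {- a}" for x using gh that by (auto simp: homeomorphism_def)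
  have cg: "continuous_on (?M - {- a}) g" and ch: "continuous_on UNIV h"
    using gh by (auto simp: homeomorphism_def)
  have aM: "a \<in> ?M - {- a}" using a ma by simp
  have "\<exists>\<eta>. natural_prod_iso ?p (?M - {- a}) (?M - {a} - {- a}) ?p (UNIV :: 'b set) (UNIV - {0})
      (\<eta> :: 'y topology \<Rightarrow> _)"
  proof (rule natural_iso_homotopy_equivalence)
    show "continuous_map (top_of_set (?M - {- a})) (top_of_set UNIV) g'"
      unfolding g'_def using cg by (auto intro!: continuous_intros)
    show "g' \<in> ?M - {a} - {- a} \<rightarrow> UNIV - {0}"
    proof
      fix x assume x: "x \<in> ?M - {a} - {- a}"
      then have "g x \<noteq> g a" using hg'[of x] hg'[of a] aM by auto
      then show "g' x \<in> UNIV - {0}" by (simp add: g'_def)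
    qed
    have "continuous_on UNIV h'"
      unfolding h'_def by (rule continuous_on_compose2[OF ch]) (auto intro!: continuous_intros)
    then show "continuous_map (top_of_set UNIV) (top_of_set (?M - {- a})) h'"
      using hm by (auto simp: h'_def continuous_map_in_subtopology)
    show "h' \<in> UNIV - {0} \<rightarrow> ?M - {a} - {- a}"
    proof
      fix y :: 'b assume "y \<in> UNIV - {0}"
      then have "g (h' y) \<noteq> g a" by (simp add: h'_def gh')
      then show "h' y \<in> ?M - {a} - {- a}" using hm[of "y + g a"] by (auto simp: h'_def)
    qed
    show "homotopic_with (\<lambda>f. f \<in> ?M - {a} - {- a} \<rightarrow> ?M - {a} - {- a}) (top_of_set (?M - {- a}))
        (top_of_set (?M - {- a})) (h' \<circ> g') id"
      using hg' continuous_on_eq[OF continuous_on_id, of "?M - {- a}" "\<lambda>x. h (g x)"]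
      by (intro homotopic_with_equal) (auto simp: h'_def g'_def intro: continuous_map_eq[OF
          continuous_map_id])
    show "homotopic_with (\<lambda>f. f \<in> UNIV - {0} \<rightarrow> UNIV - {0}) (top_of_set UNIV) (top_of_set UNIV) (g' \<circ> h') id"
      using gh' by (intro homotopic_with_equal) (auto simp: h'_def g'_def intro:
          continuous_map_eq[OF continuous_map_id])
  qed
  then obtain \<eta>2 :: "'y topology \<Rightarrow> _" where \<eta>2: "natural_prod_iso ?p (?M - {- a})
      (?M - {a} - {- a}) ?p (UNIV :: 'b set) (UNIV - {0}) \<eta>2" ..
  have "\<exists>\<eta>. natural_prod_iso ?p (?M - {- a}) (?M - {a} - {- a}) ?p ?M (?M - {a}) (\<eta> :: 'y topology \<Rightarrow> _)"
    using ma by (intro natural_iso_excision) (auto simp: openin_delete)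
  then obtain \<eta>1 :: "'y topology \<Rightarrow> _" where "natural_prod_iso ?p (?M - {- a})
      (?M - {a} - {- a}) ?p ?M (?M - {a}) \<eta>1" ..
  then have \<eta>1: "natural_prod_iso ?p ?M (?M - {a}) ?p (?M - {- a}) (?M - {a} - {- a})
      (\<lambda>Y. inv_into (carrier (prod_homology ?p (?M - {- a}) (?M - {a} - {- a}) Y)) (\<eta>1 Y))"
    by (rule natural_iso_inverse) (auto simp: hom_induced_carrier)
  have "coord_space Basis = (UNIV :: 'b set)" by (simp add: coord_space_def)
  then obtain \<eta>3 :: "'y topology \<Rightarrow> _" where \<eta>3: "natural_base_iso ?p (UNIV :: 'b set) (UNIV - {0}) p \<eta>3"
    using natural_iso_coord_space[of "Basis :: 'b set" p] by auto
  from natural_iso_compose[OF natural_iso_compose[OF \<eta>1 \<eta>2] \<eta>3] show ?thesis by blast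
qed

lemma iso_eq_one_iff:
  assumes f: "f \<in> iso G H" and G: "group G" and H: "group H" and x: "x \<in> carrier G"
  shows "f x = \<one>\<^bsub>H\<^esub> \<longleftrightarrow> x = \<one>\<^bsub>G\<^esub>"
proof -
  have "f \<one>\<^bsub>G\<^esub> = \<one>\<^bsub>H\<^esub>" using f G H by (simp add: iso_def hom_one)
  moreover have "inj_on f (carrier G)" using f by (simp add: iso_def bij_betw_def)
  moreover have "\<one>\<^bsub>G\<^esub> \<in> carrier G" using G by (simp add: group.is_monoid monoid.one_closed)
  ultimately show ?thesis using x by (metis inj_onD)
qed

text \<open>\<open>\<Theta>\<close> behaves like intersection with Y \<times> {a}: pass to homology
  relative to the complement of Y \<times> {a}, then apply the isomorphism of the previous lemma.
  Since Y \<times> (M - {a}) has the homology of the section Y \<times> {b}, which the projection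
  \<open>fst\<close> splits, the long exact sequence breaks up: the section gives the kernel and
  \<open>\<Theta>\<close> is onto, with preimages that project trivially. The last property
  localizes: a class living away from the part of Y \<times> {a} over the complement of
  \<open>V\<close> has an image coming from \<open>V\<close>.\<close>

lemma sphere_product_homology:
  fixes a b :: "'b::euclidean_space \<times> real"
  assumes ab: "a \<in> sphere 0 1" "b \<in> sphere 0 1" "a \<noteq> b"
  defines "r \<equiv> int DIM('b)" and "M \<equiv> top_of_set (sphere 0 1 :: ('b \<times> real) set)"
  obtains \<Theta> :: "int \<Rightarrow> 'y topology \<Rightarrow> ('y \<times> 'b \<times> real) chain set \<Rightarrow> 'y chain set" where
    "\<And>p Y. \<Theta> p Y \<in> hom (homology_group (p + r) (prod_topology Y M)) (homology_group p Y)"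
    "\<And>p Y Y' f c. continuous_map Y Y' f \<Longrightarrow> c \<in> carrier (homology_group (p + r) (prod_topology Y M)) \<Longrightarrow>
       \<Theta> p Y' (homology_map (p + r) (prod_topology Y M) (prod_topology Y' M) (map_prod f id) c) =
       homology_map p Y Y' f (\<Theta> p Y c)"
    "\<And>p Y c. c \<in> carrier (homology_group (p + r) (prod_topology Y M)) \<Longrightarrow>
       \<Theta> p Y c = \<one>\<^bsub>homology_group p Y\<^esub> \<longleftrightarrow>
       c \<in> homology_map (p + r) Y (prod_topology Y M) (\<lambda>y. (y, b)) ` carrier (homology_group (p + r) Y)"
    "\<And>p Y w. w \<in> carrier (homology_group p Y) \<Longrightarrow>
       \<exists>c\<in>carrier (homology_group (p + r) (prod_topology Y M)). \<Theta> p Y c = w \<and>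
         homology_map (p + r) (prod_topology Y M) Y fst c = \<one>\<^bsub>homology_group (p + r) Y\<^esub>"
    "\<And>p Y V c. openin Y V \<Longrightarrow>
       c \<in> carrier (homology_group (p + r) (subtopology (prod_topology Y M) (V \<times> UNIV \<union> UNIV \<times> - {a}))) \<Longrightarrow>
       \<Theta> p Y (homology_inclusion (p + r) (prod_topology Y M) (V \<times> UNIV \<union> UNIV \<times> - {a}) c)
       \<in> homology_inclusion p Y V ` carrier (homology_group p (subtopology Y V))"
proof -
  let ?S = "sphere 0 1 :: ('b \<times> real) set"
  let ?D = "?S - {a}"
  have "\<exists>\<eta>. \<forall>p. natural_base_iso (p + r) ?S ?D p (\<eta> p :: 'y topology \<Rightarrow> _)"
    unfolding r_def using natural_iso_sphere[OF ab(1)] by (intro choice) blast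
  then obtain \<eta> :: "int \<Rightarrow> 'y topology \<Rightarrow> _" where \<eta>: "\<And>p. natural_base_iso (p + r) ?S ?D p (\<eta> p)" by blast
  let ?X = "\<lambda>Y :: 'y topology. prod_topology Y M"
  let ?D' = "UNIV \<times> ?D :: ('y \<times> 'b \<times> real) set"
  let ?j = "\<lambda>q Y. hom_induced q (?X Y) {} (?X Y) ?D' id"
  let ?i = "\<lambda>q Y. homology_map q Y (?X Y) (\<lambda>y. (y, b))"
  let ?fst = "\<lambda>q Y. homology_map q (?X Y) Y fst"
  have \<eta>iso: "\<eta> p Y \<in> iso (relative_homology_group (p + r) (?X Y) ?D') (homology_group p Y)" for p Y
    using \<eta>[of p] by (simp add: natural_iso_def M_def)
  have \<eta>nat: "\<eta> p Y' (hom_induced (p + r) (?X Y) ?D' (?X Y') ?D' (map_prod f id) c)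
      = homology_map p Y Y' f (\<eta> p Y c)"
    if "continuous_map Y Y' f" "c \<in> carrier (relative_homology_group (p + r) (?X Y) ?D')" for p Y Y' f c
    using \<eta>[of p] that by (simp add: natural_iso_def M_def)
  have ci: "continuous_map Y (?X Y) (\<lambda>y. (y, b))" for Y
    using ab by (auto intro!: continuous_map_pairedI simp: M_def)
  have cf: "continuous_map (?X Y) Y fst" for Y by (rule continuous_map_fst)
  have cmp: "continuous_map (?X Y) (?X Y') (map_prod f id)" if "continuous_map Y Y' f" for Y Y' f
    using that by (intro continuous_map_map_prod continuous_map_id)
  have fi: "?fst q Y (?i q Y c) = c" if "c \<in> carrier (homology_group q Y)" for q Y c
    using that by (simp add: hom_induced_compose' ci cf comp_def hom_induced_id_gen)
  define W where "W Y = subtopology (?X Y) ?D'" for Y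
  have W: "W Y = prod_topology Y (top_of_set ?D)" for Y
    unfolding W_def M_def by (rule prod_topology_subset_factor) auto
  have cinc: "continuous_map (W Y) (?X Y) id" for Y
    unfolding W_def by (intro continuous_map_from_subtopology continuous_map_id)
  have contrD: "contractible ?D"
  proof -
    have "?D homeomorphic (UNIV :: 'b set)"
      using ab by (intro homeomorphic_punctured_sphere_affine) auto
    then show ?thesis by (simp add: homeomorphic_contractible_eq)
  qed
  have fstW: "homology_map q (W Y) Y fst \<in> iso (homology_group q (W Y)) (homology_group q Y)" for q Y
    unfolding W using ab by (intro iso_contractible_factor contrD) auto
  have bD: "b \<in> ?D" using ab by auto
  have ciW: "continuous_map Y (W Y) (\<lambda>y. (y, b))" for Y
    unfolding W using bD by (auto intro!: continuous_map_pairedI)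
  have cfW: "continuous_map (W Y) Y fst" for Y unfolding W by (rule continuous_map_fst)
  have fiW: "homology_map q (W Y) Y fst (homology_map q Y (W Y) (\<lambda>y. (y, b)) c) = c"
    if "c \<in> carrier (homology_group q Y)" for q Y c
    using that by (simp add: hom_induced_compose' ciW cfW comp_def hom_induced_id_gen)
  \<comment> \<open>By contractibility of M - {a}, every class of Y \<times> (M - {a}) comes from
    the section at \<open>b\<close>.\<close>
  have imW: "homology_map q (W Y) (?X Y) id ` carrier (homology_group q (W Y)) =
      ?i q Y ` carrier (homology_group q Y)" for q Y
  proof (intro equalityI subsetI)
    fix x assume "x \<in> homology_map q (W Y) (?X Y) id ` carrier (homology_group q (W Y))"
    then obtain w where w: "w \<in> carrier (homology_group q (W Y))" "x = homology_map q (W Y)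
        (?X Y) id w" by blast
    let ?v = "homology_map q (W Y) Y fst w"
    have "homology_map q (W Y) Y fst (homology_map q Y (W Y) (\<lambda>y. (y, b)) ?v) = ?v"
      by (rule fiW) (rule hom_induced_carrier)
    then have "homology_map q Y (W Y) (\<lambda>y. (y, b)) ?v = w"
      using fstW[of q Y] w by (auto simp: iso_def bij_betw_def hom_induced_carrier inj_on_def)
    then have "x = homology_map q (W Y) (?X Y) id (homology_map q Y (W Y) (\<lambda>y. (y, b)) ?v)"
      using w by simp
    also have "\<dots> = ?i q Y ?v"
      by (subst hom_induced_compose') (auto simp: ciW cinc)
    finally show "x \<in> ?i q Y ` carrier (homology_group q Y)"
      by (auto simp: hom_induced_carrier)
  next
    fix x assume "x \<in> ?i q Y ` carrier (homology_group q Y)"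
    then obtain v where v: "x = ?i q Y v" by blast
    then have "x = homology_map q (W Y) (?X Y) id (homology_map q Y (W Y) (\<lambda>y. (y, b)) v)"
      by (subst hom_induced_compose') (auto simp: ciW cinc)
    then show "x \<in> homology_map q (W Y) (?X Y) id ` carrier (homology_group q (W Y))"
      by (auto simp: hom_induced_carrier)
  qed
  have kerj: "?i q Y ` carrier (homology_group q Y) =
      kernel (homology_group q (?X Y)) (relative_homology_group q (?X Y) ?D') (?j q Y)" for q Y
    using homology_exactness_axiom_3[of q "?X Y" ?D'] imW[of q Y] unfolding W_def exact_seq_cons_iff by simp
  have injW: "inj_on (homology_map q (W Y) (?X Y) id) (carrier (homology_group q (W Y)))" for q Y
  proof (rule inj_on_imageI2)
    have "?fst q Y \<circ> homology_map q (W Y) (?X Y) id = homology_map q (W Y) Y fst"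
      by (simp add: cinc cf flip: hom_induced_compose)
    then show "inj_on (?fst q Y \<circ> homology_map q (W Y) (?X Y) id) (carrier (homology_group q (W Y)))"
      using fstW[of q Y] by (simp add: iso_def bij_betw_def)
  qed
  \<comment> \<open>Injectivity of the inclusion one degree lower makes the boundary map zero, and
    exactness then gives surjectivity.\<close>
  have surj: "?j q Y ` carrier (homology_group q (?X Y)) = carrier (relative_homology_group q
      (?X Y) ?D')" for q Y
  proof -
    have E: "exact_seq ([homology_group (q-1) (?X Y), homology_group (q-1) (subtopology (?X Y) ?D'),
        relative_homology_group q (?X Y) ?D', homology_group q (?X Y)],
       [homology_map (q-1) (subtopology (?X Y) ?D') (?X Y) id, hom_boundary q (?X Y) ?D', ?j q Y])"
      using homology_exactness_axiom_1[of q "?X Y" ?D'] homology_exactness_axiom_2[of q "?X Y" ?D']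
      unfolding exact_seq_cons_iff by blast
    show ?thesis
      using exact_seq_mon_eq_triviality[OF E] exact_seq_epi_eq_triviality[OF E] injW[of "q-1" Y]
      by (simp add: W_def)
  qed
  define \<Theta> where "\<Theta> p Y = \<eta> p Y \<circ> ?j (p + r) Y" for p Y
  have \<Theta>hom: "\<Theta> p Y \<in> hom (homology_group (p + r) (?X Y)) (homology_group p Y)" for p Y
    unfolding \<Theta>_def using \<eta>iso[of p Y] by (auto simp: iso_def intro!: hom_compose[OF hom_induced_hom])
  have \<Theta>nat: "\<Theta> p Y' (homology_map (p + r) (?X Y) (?X Y') (map_prod f id) c) = homology_map p Y Y' f
      (\<Theta> p Y c)"
    if f: "continuous_map Y Y' f" for p Y Y' f c
  proof -
    have mm: "map_prod f id \<in> ?D' \<rightarrow> ?D'" by auto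
    have "?j (p + r) Y' (homology_map (p + r) (?X Y) (?X Y') (map_prod f id) c) =
        hom_induced (p + r) (?X Y) ?D' (?X Y') ?D' (map_prod f id) (?j (p + r) Y c)"
      using cmp[OF f] by (simp add: hom_induced_compose' mm)
    then show ?thesis
      unfolding \<Theta>_def comp_def by (simp add: \<eta>nat[OF f] hom_induced_carrier)
  qed
  have \<Theta>ker: "\<Theta> p Y c = \<one>\<^bsub>homology_group p Y\<^esub> \<longleftrightarrow> c \<in> ?i (p + r) Y ` carrier (homology_group (p + r) Y)"
    if c: "c \<in> carrier (homology_group (p + r) (?X Y))" for p Y c
  proof -
    have "\<Theta> p Y c = \<one>\<^bsub>homology_group p Y\<^esub> \<longleftrightarrow> ?j (p + r) Y c = \<one>\<^bsub>relative_homology_group (p + r) (?X Y) ?D'\<^esub>"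
      unfolding \<Theta>_def comp_def
      using \<eta>iso[of p Y] by (intro iso_eq_one_iff) (auto simp: hom_induced_carrier)
    then show ?thesis using c unfolding kerj kernel_def by simp
  qed
  have \<Theta>lift: "\<exists>c\<in>carrier (homology_group (p + r) (?X Y)). \<Theta> p Y c = w \<and> ?fst (p + r) Y c
      = \<one>\<^bsub>homology_group (p + r) Y\<^esub>"
    if w: "w \<in> carrier (homology_group p Y)" for p Y w
  proof -
    let ?H = "homology_group (p + r) (?X Y)" and ?K = "homology_group (p + r) Y"
    interpret \<Theta>: group_hom ?H "homology_group p Y" "\<Theta> p Y"
      using \<Theta>hom by (simp add: group_hom_def group_hom_axioms_def)
    interpret F: group_hom ?H ?K "?fst (p + r) Y"
      by (simp add: group_hom_def group_hom_axioms_def hom_induced_hom)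
    have "w \<in> \<eta> p Y ` carrier (relative_homology_group (p + r) (?X Y) ?D')"
      using w \<eta>iso[of p Y] by (auto simp: iso_def bij_betw_def)
    then obtain c0 where c0: "c0 \<in> carrier ?H" "\<Theta> p Y c0 = w"
      unfolding surj[symmetric] by (auto simp: \<Theta>_def)
    \<comment> \<open>Subtracting the section of the projection kills the projection and leaves
      \<open>\<Theta>\<close> unchanged, as \<open>\<Theta>\<close> vanishes on the section.\<close>
    define v where "v = ?i (p + r) Y (?fst (p + r) Y c0)"
    have v: "v \<in> carrier ?H" "\<Theta> p Y v = \<one>\<^bsub>homology_group p Y\<^esub>" "?fst (p + r) Y v = ?fst (p + r) Y c0"
      unfolding v_def by (auto simp: \<Theta>ker fi hom_induced_carrier)
    show ?thesis
    proof (intro bexI conjI)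
      show "\<Theta> p Y (c0 \<otimes>\<^bsub>?H\<^esub> inv\<^bsub>?H\<^esub> v) = w" using c0 v w by simp
      show "?fst (p + r) Y (c0 \<otimes>\<^bsub>?H\<^esub> inv\<^bsub>?H\<^esub> v) = \<one>\<^bsub>?K\<^esub>" using c0 v by simp
      show "c0 \<otimes>\<^bsub>?H\<^esub> inv\<^bsub>?H\<^esub> v \<in> carrier ?H" using c0 v by simp
    qed
  qed
  have \<Theta>sup: "\<Theta> p Y (homology_inclusion (p + r) (?X Y) (V \<times> UNIV \<union> UNIV \<times> - {a}) c)
       \<in> homology_inclusion p Y V ` carrier (homology_group p (subtopology Y V))"
    if V: "openin Y V" and c: "c \<in> carrier (homology_group (p + r) (subtopology (?X Y) (V \<times> UNIV
        \<union> UNIV \<times> - {a})))"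
    for p Y V c
  proof -
    define Z where "Z = subtopology (?X Y) (V \<times> UNIV \<union> UNIV \<times> - {a})"
    let ?q = "p + r" and ?V = "subtopology Y V"
    have tM: "topspace M = ?S" by (simp add: M_def)
    have cZ: "continuous_map Z (?X Y) id"
      unfolding Z_def by (intro continuous_map_from_subtopology continuous_map_id)
    have cV: "continuous_map ?V Y id" by (intro continuous_map_from_subtopology continuous_map_id)
    \<comment> \<open>The part of \<open>Z\<close> outside V \<times> M. There \<open>a\<close> is
      missing from the second factor, so \<open>U\<close> lies in \<open>?D'\<close> and can be
      excised; the pair that remains is (V \<times> M, V \<times> (M - {a})), to which naturality of
      \<open>\<eta>\<close> for V \<subseteq> Y applies.\<close>
    define U where "U = topspace Z \<inter> ((- V) \<times> UNIV)"
    have U: "U = (topspace Y - V) \<times> ?D" using V[THEN openin_subset] by (auto simp: U_def Z_def tM)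
    have closedU: "closedin Z U"
    proof -
      have "closedin (?X Y) ((topspace Y - V) \<times> ?S)"
        using V tM by (auto simp: closedin_prod_Times_iff closedin_topspace[of M, simplified tM])
      moreover have "U = topspace Z \<inter> ((topspace Y - V) \<times> ?S)" by (auto simp: U_def Z_def tM)
      ultimately show ?thesis unfolding Z_def closedin_subtopology
        by (intro exI[of _ "(topspace Y - V) \<times> ?S"]) (auto simp: tM)
    qed
    have openT: "openin Z (topspace Z \<inter> ?D')"
    proof -
      have "openin (?X Y) (topspace Y \<times> ?D)"
        by (auto simp: openin_prod_Times_iff M_def openin_delete)
      moreover have "topspace Z \<inter> ?D' = (topspace Y \<times> ?D) \<inter> (V \<times> UNIV \<union> UNIV \<times> - {a})"
        by (auto simp: Z_def tM)
      ultimately show ?thesis unfolding Z_def openin_subtopology by blast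
    qed
    have ex: "hom_induced ?q (subtopology Z (UNIV - U)) (topspace Z \<inter> ?D' - U) (subtopology Z UNIV)
        (topspace Z \<inter> ?D') id
       \<in> iso (relative_homology_group ?q (subtopology Z (UNIV - U)) (topspace Z \<inter> ?D' - U))
            (relative_homology_group ?q (subtopology Z UNIV) (topspace Z \<inter> ?D'))"
    proof (rule homology_excision_axiom)
      show "Z closure_of U \<subseteq> Z interior_of (topspace Z \<inter> ?D')"
        unfolding closure_of_closedin[OF closedU] interior_of_openin[OF openT]
        using closedU[THEN closedin_subset] U by auto
    qed auto
    have s1: "subtopology Z (UNIV - U) = ?X ?V"
    proof -
      have "subtopology Z (UNIV - U) = subtopology (?X Y) (topspace (?X Y) \<inter> ((V \<times> UNIV
          \<union> UNIV \<times> - {a}) \<inter> (UNIV - U)))"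
        by (simp only: Z_def subtopology_subtopology subtopology_restrict)
      also have "topspace (?X Y) \<inter> ((V \<times> UNIV \<union> UNIV \<times> - {a}) \<inter> (UNIV - U)) = topspace (?X Y) \<inter> (V \<times> UNIV)"
        by (auto simp: U tM)
      also have "subtopology (?X Y) \<dots> = subtopology (?X Y) (V \<times> UNIV)"
        by (rule subtopology_restrict)
      finally show ?thesis by (simp add: subtopology_Times)
    qed
    have s2: "relative_homology_group ?q (?X ?V) (topspace Z \<inter> ?D' - U) = relative_homology_group ?q
        (?X ?V) ?D'"
    proof -
      have "topspace (?X ?V) \<inter> (topspace Z \<inter> ?D' - U) = topspace (?X ?V) \<inter> ?D'"
        by (auto simp: Z_def U)
      then show ?thesis by (metis relative_homology_group_restrict)
    qed
    have "hom_induced ?q Z {} Z (topspace Z \<inter> ?D') id c \<in> carrier (relative_homology_group ?q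
        (subtopology Z UNIV) (topspace Z \<inter> ?D'))"
      by (simp add: hom_induced_carrier del: relative_homology_group_restrict)
    then obtain d where d: "d \<in> carrier (relative_homology_group ?q (?X ?V) ?D')"
      "hom_induced ?q Z {} Z (topspace Z \<inter> ?D') id c =
       hom_induced ?q (?X ?V) (topspace Z \<inter> ?D' - U) Z (topspace Z \<inter> ?D') id d"
      using ex unfolding s1 s2 by (auto simp: iso_def bij_betw_def simp del:
          relative_homology_group_restrict hom_induced_restrict)
    have cVZ: "continuous_map (?X ?V) Z id"
      unfolding s1[symmetric] by (intro continuous_map_from_subtopology continuous_map_id)
    have "?j ?q Y (homology_map ?q Z (?X Y) id c) = hom_induced ?q Z (topspace Z \<inter> ?D')
        (?X Y) ?D' id (hom_induced ?q Z {} Z (topspace Z \<inter> ?D') id c)"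
      using cZ by (simp add: hom_induced_compose' del: hom_induced_restrict)
    also have "\<dots> = hom_induced ?q (?X ?V) (topspace Z \<inter> ?D' - U) (?X Y) ?D' id d"
      unfolding d(2) using cZ cVZ by (subst hom_induced_compose') auto
    also have "\<dots> = hom_induced ?q (?X ?V) ?D' (?X Y) ?D' (map_prod id id) d"
    proof -
      have "topspace (?X ?V) \<inter> (topspace Z \<inter> ?D' - U) = topspace (?X ?V) \<inter> ?D'"
        by (auto simp: Z_def U)
      then show ?thesis unfolding prod.map_id0 by (metis hom_induced_restrict)
    qed
    finally have "\<Theta> p Y (homology_map ?q Z (?X Y) id c) = homology_map p ?V Y id (\<eta> p ?V d)"
      unfolding \<Theta>_def comp_def using \<eta>nat[OF cV d(1)] by simp
    then show ?thesis using \<eta>iso[of p ?V] d(1) unfolding Z_def by (auto simp: iso_def bij_betw_def)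
  qed
  show thesis
    by (rule that[of \<Theta>]) (rule \<Theta>hom \<Theta>nat \<Theta>ker \<Theta>lift \<Theta>sup; assumption)+
qed

section \<open>Dual bases of homology and cohomology\<close>

text \<open>The additive reals in multiplicative notation, so that \<open>hom\<close> into it
  consists of additive functionals.\<close>

abbreviation real_group :: "real monoid" where
  "real_group \<equiv> \<lparr>carrier = UNIV, mult = (+), one = 0\<rparr>"

lemma group_real_group [simp]: "group real_group"
  by (rule groupI) (auto intro: exI[of _ "- x" for x])

text \<open>The coordinates are abstract maps \<open>\<pi> i\<close>, so that the notion applies to
  spaces of pairs as well as of functions. The second clause says where \<open>z S\<close> is
  carried, the fifth where \<open>e S\<close> dies; duality is demanded only between equal degrees.
  The last clause expresses that the \<open>z S\<close> generate homology after tensoring with the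
  reals, in terms of functionals, so that torsion does not interfere.\<close>

definition homology_dual_basis ::
    "nat \<Rightarrow> 'x topology \<Rightarrow> 'i set \<Rightarrow> ('i \<Rightarrow> 'x \<Rightarrow> 'm::topological_space) \<Rightarrow> 'm set \<Rightarrow> 'm \<Rightarrow> 'm \<Rightarrow>
     ('i set \<Rightarrow> 'x chain set) \<Rightarrow> ('i set \<Rightarrow> 'x chain set \<Rightarrow> real) \<Rightarrow> bool" where
  "homology_dual_basis r X \<Omega> \<pi> M a b z e \<longleftrightarrow>
     (\<forall>i\<in>\<Omega>. continuous_map X (top_of_set M) (\<pi> i)) \<and>
     (\<forall>S\<subseteq>\<Omega>. z S \<in> homology_inclusion (int (r * card S)) X {x. \<forall>i\<in>\<Omega> - S. \<pi> i x = b} `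
          carrier (homology_group (int (r * card S)) (subtopology X {x. \<forall>i\<in>\<Omega> - S. \<pi> i x = b}))) \<and>
     (\<forall>S\<subseteq>\<Omega>. e S \<in> hom (homology_group (int (r * card S)) X) real_group) \<and>
     (\<forall>S\<subseteq>\<Omega>. \<forall>T\<subseteq>\<Omega>. card T = card S \<longrightarrow> e S (z T) = of_bool (S = T)) \<and>
     (\<forall>S\<subseteq>\<Omega>. \<forall>c\<in>carrier (homology_group (int (r * card S)) (subtopology X {x. \<exists>i\<in>S. \<pi> i x \<noteq> a})).
          e S (homology_inclusion (int (r * card S)) X {x. \<exists>i\<in>S. \<pi> i x \<noteq> a} c) = 0) \<and>
     (\<forall>p. \<forall>h\<in>hom (homology_group p X) real_group.
          (\<forall>S\<subseteq>\<Omega>. int (r * card S) = p \<longrightarrow> h (z S) = 0) \<longrightarrow> (\<forall>c\<in>carrier (homology_group p X). h c = 0))"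

lemmas homology_dual_basis_continuous =
  homology_dual_basis_def[THEN iffD1, THEN conjunct1, rule_format]
lemmas homology_dual_basis_carrier_image =
  homology_dual_basis_def[THEN iffD1, THEN conjunct2, THEN conjunct1, rule_format]
lemmas homology_dual_basis_hom =
  homology_dual_basis_def[THEN iffD1, THEN conjunct2, THEN conjunct2, THEN conjunct1, rule_format]
lemmas homology_dual_basis_dual =
  homology_dual_basis_def[THEN iffD1, THEN conjunct2, THEN conjunct2, THEN conjunct2, THEN
      conjunct1, rule_format]
lemmas homology_dual_basis_vanish =
  homology_dual_basis_def[THEN iffD1, THEN conjunct2, THEN conjunct2, THEN conjunct2, THEN
      conjunct2, THEN conjunct1, rule_format]
lemmas homology_dual_basis_zero =
  homology_dual_basis_def[THEN iffD1, THEN conjunct2, THEN conjunct2, THEN conjunct2, THEN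
      conjunct2, THEN conjunct2, rule_format]

lemma homology_dual_basis_carrier:
  assumes "homology_dual_basis r X \<Omega> \<pi> M a b z e" "S \<subseteq> \<Omega>"
  shows "z S \<in> carrier (homology_group (int (r * card S)) X)"
  using homology_dual_basis_carrier_image[OF assms] by (auto simp only: image_iff hom_induced_carrier)

lemma continuous_map_id_subtopology: "continuous_map (subtopology X S) X id"
  by (intro continuous_map_from_subtopology continuous_map_id)

text \<open>Adding a factor produces a space of pairs, while \<open>sphere_power\<close> is a space
  of functions. The classes \<open>z\<close> are pushed forward along \<open>f\<close> and the
  functionals \<open>e\<close> pulled back along \<open>g\<close>.\<close>

lemma homology_dual_basis_homeomorphic:
  assumes basis: "homology_dual_basis r X \<Omega> \<pi> M a b z e"
    and fg: "homeomorphic_maps X X' f g"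
    and \<pi>: "\<And>i x. i \<in> \<Omega> \<Longrightarrow> x \<in> topspace X \<Longrightarrow> \<pi>' i (f x) = \<pi> i x"
  shows "\<exists>z e. homology_dual_basis r X' \<Omega> \<pi>' M a b z e"
proof -
  have cf: "continuous_map X X' f" and cg: "continuous_map X' X g"
    and gf: "\<And>x. x \<in> topspace X \<Longrightarrow> g (f x) = x" and fgx: "\<And>x. x \<in> topspace X' \<Longrightarrow> f (g x) = x"
    using fg by (auto simp: homeomorphic_maps_def)
  have \<pi>g: "\<pi> i (g x) = \<pi>' i x" if "i \<in> \<Omega>" "x \<in> topspace X'" for i x
    using \<pi>[of i "g x"] that fgx cg by (auto simp: continuous_map_def Pi_iff)
  let ?f = "\<lambda>q. homology_map q X X' f" and ?g = "\<lambda>q. homology_map q X' X g"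
  have gf_id: "?g q (?f q c) = c" if "c \<in> carrier (homology_group q X)" for q c
    using that by (simp add: hom_induced_compose' cf cg hom_induced_id_gen gf
        continuous_map_compose[OF cf cg])
  have fg_id: "?f q (?g q c) = c" if "c \<in> carrier (homology_group q X')" for q c
    using that by (simp add: hom_induced_compose' cf cg hom_induced_id_gen fgx
        continuous_map_compose[OF cg cf])
  define z' where "z' S = ?f (int (r * card S)) (z S)" for S
  define e' where "e' S = e S \<circ> ?g (int (r * card S))" for S
  have zc: "z S \<in> carrier (homology_group (int (r * card S)) X)" if "S \<subseteq> \<Omega>" for S
    using basis that by (rule homology_dual_basis_carrier)
  have "homology_dual_basis r X' \<Omega> \<pi>' M a b z' e'"
    unfolding homology_dual_basis_def
  proof (intro conjI allI impI ballI)
    fix i assume i: "i \<in> \<Omega>"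
    have "continuous_map X' (top_of_set M) (\<pi> i \<circ> g)"
      using cg homology_dual_basis_continuous[OF basis i] by (rule continuous_map_compose)
    then show "continuous_map X' (top_of_set M) (\<pi>' i)"
      by (rule continuous_map_eq) (simp add: \<pi>g i)
  next
    fix S assume S: "S \<subseteq> \<Omega>"
    let ?q = "int (r * card S)" and ?W = "{x. \<forall>i\<in>\<Omega> - S. \<pi> i x = b}" and ?W' = "{x. \<forall>i\<in>\<Omega> - S. \<pi>' i x = b}"
    obtain w where w: "w \<in> carrier (homology_group ?q (subtopology X ?W))"
      "z S = homology_inclusion ?q X ?W w"
      using homology_dual_basis_carrier_image[OF basis S] by (elim imageE)
    have c: "continuous_map (subtopology X ?W) (subtopology X' ?W') f"
      using cf \<pi> S by (auto simp: continuous_map_in_subtopology continuous_map_from_subtopology)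
    have "z' S = homology_inclusion ?q X' ?W' (homology_map ?q (subtopology X ?W) (subtopology X' ?W') f w)"
      unfolding z'_def w(2) by (simp add: hom_induced_compose' cf c continuous_map_id_subtopology)
    then show "z' S \<in> homology_inclusion ?q X' ?W' ` carrier (homology_group ?q (subtopology X' ?W'))"
      by (auto simp: hom_induced_carrier)
  next
    fix S assume S: "S \<subseteq> \<Omega>"
    show "e' S \<in> hom (homology_group (int (r * card S)) X') real_group"
      unfolding e'_def by (intro hom_compose[OF hom_induced_hom] homology_dual_basis_hom[OF basis S])
  next
    fix S T assume "S \<subseteq> \<Omega>" "T \<subseteq> \<Omega>" "card T = card S"
    then show "e' S (z' T) = of_bool (S = T)"
      using homology_dual_basis_dual[OF basis] zc[of T] by (simp add: e'_def z'_def gf_id)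
  next
    fix S c assume S: "S \<subseteq> \<Omega>"
    let ?q = "int (r * card S)" and ?V = "{x. \<exists>i\<in>S. \<pi> i x \<noteq> a}" and ?V' = "{x. \<exists>i\<in>S. \<pi>' i x \<noteq> a}"
    assume "c \<in> carrier (homology_group ?q (subtopology X' ?V'))"
    have c: "continuous_map (subtopology X' ?V') (subtopology X ?V) g"
      using cg \<pi>g[OF subsetD[OF S]] by (auto simp: continuous_map_in_subtopology
          continuous_map_from_subtopology)
    have "?g ?q (homology_inclusion ?q X' ?V' c) =
        homology_inclusion ?q X ?V (homology_map ?q (subtopology X' ?V') (subtopology X ?V) g c)"
      by (simp add: hom_induced_compose' cg c continuous_map_id_subtopology)
    then show "e' S (homology_inclusion ?q X' ?V' c) = 0"
      using homology_dual_basis_vanish[OF basis S hom_induced_carrier] by (simp add: e'_def)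
  next
    fix p h c assume h: "h \<in> hom (homology_group p X') real_group"
      and z: "\<forall>S\<subseteq>\<Omega>. int (r * card S) = p \<longrightarrow> h (z' S) = 0" and c: "c \<in> carrier (homology_group p X')"
    have "h \<circ> ?f p \<in> hom (homology_group p X) real_group"
      using h by (intro hom_compose[OF hom_induced_hom])
    moreover have "\<forall>S\<subseteq>\<Omega>. int (r * card S) = p \<longrightarrow> (h \<circ> ?f p) (z S) = 0"
      using z by (auto simp: z'_def)
    ultimately have "(h \<circ> ?f p) (?g p c) = 0"
      using homology_dual_basis_zero[OF basis, of "h \<circ> ?f p" p "?g p c"] hom_induced_carrier by blast
    then show "h c = 0" using c by (simp add: fg_id)
  qed
  then show ?thesis by blast
qed

text \<open>Base case: \<open>z\<close> is a generator of the infinite cyclic group in degree 0 and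
  \<open>e\<close> reads off the multiple. The only open set to be checked is empty and has trivial
  homology.\<close>

lemma homology_dual_basis_singleton:
  fixes \<pi> :: "'i \<Rightarrow> 'x \<Rightarrow> 'm::topological_space"
  assumes X: "topspace X = {u}"
  shows "\<exists>z e. homology_dual_basis r X {} \<pi> M a b z e"
proof -
  obtain f where f: "f \<in> iso (homology_group 0 X) integer_group"
    using homology_coefficients[OF X] by (auto simp: is_iso_def)
  have bf: "bij_betw f (carrier (homology_group 0 X)) UNIV"
    using f by (simp add: iso_def)
  then obtain z0 where z0: "z0 \<in> carrier (homology_group 0 X)" "f z0 = 1"
    by (metis UNIV_I bij_betw_imp_surj_on imageE)
  have "homology_dual_basis r X {} \<pi> M a b (\<lambda>_. z0) (\<lambda>_ c. real_of_int (f c))"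
    unfolding homology_dual_basis_def
  proof (intro conjI allI impI ballI)
    fix S :: "'i set" assume "S \<subseteq> {}"
    then show "z0 \<in> homology_map (int (r * card S)) (subtopology X {x. \<forall>i\<in>{} - S. \<pi> i x = b}) X id `
          carrier (homology_group (int (r * card S)) (subtopology X {x. \<forall>i\<in>{} - S. \<pi> i x = b}))"
      using z0 hom_induced_id[OF z0(1)] by (auto intro!: image_eqI[of _ _ z0])
  next
    fix S :: "'i set" assume "S \<subseteq> {}"
    then show "(\<lambda>c. real_of_int (f c)) \<in> hom (homology_group (int (r * card S)) X) real_group"
      using f by (auto simp: iso_def hom_def)
  next
    fix S :: "'i set" and c assume S: "S \<subseteq> {}"
      and c: "c \<in> carrier (homology_group (int (r * card S)) (subtopology X {x. \<exists>i\<in>S. \<pi> i x \<noteq> a}))"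
    let ?Z = "subtopology X {}" and ?j = "homology_inclusion 0 X {}"
    have "c \<in> carrier (homology_group 0 ?Z)" using c S by simp
    moreover have "trivial_group (homology_group 0 ?Z)" by (simp add: trivial_homology_group_empty)
    ultimately have "c = \<one>\<^bsub>homology_group 0 ?Z\<^esub>" by (simp add: trivial_group_def)
    then have "?j c = \<one>\<^bsub>homology_group 0 X\<^esub>"
      using hom_one[OF hom_induced_hom[of 0 ?Z "{}" X "{}" id]] by simp
    then have "f (?j c) = 0"
      using f hom_one[of f "homology_group 0 X" integer_group] by (simp add: iso_def)
    then show "real_of_int (f (homology_inclusion (int (r * card S)) X {x. \<exists>i\<in>S. \<pi> i x \<noteq> a} c)) = 0"
      using S by simp
  next
    fix p h c assume h: "h \<in> hom (homology_group p X) real_group"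
      and z: "\<forall>S\<subseteq>{} :: 'i set. int (r * card S) = p \<longrightarrow> h z0 = 0" and c: "c \<in> carrier (homology_group p X)"
    show "h c = 0"
    proof (cases "p = 0")
      case False
      then have "c = \<one>\<^bsub>homology_group p X\<^esub>"
        using homology_dimension_axiom[OF X, of p] c by (simp add: trivial_group_def)
      then show ?thesis using hom_one[OF h] by simp
    next
      case True
      define H where "H = homology_group 0 X"
      interpret H: group H by (simp add: H_def)
      interpret h: group_hom H real_group h
        using h True by (simp add: group_hom_def group_hom_axioms_def H_def)
      interpret f: group_hom H integer_group f
        using f by (simp add: group_hom_def group_hom_axioms_def H_def iso_def)
      have hz: "h z0 = 0" using z True by simp
      have zH: "z0 \<in> carrier H" "c \<in> carrier H" using z0 c True by (auto simp: H_def)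
      have pow: "f (z0 [^]\<^bsub>H\<^esub> (k::int)) = k" "h (z0 [^]\<^bsub>H\<^esub> k) = 0" for k
      proof -
        have "f (z0 [^]\<^bsub>H\<^esub> k) = f z0 [^]\<^bsub>integer_group\<^esub> k" using zH by (rule_tac f.hom_int_pow)
        then show "f (z0 [^]\<^bsub>H\<^esub> k) = k" by (simp add: z0)
        have "h (z0 [^]\<^bsub>H\<^esub> k) = h z0 [^]\<^bsub>real_group\<^esub> k" using zH by (rule_tac h.hom_int_pow)
        also have "\<dots> = 0" using group.int_pow_one[OF group_real_group, of k] by (simp add: hz)
        finally show "h (z0 [^]\<^bsub>H\<^esub> k) = 0" .
      qed
      have "c = z0 [^]\<^bsub>H\<^esub> (f c)"
        using bf zH pow(1)[of "f c"] by (auto simp: bij_betw_def H_def[symmetric] inj_on_def)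
      then show ?thesis using pow(2) by metis
    qed
  qed (use z0 in auto)
  then show ?thesis by blast
qed

text \<open>
  The new homology basis consists of the images of the \<open>z S\<close> in \<open>Y \<times> {b}\<close> and of lifts of the \<open>z S\<close>
  under \<open>\<Theta>\<close> whose projection to \<open>Y\<close> is trivial; dually, one composes the \<open>e S\<close> with the projection
  and with \<open>\<Theta>\<close>.
\<close>

lemma homology_dual_basis_prod_sphere:
  fixes a b :: "'b::euclidean_space \<times> real" and Y :: "'y topology"
  defines "r \<equiv> DIM('b)" and "M \<equiv> sphere 0 1 :: ('b \<times> real) set"
  assumes ab: "a \<in> M" "b \<in> M" "a \<noteq> b" and k: "k \<notin> \<Omega>" and fin: "finite \<Omega>"
    and basis: "homology_dual_basis r Y \<Omega> \<pi> M a b z e"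
  shows "\<exists>z e. homology_dual_basis r (prod_topology Y (top_of_set M)) (insert k \<Omega>)
           (\<lambda>i x. if i = k then snd x else \<pi> i (fst x)) M a b z e"
proof -
  let ?M = "top_of_set M" and ?r = "int r"
  obtain \<Theta> :: "int \<Rightarrow> 'y topology \<Rightarrow> ('y \<times> 'b \<times> real) chain set \<Rightarrow> 'y chain set" where
    \<Theta>hom: "\<And>p Y. \<Theta> p Y \<in> hom (homology_group (p + ?r) (prod_topology Y ?M)) (homology_group p Y)" and
    \<Theta>nat: "\<And>p Y Y' f c. continuous_map Y Y' f \<Longrightarrow> c \<in> carrier (homology_group (p + ?r) (prod_topology Y ?M)) \<Longrightarrow>
       \<Theta> p Y' (homology_map (p + ?r) (prod_topology Y ?M) (prod_topology Y' ?M) (map_prod f id) c) =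
       homology_map p Y Y' f (\<Theta> p Y c)" and
    \<Theta>ker: "\<And>p Y c. c \<in> carrier (homology_group (p + ?r) (prod_topology Y ?M)) \<Longrightarrow>
       \<Theta> p Y c = \<one>\<^bsub>homology_group p Y\<^esub> \<longleftrightarrow>
       c \<in> homology_map (p + ?r) Y (prod_topology Y ?M) (\<lambda>y. (y, b)) ` carrier (homology_group
           (p + ?r) Y)" and
    \<Theta>lift: "\<And>p Y w. w \<in> carrier (homology_group p Y) \<Longrightarrow>
       \<exists>c\<in>carrier (homology_group (p + ?r) (prod_topology Y ?M)). \<Theta> p Y c = w \<and>
         homology_map (p + ?r) (prod_topology Y ?M) Y fst c = \<one>\<^bsub>homology_group (p + ?r) Y\<^esub>" and
    \<Theta>sup: "\<And>p Y V c. openin Y V \<Longrightarrow>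
       c \<in> carrier (homology_group (p + ?r) (subtopology (prod_topology Y ?M) (V \<times> UNIV \<union> UNIV \<times> - {a}))) \<Longrightarrow>
       \<Theta> p Y (homology_inclusion (p + ?r) (prod_topology Y ?M) (V \<times> UNIV \<union> UNIV \<times> - {a}) c)
       \<in> homology_inclusion p Y V ` carrier (homology_group p (subtopology Y V))"
    using that unfolding r_def M_def by (rule sphere_product_homology[OF ab[unfolded M_def]])
  let ?X = "prod_topology Y ?M"
  define \<pi>' where "\<pi>' i x = (if i = k then snd x else \<pi> i (fst x))" for i and x :: "'y \<times> 'b \<times> real"
  define W where "W S = {y. \<forall>i\<in>\<Omega> - S. \<pi> i y = b}" for S
  define W' where "W' S = {x. \<forall>i\<in>insert k \<Omega> - S. \<pi>' i x = b}" for S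
  define V where "V S = {y. \<exists>i\<in>S. \<pi> i y \<noteq> a}" for S
  define V' where "V' S = {x. \<exists>i\<in>S. \<pi>' i x \<noteq> a}" for S
  define q where "q S = int (r * card S)" for S :: "'a set"
  have cf: "continuous_map ?X Y fst" by (rule continuous_map_fst)
  have ci: "continuous_map Y ?X (\<lambda>y. (y, b))"
    using ab by (auto intro!: continuous_map_pairedI)
  have \<pi>'\<Omega>: "\<pi>' i x = \<pi> i (fst x)" if "i \<in> \<Omega>" for i x using that k by (auto simp: \<pi>'_def)
  let ?i = "\<lambda>p. homology_map p Y ?X (\<lambda>y. (y, b))" and ?f = "\<lambda>p. homology_map p ?X Y fst"
  have fi: "?f p (?i p c) = c" if "c \<in> carrier (homology_group p Y)" for p c
    using that by (simp add: hom_induced_compose' ci cf comp_def hom_induced_id_gen)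
  have \<Theta>i: "\<Theta> p Y (?i (p + ?r) c) = \<one>\<^bsub>homology_group p Y\<^esub>" if "c \<in> carrier (homology_group
      (p + ?r) Y)" for p c
    using that by (subst \<Theta>ker) (auto simp: hom_induced_carrier)
  have q_insert: "q (insert k S) = q S + ?r" if "S \<subseteq> \<Omega>" for S
    using that k finite_subset[OF that fin] by (subst q_def, subst card_insert_disjoint)
        (auto simp: q_def algebra_simps)
  have zc: "z S \<in> carrier (homology_group (q S) Y)" if "S \<subseteq> \<Omega>" for S
    unfolding q_def using basis that by (rule homology_dual_basis_carrier)
  have "\<exists>w\<in>carrier (homology_group (q S) (subtopology Y (W S))). homology_inclusion (q S) Y (W S) w = z S"
    if "S \<subseteq> \<Omega>" for S
    using homology_dual_basis_carrier_image[OF basis that] unfolding W_def q_def by (elim imageE)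
        (intro bexI, auto)
  then obtain w where wc: "\<And>S. S \<subseteq> \<Omega> \<Longrightarrow> w S \<in> carrier (homology_group (q S) (subtopology Y (W S)))"
    and wz: "\<And>S. S \<subseteq> \<Omega> \<Longrightarrow> homology_inclusion (q S) Y (W S) (w S) = z S"
    by metis
  let ?WM = "\<lambda>S. prod_topology (subtopology Y (W S)) ?M"
  \<comment> \<open>The lift is taken over \<open>W S\<close>, which carries \<open>z S\<close>,
    instead of over \<open>Y\<close>: its image \<open>u S\<close> is then carried by W S \<times>
    M, as the support clause for \<open>insert k S\<close> requires. Naturality transfers the
    equations to \<open>Y\<close>.\<close>
  have "\<exists>v. S \<subseteq> \<Omega> \<longrightarrow> v \<in> carrier (homology_group (q S + ?r) (?WM S)) \<and> \<Theta> (q S) (subtopology Y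
      (W S)) v = w S \<and>
         homology_map (q S + ?r) (?WM S) (subtopology Y (W S)) fst v = \<one>\<^bsub>homology_group (q S + ?r)
             (subtopology Y (W S))\<^esub>" for S
    using \<Theta>lift[OF wc[of S]] by blast
  then obtain v where v: "\<And>S. S \<subseteq> \<Omega> \<Longrightarrow> v S \<in> carrier (homology_group (q S + ?r) (?WM S))"
      "\<And>S. S \<subseteq> \<Omega> \<Longrightarrow> \<Theta> (q S) (subtopology Y (W S)) (v S) = w S"
      "\<And>S. S \<subseteq> \<Omega> \<Longrightarrow> homology_map (q S + ?r) (?WM S) (subtopology Y (W S)) fst (v S)
          = \<one>\<^bsub>homology_group (q S + ?r) (subtopology Y (W S))\<^esub>"
    by metis
  have cW: "continuous_map (subtopology Y (W S)) Y id" for S by (rule continuous_map_id_subtopology)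
  have cWM: "continuous_map (?WM S) ?X (map_prod id id)" for S
    by (intro continuous_map_map_prod cW continuous_map_id)
  define u where "u S = homology_map (q S + ?r) (?WM S) ?X (map_prod id id) (v S)" for S
  have uc: "u S \<in> carrier (homology_group (q S + ?r) ?X)" for S
    unfolding u_def by (rule hom_induced_carrier)
  have u\<Theta>: "\<Theta> (q S) Y (u S) = z S" if "S \<subseteq> \<Omega>" for S
    unfolding u_def using \<Theta>nat[OF cW v(1)[OF that]] v(2)[OF that] wz[OF that] by simp
  have uf: "?f (q S + ?r) (u S) = \<one>\<^bsub>homology_group (q S + ?r) Y\<^esub>" if "S \<subseteq> \<Omega>" for S
  proof -
    have cfW: "continuous_map (?WM S) (subtopology Y (W S)) fst" by (rule continuous_map_fst)
    have "?f (q S + ?r) (u S) = homology_inclusion (q S + ?r) Y (W S)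
        (homology_map (q S + ?r) (?WM S) (subtopology Y (W S)) fst (v S))"
      unfolding u_def by (simp add: hom_induced_compose' cfW cW cWM cf fst_comp_map_prod)
    also have "\<dots> = \<one>\<^bsub>homology_group (q S + ?r) Y\<^esub>"
      unfolding v(3)[OF that] by (rule hom_one[OF hom_induced_hom]) auto
    finally show ?thesis .
  qed
  define z' where "z' S = (if k \<in> S then u (S - {k}) else ?i (q S) (z S))" for S
  define e' where "e' S = (if k \<in> S then e (S - {k}) \<circ> \<Theta> (q (S - {k})) Y else e S \<circ> ?f (q S))" for S
  have dec: thesis if "S \<subseteq> insert k \<Omega>" "S \<subseteq> \<Omega> \<Longrightarrow> thesis"
    "\<And>S'. S = insert k S' \<Longrightarrow> S' \<subseteq> \<Omega> \<Longrightarrow> thesis" for S thesis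
    using that(1) that(2) that(3)[of "S - {k}"] by (cases "k \<in> S") auto
  have z'1: "z' S = ?i (q S) (z S)" and e'1: "e' S = e S \<circ> ?f (q S)" if "S \<subseteq> \<Omega>" for S
    using that k by (auto simp: z'_def e'_def)
  have z'2: "z' (insert k S) = u S" and e'2: "e' (insert k S) = e S \<circ> \<Theta> (q S) Y" if "S \<subseteq> \<Omega>" for S
  proof -
    have "insert k S - {k} = S" using that k by auto
    then show "z' (insert k S) = u S" "e' (insert k S) = e S \<circ> \<Theta> (q S) Y" by (simp_all add: z'_def e'_def)
  qed
  have eh: "e S \<in> hom (homology_group (q S) Y) real_group" if "S \<subseteq> \<Omega>" for S
    unfolding q_def using basis that by (rule homology_dual_basis_hom)
  have e1: "e S \<one>\<^bsub>homology_group (q S) Y\<^esub> = 0" if "S \<subseteq> \<Omega>" for S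
    using hom_one[OF eh[OF that]] by simp
  have ez: "e S (z T) = of_bool (S = T)" if "S \<subseteq> \<Omega>" "T \<subseteq> \<Omega>" "card T = card S" for S T
    using basis that by (rule homology_dual_basis_dual)
  have "homology_dual_basis r ?X (insert k \<Omega>) \<pi>' M a b z' e'"
    unfolding homology_dual_basis_def W'_def[symmetric] V'_def[symmetric] q_def[symmetric]
  proof (intro conjI allI impI ballI)
    fix i assume i: "i \<in> insert k \<Omega>"
    show "continuous_map ?X ?M (\<pi>' i)"
    proof (cases "i = k")
      case True then have "\<pi>' i = snd" by (simp add: \<pi>'_def fun_eq_iff)
      then show ?thesis by (simp add: continuous_map_snd)
    next
      case False
      then have "continuous_map ?X ?M (\<pi> i \<circ> fst)"
        using homology_dual_basis_continuous[OF basis, of i] i cf by (auto intro: continuous_map_compose)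
      moreover have "\<pi>' i = \<pi> i \<circ> fst" using False by (simp add: \<pi>'_def fun_eq_iff)
      ultimately show ?thesis by simp
    qed
  next
    fix S assume "S \<subseteq> insert k \<Omega>"
    then show "z' S \<in> homology_inclusion (q S) ?X (W' S) ` carrier (homology_group (q S)
        (subtopology ?X (W' S)))"
    proof (rule dec)
      assume S: "S \<subseteq> \<Omega>"
      have c: "continuous_map (subtopology Y (W S)) (subtopology ?X (W' S)) (\<lambda>y. (y, b))"
        using ci by (auto simp: continuous_map_in_subtopology continuous_map_from_subtopology W_def
            W'_def \<pi>'_def)
      have "z' S = homology_inclusion (q S) ?X (W' S)
          (homology_map (q S) (subtopology Y (W S)) (subtopology ?X (W' S)) (\<lambda>y. (y, b)) (w S))"
        unfolding z'1[OF S] wz[OF S, symmetric]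
        by (simp add: hom_induced_compose' c cW ci continuous_map_id_subtopology)
      then show ?thesis by (auto simp: hom_induced_carrier)
    next
      fix S' assume S': "S = insert k S'" "S' \<subseteq> \<Omega>"
      have "W' S = W S' \<times> UNIV"
      proof -
        have "insert k \<Omega> - S = \<Omega> - S'" using S' k by auto
        then show ?thesis by (auto simp: W'_def W_def \<pi>'\<Omega>)
      qed
      then have "subtopology ?X (W' S) = ?WM S'" by (simp add: subtopology_Times)
      then show ?thesis
        using S' v(1)[of S'] by (simp add: z'2 q_insert u_def prod.map_id0)
    qed
  next
    fix S assume "S \<subseteq> insert k \<Omega>"
    then show "e' S \<in> hom (homology_group (q S) ?X) real_group"
    proof (rule dec)
      assume S: "S \<subseteq> \<Omega>"
      show ?thesis unfolding e'1[OF S] by (intro hom_compose[OF hom_induced_hom] eh S)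
    next
      fix S' assume S': "S = insert k S'" "S' \<subseteq> \<Omega>"
      show ?thesis unfolding S'(1) e'2[OF S'(2)] q_insert[OF S'(2)] by (intro hom_compose[OF \<Theta>hom] eh S')
    qed
  next
    fix S T assume S: "S \<subseteq> insert k \<Omega>" and T: "T \<subseteq> insert k \<Omega>" and card: "card T = card S"
    have qq: "q S = q T" using card by (simp add: q_def)
    have card': "card (insert k S) = Suc (card S)" if "S \<subseteq> \<Omega>" for S
      using that k finite_subset[OF that fin] by (subst card_insert_disjoint) auto
    \<comment> \<open>If exactly one of \<open>S\<close> and \<open>T\<close> contains
      \<open>k\<close>, then \<open>e\<close> is evaluated at a neutral element: the lifts
      \<open>u\<close> project trivially to \<open>Y\<close>, and \<open>\<Theta>\<close> kills the
      classes on the section.\<close>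
    from S show "e' S (z' T) = of_bool (S = T)"
    proof (rule dec)
      assume S1: "S \<subseteq> \<Omega>"
      from T show ?thesis
      proof (rule dec)
        assume T1: "T \<subseteq> \<Omega>"
        show ?thesis using zc[OF T1] ez[OF S1 T1 card] by (simp add: e'1[OF S1] z'1[OF T1] qq fi)
      next
        fix T' assume T': "T = insert k T'" "T' \<subseteq> \<Omega>"
        have "e' S (z' T) = e S \<one>\<^bsub>homology_group (q S) Y\<^esub>"
          using uf[OF T'(2)] by (simp add: e'1[OF S1] T'(1) z'2[OF T'(2)] qq q_insert[OF T'(2)])
        then show ?thesis using e1[OF S1] S1 T' k by auto
      qed
    next
      fix S' assume S': "S = insert k S'" "S' \<subseteq> \<Omega>"
      from T show ?thesis
      proof (rule dec)
        assume T1: "T \<subseteq> \<Omega>"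
        have "q T = q S' + ?r" using qq S' q_insert by simp
        then have "e' S (z' T) = e S' \<one>\<^bsub>homology_group (q S') Y\<^esub>"
          using \<Theta>i[of "z T" "q S'"] zc[OF T1] by (simp add: e'2[OF S'(2)] S'(1) z'1[OF T1])
        then show ?thesis using e1[OF S'(2)] T1 S' k by auto
      next
        fix T' assume T': "T = insert k T'" "T' \<subseteq> \<Omega>"
        have cc: "card T' = card S'" using card card' S' T' by simp
        then have "q S' = q T'" by (simp add: q_def)
        then have "e' S (z' T) = e S' (z T')"
          using u\<Theta>[OF T'(2)] by (simp add: e'2[OF S'(2)] S'(1) z'2[OF T'(2)] T'(1))
        moreover have "S = T \<longleftrightarrow> S' = T'" using S' T' k by (metis insert_ident subsetD)
        ultimately show ?thesis using ez[OF S'(2) T'(2) cc] by simp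
      qed
    qed
  next
    fix S c assume "S \<subseteq> insert k \<Omega>" and c: "c \<in> carrier (homology_group (q S) (subtopology ?X (V' S)))"
    then show "e' S (homology_inclusion (q S) ?X (V' S) c) = 0"
    proof (rule_tac dec[of S])
      assume S: "S \<subseteq> \<Omega>"
      have cfV: "continuous_map (subtopology ?X (V' S)) (subtopology Y (V S)) fst"
        using cf \<pi>'\<Omega>[OF subsetD[OF S]]
        by (auto simp: continuous_map_in_subtopology continuous_map_from_subtopology V_def V'_def)
      have "?f (q S) (homology_inclusion (q S) ?X (V' S) c) =
          homology_inclusion (q S) Y (V S) (homology_map (q S) (subtopology ?X (V' S))
              (subtopology Y (V S)) fst c)"
        by (simp add: hom_induced_compose' cf cfV continuous_map_id_subtopology)
      then show ?thesis
        using homology_dual_basis_vanish[OF basis S hom_induced_carrier] by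
            (simp add: e'1[OF S] V_def q_def)
    next
      fix S' assume S': "S = insert k S'" "S' \<subseteq> \<Omega>"
      \<comment> \<open>For \<open>S = insert k S'\<close> the set \<open>V' S\<close> consists of
        the points over \<open>U\<close> and those whose last coordinate is not \<open>a\<close>,
        exactly the shape of the localization property of \<open>\<Theta>\<close>; then
        \<open>e S'\<close> vanishes on what comes from \<open>U\<close>.\<close>
      define U where "U = topspace Y \<inter> V S'"
      have "openin Y U"
      proof -
        have "U = (\<Union>i\<in>S'. {y \<in> topspace Y. \<pi> i y \<in> M - {a}})"
          using homology_dual_basis_continuous[OF basis] S' by
              (fastforce simp: U_def V_def continuous_map_def Pi_iff)
        moreover have "openin Y {y \<in> topspace Y. \<pi> i y \<in> M - {a}}" if "i \<in> S'" for i
          using homology_dual_basis_continuous[OF basis, of i] S' that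
          by (intro openin_continuous_map_preimage[where Y = ?M]) (auto simp: openin_delete)
        ultimately show ?thesis by (auto intro!: openin_Union)
      qed
      have sub: "subtopology ?X (V' S) = subtopology ?X (U \<times> UNIV \<union> UNIV \<times> - {a})"
      proof -
        have "topspace ?X \<inter> V' S = topspace ?X \<inter> (U \<times> UNIV \<union> UNIV \<times> - {a})"
          using \<pi>'\<Omega>[OF subsetD[OF S'(2)]] by (auto simp: V'_def V_def U_def S'(1) \<pi>'_def)
        then show ?thesis by (metis subtopology_restrict)
      qed
      have qS: "q S = q S' + ?r" using S' q_insert by simp
      have c': "c \<in> carrier (homology_group (q S' + ?r) (subtopology ?X (U \<times> UNIV \<union> UNIV \<times> - {a})))"
        using c by (simp only: sub qS)
      obtain d where d: "d \<in> carrier (homology_group (q S') (subtopology Y U))"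
        "\<Theta> (q S') Y (homology_inclusion (q S' + ?r) ?X (V' S) c) = homology_inclusion (q S') Y U d"
        using \<Theta>sup[OF \<open>openin Y U\<close> c'] unfolding sub by (elim imageE)
      have "subtopology Y U = subtopology Y (V S')" unfolding U_def by (rule subtopology_restrict)
      then show ?thesis
        using homology_dual_basis_vanish[OF basis S'(2), of d, folded V_def q_def] d
        by (simp add: qS e'2[OF S'(2), folded S'(1)])
    qed
  next
    fix p h c assume h: "h \<in> hom (homology_group p ?X) real_group"
      and hz: "\<forall>S\<subseteq>insert k \<Omega>. q S = p \<longrightarrow> h (z' S) = 0" and c: "c \<in> carrier (homology_group p ?X)"
    define p' where "p' = p - ?r"
    have p: "p = p' + ?r" by (simp add: p'_def)
    let ?H = "homology_group p ?X" and ?K = "homology_group p' Y"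
    \<comment> \<open>A functional that vanishes on the section vanishes on the kernel of
      \<open>\<Theta>\<close>, hence factors through \<open>\<Theta>\<close>. The factor
      \<open>h \<circ> l\<close>, for a set-theoretic right inverse \<open>l\<close> of
      \<open>\<Theta>\<close>, is then handled by the basis of \<open>Y\<close> in degree
      \<open>p - r\<close>.\<close>
    have hi: "h (?i p y) = 0" if "y \<in> carrier (homology_group p Y)" for y
    proof -
      have "h \<circ> ?i p \<in> hom (homology_group p Y) real_group" using h by
          (intro hom_compose[OF hom_induced_hom])
      moreover have "(h \<circ> ?i p) (z S) = 0" if "S \<subseteq> \<Omega>" "int (r * card S) = p" for S
        using hz that z'1[of S] by (auto simp: q_def)
      ultimately have "(h \<circ> ?i p) y = 0" using homology_dual_basis_zero[OF basis, of
          "h \<circ> ?i p" p y] that by simp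
      then show ?thesis by simp
    qed
    interpret \<Theta>: group_hom ?H ?K "\<Theta> p' Y"
      using \<Theta>hom[of p' Y] by (simp add: group_hom_def group_hom_axioms_def p)
    interpret h: group_hom ?H real_group h
      using h by (simp add: group_hom_def group_hom_axioms_def)
    have inv_real: "inv\<^bsub>real_group\<^esub> x = - x" for x
      using group.inv_equality[OF group_real_group, of "- x" x] by simp
    have well: "h x = h y" if x: "x \<in> carrier ?H" and y: "y \<in> carrier ?H" and xy: "\<Theta> p' Y x
        = \<Theta> p' Y y" for x y
    proof -
      let ?d = "x \<otimes>\<^bsub>?H\<^esub> inv\<^bsub>?H\<^esub> y"
      have d: "?d \<in> carrier ?H" using x y by simp
      have "\<Theta> p' Y ?d = \<one>\<^bsub>?K\<^esub>" using x y xy by simp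
      then have "h ?d = 0" using \<Theta>ker[of ?d p' Y] d hi unfolding p by auto
      then show ?thesis using x y by (simp add: inv_real)
    qed
    have "\<exists>x. y \<in> carrier ?K \<longrightarrow> x \<in> carrier ?H \<and> \<Theta> p' Y x = y" for y
      using \<Theta>lift[of y p' Y] unfolding p by blast
    then obtain l where l: "\<And>y. y \<in> carrier ?K \<Longrightarrow> l y \<in> carrier ?H" "\<And>y. y \<in> carrier ?K \<Longrightarrow> \<Theta> p' Y (l y) = y"
      by metis
    have "h \<circ> l \<in> hom ?K real_group"
    proof (rule homI)
      fix x y assume xy: "x \<in> carrier ?K" "y \<in> carrier ?K"
      have "h (l (x \<otimes>\<^bsub>?K\<^esub> y)) = h (l x \<otimes>\<^bsub>?H\<^esub> l y)" using xy l by (intro well) auto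
      then show "(h \<circ> l) (x \<otimes>\<^bsub>?K\<^esub> y) = (h \<circ> l) x \<otimes>\<^bsub>real_group\<^esub> (h \<circ> l) y" using xy l by simp
    qed auto
    moreover have "(h \<circ> l) (z S) = 0" if S: "S \<subseteq> \<Omega>" "int (r * card S) = p'" for S
    proof -
      have qS: "q S = p'" using S by (simp add: q_def)
      then have "h (l (z S)) = h (u S)"
        using l[of "z S"] zc[OF S(1)] uc[of S] u\<Theta>[OF S(1)] p by (intro well) auto
      also have "\<dots> = 0" using hz S z'2[OF S(1)] q_insert[OF S(1)] qS p by (metis insert_mono)
      finally show ?thesis by simp
    qed
    ultimately have "(h \<circ> l) (\<Theta> p' Y c) = 0"
      using homology_dual_basis_zero[OF basis, of "h \<circ> l" p' "\<Theta> p' Y c"] c by simp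
    moreover have "h c = h (l (\<Theta> p' Y c))" using c l by (intro well) auto
    ultimately show "h c = 0" by simp
  qed
  then show ?thesis unfolding \<pi>'_def by blast
qed

lemma homeomorphic_maps_sphere_power_insert:
  assumes "k \<notin> \<Omega>"
  shows "homeomorphic_maps (prod_topology (sphere_power \<Omega>) (top_of_set unit_sphere)) (sphere_power
      (insert k \<Omega>))
           (\<lambda>x. (fst x)(k := snd x)) (\<lambda>x. (restrict x \<Omega>, x k))"
  unfolding homeomorphic_maps_def
proof (intro conjI ballI)
  let ?M = "top_of_set unit_sphere :: ('b \<times> real) topology"
  show "continuous_map (prod_topology (sphere_power \<Omega>) ?M) (sphere_power (insert k \<Omega>)) (\<lambda>x.
      (fst x)(k := snd x))"
    unfolding sphere_power_def continuous_map_componentwise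
  proof (intro conjI ballI)
    show "(\<lambda>x. (fst x)(k := snd x)) ` topspace (prod_topology (product_topology (\<lambda>_. ?M) \<Omega>) ?M)
        \<subseteq> extensional (insert k \<Omega>)"
      by (auto simp: PiE_def extensional_def)
    fix i assume i: "i \<in> insert k \<Omega>"
    show "continuous_map (prod_topology (product_topology (\<lambda>_. ?M) \<Omega>) ?M) ?M (\<lambda>x. ((fst x)(k := snd x)) i)"
    proof (cases "i = k")
      case False
      then have "continuous_map (product_topology (\<lambda>_. ?M) \<Omega>) ?M (\<lambda>x. x i)"
        using i by (intro continuous_map_product_projection) auto
      from continuous_map_compose[OF continuous_map_fst this] show ?thesis
        using False by (simp add: comp_def)
    next
      case True
      then show ?thesis using continuous_map_snd[of "product_topology (\<lambda>_. ?M) \<Omega>" ?M] by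
          (simp add: comp_def)
    qed
  qed
  show "continuous_map (sphere_power (insert k \<Omega>)) (prod_topology (sphere_power \<Omega>) ?M) (\<lambda>x.
      (restrict x \<Omega>, x k))"
    unfolding sphere_power_def
    by (intro continuous_map_pairedI)
      (auto simp: continuous_map_componentwise intro!: continuous_map_product_projection)
qed (use assms in \<open>auto simp: sphere_power_def PiE_def extensional_def fun_eq_iff\<close>)

lemma homology_dual_basis_sphere_power:
  fixes a b :: "'b::euclidean_space \<times> real"
  assumes ab: "a \<in> unit_sphere" "b \<in> unit_sphere" "a \<noteq> b" and "finite \<Omega>"
  shows "\<exists>z e. homology_dual_basis DIM('b) (sphere_power \<Omega>) \<Omega> (\<lambda>g x. x g) unit_sphere a b z e"
  using \<open>finite \<Omega>\<close>
proof (induction \<Omega> rule: finite_induct)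
  case empty
  have "topspace (sphere_power {} :: ('a \<Rightarrow> 'b \<times> real) topology) = {\<lambda>_. undefined}"
    by (simp add: sphere_power_def)
  then show ?case by (rule homology_dual_basis_singleton)
next
  case (insert k \<Omega>)
  then obtain z e where "homology_dual_basis DIM('b) (sphere_power \<Omega>) \<Omega> (\<lambda>g x. x g) unit_sphere a b z e"
    by (elim exE)
  from homology_dual_basis_prod_sphere[OF ab insert.hyps(2,1) this]
  obtain z e where "homology_dual_basis DIM('b) (prod_topology (sphere_power \<Omega>)
      (top_of_set unit_sphere)) (insert k \<Omega>)
      (\<lambda>i x. if i = k then snd x else fst x i) unit_sphere a b z e"
    by (elim exE)
  then show ?case
    by (rule homology_dual_basis_homeomorphic[OF _ homeomorphic_maps_sphere_power_insert[OF
        insert.hyps(2)]]) auto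
qed

section \<open>Real cohomology classes as functionals on homology\<close>

text \<open>
  Zorn's lemma for graphs of additive functions: if some non-zero multiple of \<open>x\<close> lies in the domain,
  it determines the value at \<open>x\<close> by division.
\<close>

lemma additive_extension:
  fixes h :: "('a \<Rightarrow>\<^sub>0 int) \<Rightarrow> real"
  assumes G: "0 \<in> G" "\<And>x y. x \<in> G \<Longrightarrow> y \<in> G \<Longrightarrow> x - y \<in> G"
    and h: "\<And>x y. x \<in> G \<Longrightarrow> y \<in> G \<Longrightarrow> h (x - y) = h x - h y"
  shows "\<exists>H. (\<forall>x y. H (x + y) = H x + H y) \<and> (\<forall>x\<in>G. H x = h x)"
proof -
  \<comment> \<open>A relation closed under differences whose only value over 0 is 0 is the graph of
    an additive function on a subgroup; inclusion of graphs is extension of functions.\<close>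
  define good where "good R \<longleftrightarrow> (\<lambda>x. (x, h x)) ` G \<subseteq> R \<and>
      (\<forall>x u y v. (x, u) \<in> R \<longrightarrow> (y, v) \<in> R \<longrightarrow> (x - y, u - v) \<in> R) \<and> (\<forall>u. (0, u) \<in> R \<longrightarrow> u = 0)"
    for R :: "(('a \<Rightarrow>\<^sub>0 int) \<times> real) set"
  have "h 0 = 0" using h[of 0 0] G by simp
  then have "good ((\<lambda>x. (x, h x)) ` G)"
    using G h by (auto simp: good_def image_iff)
  moreover have "good (\<Union>C)" if C: "C \<noteq> {}" "subset.chain {R. good R} C" for C
  proof -
    have g: "good R" if "R \<in> C" for R using C that by (auto simp: subset.chain_def)
    have "(x - y, u - v) \<in> \<Union>C" if xu: "(x, u) \<in> \<Union>C" and yv: "(y, v) \<in> \<Union>C" for x u y v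
    proof -
      obtain R S where R: "R \<in> C" "(x, u) \<in> R" and S: "S \<in> C" "(y, v) \<in> S" using xu yv by blast
      then have "R \<subseteq> S \<or> S \<subseteq> R" using C by (meson subset_chain_def)
      then show ?thesis
      proof
        assume "R \<subseteq> S" then have "(x, u) \<in> S" using R by blast
        then show ?thesis using g[OF S(1)] S unfolding good_def by blast
      next
        assume "S \<subseteq> R" then have "(y, v) \<in> R" using S by blast
        then show ?thesis using g[OF R(1)] R unfolding good_def by blast
      qed
    qed
    moreover obtain R0 where "R0 \<in> C" using C by blast
    then have "(\<lambda>x. (x, h x)) ` G \<subseteq> \<Union>C" using g[of R0] unfolding good_def by blast
    moreover have "u = 0" if "(0, u) \<in> \<Union>C" for u using that g unfolding good_def by blast
    ultimately show ?thesis unfolding good_def by blast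
  qed
  ultimately obtain R where R: "good R" and max: "\<And>S. good S \<Longrightarrow> R \<subseteq> S \<Longrightarrow> S = R"
    using subset_Zorn_nonempty[of "{R. good R}"] by auto
  have R0: "(0, 0) \<in> R" using R G \<open>h 0 = 0\<close> unfolding good_def by force
  have Rdiff: "(x - y, u - v) \<in> R" if "(x, u) \<in> R" "(y, v) \<in> R" for x u y v
    using R that unfolding good_def by blast
  have Rneg: "(- x, - u) \<in> R" if "(x, u) \<in> R" for x u using Rdiff[OF R0 that] by simp
  have Radd: "(x + y, u + v) \<in> R" if "(x, u) \<in> R" "(y, v) \<in> R" for x u y v
    using Rdiff[OF that(1) Rneg[OF that(2)]] by simp
  have Rzero: "u = 0" if "(0, u) \<in> R" for u using R that unfolding good_def by blast
  have Rnat: "(frag_cmul (int n) x, real n * u) \<in> R" if "(x, u) \<in> R" for n x u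
  proof (induction n)
    case (Suc n)
    show ?case using Radd[OF Suc that] by (simp add: frag_cmul_distrib algebra_simps)
  qed (use R0 in simp)
  have Rmul: "(frag_cmul m x, real_of_int m * u) \<in> R" if "(x, u) \<in> R" for m x u
  proof (cases m rule: int_cases2)
    case (nonneg n) then show ?thesis using Rnat[OF that, of n] by simp
  next
    case (nonpos n) then show ?thesis using Rneg[OF Rnat[OF that, of n]] by simp
  qed
  have dom: "\<exists>u. (x, u) \<in> R" for x
  proof -
    have "\<exists>v. \<forall>m u. (frag_cmul m x, u) \<in> R \<longrightarrow> u = real_of_int m * v"
    proof (cases "\<exists>m u. m \<noteq> 0 \<and> (frag_cmul m x, u) \<in> R")
      case True
      then obtain m0 u0 where m0: "m0 \<noteq> 0" "(frag_cmul m0 x, u0) \<in> R" by blast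
      have "u = real_of_int m * (u0 / real_of_int m0)" if "(frag_cmul m x, u) \<in> R" for m u
      proof -
        have "(frag_cmul m0 (frag_cmul m x) - frag_cmul m (frag_cmul m0 x), real_of_int m0 * u -
            real_of_int m * u0) \<in> R"
          by (intro Rdiff Rmul that m0)
        then have "real_of_int m0 * u - real_of_int m * u0 = 0" by (intro Rzero) (simp add: mult.commute)
        then show ?thesis using m0 by (simp add: field_simps)
      qed
      then show ?thesis by blast
    next
      case False
      then show ?thesis using Rzero by (intro exI[of _ 0]) (metis frag_cmul_zero mult_zero_right)
    qed
    then obtain v where v: "\<And>m u. (frag_cmul m x, u) \<in> R \<Longrightarrow> u = real_of_int m * v" by blast
    \<comment> \<open>The graph generated by \<open>R\<close> and the pair \<open>(x, v)\<close>. It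
      is again single-valued by the choice of \<open>v\<close>, so maximality puts \<open>x\<close>
      into the domain of \<open>R\<close>.\<close>
    define S where "S = {(y + frag_cmul m x, u + real_of_int m * v) | y u m. (y, u) \<in> R}"
    have RS: "R \<subseteq> S"
    proof
      fix w assume "w \<in> R"
      moreover obtain y u where "w = (y, u)" by (cases w)
      ultimately show "w \<in> S"
        unfolding S_def mem_Collect_eq by (intro exI[of _ y], intro exI[of _ u], intro exI[of _ 0]) simp
    qed
    have "good S"
      unfolding good_def
    proof (intro conjI allI impI)
      show "(\<lambda>x. (x, h x)) ` G \<subseteq> S" using R RS unfolding good_def by blast
    next
      fix x1 u1 x2 u2 assume "(x1, u1) \<in> S" "(x2, u2) \<in> S"
      then obtain y1 w1 m1 y2 w2 m2 where *: "(y1, w1) \<in> R" "(y2, w2) \<in> R" "x1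
          = y1 + frag_cmul m1 x" "x2 = y2 + frag_cmul m2 x"
         "u1 = w1 + real_of_int m1 * v" "u2 = w2 + real_of_int m2 * v" by (auto simp: S_def)
      have "x1 - x2 = (y1 - y2) + frag_cmul (m1 - m2) x" "u1 - u2 = (w1 - w2) + real_of_int (m1 - m2) * v"
        by (simp_all add: * frag_cmul_diff_distrib algebra_simps)
      then show "(x1 - x2, u1 - u2) \<in> S" using Rdiff[OF *(1,2)] unfolding S_def by blast
    next
      fix u assume "(0, u) \<in> S"
      then obtain y w m where *: "(y, w) \<in> R" "y + frag_cmul m x = 0" "u = w + real_of_int m * v" by
          (auto simp: S_def)
      have "y = - frag_cmul m x" using *(2) by (simp only: eq_neg_iff_add_eq_0)
      then have "y = frag_cmul (- m) x" by simp
      then have "w = real_of_int (- m) * v" using v *(1) by blast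
      then show "u = 0" using * by simp
    qed
    then have "S = R" using RS max by blast
    moreover have "(x, v) \<in> S"
      unfolding S_def mem_Collect_eq
      by (rule exI[of _ 0], rule exI[of _ 0], rule exI[of _ 1]) (simp add: R0)
    ultimately show ?thesis by blast
  qed
  define H where "H x = (SOME u. (x, u) \<in> R)" for x
  have HR: "(x, H x) \<in> R" for x unfolding H_def using dom by (rule someI_ex)
  have uniq: "u = H x" if "(x, u) \<in> R" for x u using Rzero[of "u - H x"] Rdiff[OF that HR[of x]] by simp
  have "H (x + y) = H x + H y" for x y using uniq[OF Radd[OF HR HR]] by simp
  moreover have "H x = h x" if "x \<in> G" for x using uniq[of x "h x"] R that unfolding good_def by force
  ultimately show ?thesis by blast
qed

section \<open>Evaluation of real cochains on integral chains\<close>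

definition chain_pairing :: "'x cochain \<Rightarrow> 'x chain \<Rightarrow> real" where
  "chain_pairing \<phi> c = (\<Sum>\<sigma>\<in>Poly_Mapping.keys c. real_of_int (Poly_Mapping.lookup c \<sigma>) * \<phi> \<sigma>)"

lemma chain_pairing_superset:
  assumes "finite A" "Poly_Mapping.keys c \<subseteq> A"
  shows "chain_pairing \<phi> c = (\<Sum>\<sigma>\<in>A. real_of_int (Poly_Mapping.lookup c \<sigma>) * \<phi> \<sigma>)"
  unfolding chain_pairing_def using assms
  by (intro sum.mono_neutral_left) (auto simp: in_keys_iff)

lemma chain_pairing_zero [simp]: "chain_pairing \<phi> 0 = 0"
  by (simp add: chain_pairing_def)

lemma chain_pairing_zero_left [simp]: "chain_pairing (\<lambda>_. 0) c = 0"
  by (simp add: chain_pairing_def)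

lemma chain_pairing_frag_of [simp]: "chain_pairing \<phi> (frag_of \<sigma>) = \<phi> \<sigma>"
  by (simp add: chain_pairing_def)

lemma chain_pairing_diff: "chain_pairing \<phi> (c - d) = chain_pairing \<phi> c - chain_pairing \<phi> d"
proof -
  let ?A = "Poly_Mapping.keys c \<union> Poly_Mapping.keys d"
  have "Poly_Mapping.keys (c - d) \<subseteq> ?A" by (rule keys_diff)
  then show ?thesis
    by (simp add: chain_pairing_superset[of ?A] lookup_minus algebra_simps sum_subtractf)
qed

lemma chain_pairing_add: "chain_pairing \<phi> (c + d) = chain_pairing \<phi> c + chain_pairing \<phi> d"
  using chain_pairing_diff[of \<phi> "c + d" d] by simp

text \<open>Chains are free on the simplices, so an additive function on them is recovered from its
  values there; this turns the extensions found by \<open>additive_extension\<close> into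
  cochains.\<close>

lemma chain_pairing_of_additive:
  assumes "\<And>x y. H (x + y) = H x + (H y :: real)"
  shows "chain_pairing (\<lambda>\<sigma>. H (frag_of \<sigma>)) c = H c"
proof -
  have z: "H 0 = 0" using assms[of 0 0] by simp
  have d: "H (x - y) = H x - H y" for x y using assms[of "x - y" y] by simp
  show ?thesis
    by (rule frag_induction[where S = UNIV and c = c]) (auto simp: chain_pairing_diff d z)
qed

lemma chain_pairing_cong:
  assumes "singular_chain p X c" "\<And>\<sigma>. singular_simplex p X \<sigma> \<Longrightarrow> \<phi> \<sigma> = \<psi> \<sigma>"
  shows "chain_pairing \<phi> c = chain_pairing \<psi> c"
  unfolding chain_pairing_def using assms by (intro sum.cong) (auto simp: singular_chain_def)

lemma chain_pairing_cmul: "chain_pairing \<phi> (frag_cmul k c) = real_of_int k * chain_pairing \<phi> c"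
  by (subst chain_pairing_superset[of "Poly_Mapping.keys c"])
    (auto simp: chain_pairing_def sum_distrib_left mult.assoc)

lemma chain_pairing_sum: "chain_pairing \<phi> (sum f I) = (\<Sum>i\<in>I. chain_pairing \<phi> (f i))"
  by (induction I rule: infinite_finite_induct) (auto simp: chain_pairing_add)

lemma chain_pairing_coboundary:
  assumes "singular_chain (Suc p) X c"
  shows "chain_pairing (coboundary p X \<phi>) c = chain_pairing \<phi> (chain_boundary (Suc p) c)"
  using assms[unfolded singular_chain_def]
proof (rule frag_induction)
  fix \<sigma> :: "(nat \<Rightarrow> real) \<Rightarrow> 'a" assume "\<sigma> \<in> singular_simplex_set (Suc p) X"
  then show "chain_pairing (coboundary p X \<phi>) (frag_of \<sigma>) = chain_pairing \<phi> (chain_boundary (Suc p)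
      (frag_of \<sigma>))"
    by (simp add: coboundary_def chain_boundary_of chain_pairing_sum chain_pairing_cmul
        del: sum.atMost_Suc)
qed (auto simp: chain_pairing_diff chain_boundary_diff)

lemma carrier_cochains: "carrier (cochains p X) = extensional {\<sigma>. singular_simplex p X \<sigma>}"
  by (auto simp: cochains_def class_ring.func_space_def PiE_def)

lemma zero_cochains: "\<zero>\<^bsub>cochains p X\<^esub> = (\<lambda>\<sigma>\<in>{\<sigma>. singular_simplex p X \<sigma>}. 0)"
  by (simp add: cochains_def class_ring.func_space_def)

lemma add_cochains: "\<phi> \<oplus>\<^bsub>cochains p X\<^esub> \<psi> = (\<lambda>\<sigma>\<in>{\<sigma>. singular_simplex p X \<sigma>}. \<phi> \<sigma> + \<psi> \<sigma>)"
  by (simp add: cochains_def class_ring.func_space_def)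

lemma smult_cochains: "c \<odot>\<^bsub>cochains p X\<^esub> \<phi> = (\<lambda>\<sigma>\<in>{\<sigma>. singular_simplex p X \<sigma>}. c * \<phi> \<sigma>)"
  by (simp add: cochains_def class_ring.func_space_def)

text \<open>The coboundary is adjoint to the boundary, and single simplices suffice for
  testing.\<close>

lemma cocycles_iff:
  "\<phi> \<in> cocycles p X \<longleftrightarrow> \<phi> \<in> extensional {\<sigma>. singular_simplex p X \<sigma>} \<and>
     (\<forall>c. singular_chain (Suc p) X c \<longrightarrow> chain_pairing \<phi> (chain_boundary (Suc p) c) = 0)"
proof -
  have "(\<forall>c. singular_chain (Suc p) X c \<longrightarrow> chain_pairing \<phi> (chain_boundary (Suc p) c) = 0) \<longleftrightarrow>
     coboundary p X \<phi> = \<zero>\<^bsub>cochains (Suc p) X\<^esub>" (is "?l = ?r")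
  proof
    assume l: ?l
    show ?r
    proof
      fix \<sigma>
      show "coboundary p X \<phi> \<sigma> = \<zero>\<^bsub>cochains (Suc p) X\<^esub> \<sigma>"
      proof (cases "singular_simplex (Suc p) X \<sigma>")
        case True
        then have c: "singular_chain (Suc p) X (frag_of \<sigma>)" by (simp add: singular_chain_of)
        then show ?thesis
          using l chain_pairing_coboundary[OF c, of \<phi>] True by (simp add: zero_cochains)
      qed (simp add: coboundary_def zero_cochains)
    qed
  next
    assume r: ?r
    show ?l
    proof (intro allI impI)
      fix c assume c: "singular_chain (Suc p) X c"
      have "chain_pairing (coboundary p X \<phi>) c = chain_pairing (\<lambda>_. 0) c"
        using c by (rule chain_pairing_cong) (simp add: r zero_cochains)
      then show "chain_pairing \<phi> (chain_boundary (Suc p) c) = 0"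
        by (simp add: chain_pairing_coboundary[OF c])
    qed
  qed
  then show ?thesis by (simp add: cocycles_def carrier_cochains)
qed

text \<open>The vanishing of Ext into a divisible group: if a cocycle vanishes on cycles, its value
  on a chain depends only on the boundary of the chain. This defines an additive function on
  boundaries, and any extension of it to all chains is a primitive. In degree 0 every chain is a
  cycle, so only the zero cochain is left.\<close>

lemma coboundaries_iff:
  "\<phi> \<in> coboundaries p X \<longleftrightarrow> \<phi> \<in> cocycles p X \<and> (\<forall>c. singular_relcycle p X {} c \<longrightarrow> chain_pairing \<phi> c = 0)"
proof (cases p)
  case 0
  show ?thesis
  proof
    assume "\<phi> \<in> coboundaries p X"
    then have \<phi>: "\<phi> = (\<lambda>\<sigma>\<in>{\<sigma>. singular_simplex p X \<sigma>}. 0)" by (simp add: coboundaries_def 0 zero_cochains)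
    have "chain_pairing \<phi> c = 0" if "singular_chain p X c" for c
      using chain_pairing_cong[OF that, of \<phi> "\<lambda>_. 0"] by (simp add: \<phi>)
    then show "\<phi> \<in> cocycles p X \<and> (\<forall>c. singular_relcycle p X {} c \<longrightarrow> chain_pairing \<phi> c = 0)"
      using singular_chain_boundary_alt[of p X] by (auto simp: cocycles_iff singular_cycle \<phi>)
  next
    assume r: "\<phi> \<in> cocycles p X \<and> (\<forall>c. singular_relcycle p X {} c \<longrightarrow> chain_pairing \<phi> c = 0)"
    have "\<phi> \<sigma> = 0" if "singular_simplex p X \<sigma>" for \<sigma>
      using r[THEN conjunct2, rule_format, of "frag_of \<sigma>"] that
      by (simp add: singular_cycle singular_chain_of 0 chain_boundary_def)
    then have "\<phi> = \<zero>\<^bsub>cochains 0 X\<^esub>"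
      using r by (auto simp: zero_cochains cocycles_iff 0 extensional_def fun_eq_iff)
    then show "\<phi> \<in> coboundaries p X" by (simp add: coboundaries_def 0)
  qed
next
  case (Suc q)
  show ?thesis
  proof
    assume "\<phi> \<in> coboundaries p X"
    then obtain \<psi> where \<phi>: "\<phi> = coboundary q X \<psi>" by (auto simp: coboundaries_def Suc)
    have *: "chain_pairing \<phi> c = chain_pairing \<psi> (chain_boundary p c)" if "singular_chain p X c" for c
      using chain_pairing_coboundary[of q X c \<psi>] that by (simp add: \<phi> Suc)
    have "\<phi> \<in> extensional {\<sigma>. singular_simplex p X \<sigma>}" by (simp add: \<phi> coboundary_def Suc)
    moreover have "chain_pairing \<phi> (chain_boundary (Suc p) c) = 0" if "singular_chain (Suc p) X c" for c
    proof -
      have "chain_boundary p (chain_boundary (Suc p) c) = 0"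
        using chain_boundary_boundary_alt[OF that] by simp
      then show ?thesis using *[OF singular_chain_boundary_alt[OF that]] by simp
    qed
    ultimately show "\<phi> \<in> cocycles p X \<and> (\<forall>c. singular_relcycle p X {} c \<longrightarrow> chain_pairing \<phi> c = 0)"
      by (auto simp: cocycles_iff singular_cycle *)
  next
    assume r: "\<phi> \<in> cocycles p X \<and> (\<forall>c. singular_relcycle p X {} c \<longrightarrow> chain_pairing \<phi> c = 0)"
    define G where "G = chain_boundary p ` {c. singular_chain p X c}"
    have well: "chain_pairing \<phi> c = chain_pairing \<phi> d"
      if "singular_chain p X c" "singular_chain p X d" "chain_boundary p c = chain_boundary p d" for c d
      using r that singular_chain_diff[OF that(1,2)]
      by (auto simp: singular_cycle chain_boundary_diff chain_pairing_diff dest: spec[of _ "c - d"])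
    \<comment> \<open>The cocycle read as a function of the boundary; by \<open>well\<close> the
      choice of the chain does not matter.\<close>
    define h where "h x = chain_pairing \<phi> (SOME c. singular_chain p X c \<and> chain_boundary p c = x)" for x
    have h: "h (chain_boundary p c) = chain_pairing \<phi> c" if "singular_chain p X c" for c
      unfolding h_def by (rule someI2[of _ c]) (auto simp: that intro: well)
    have "\<exists>H. (\<forall>x y. H (x + y) = H x + H y) \<and> (\<forall>x\<in>G. H x = h x)"
    proof (rule additive_extension)
      show "0 \<in> G" by (auto simp: G_def intro!: image_eqI[of _ _ 0])
      fix x y assume "x \<in> G" "y \<in> G"
      then obtain c d where *: "x = chain_boundary p c" "y = chain_boundary p d"
          "singular_chain p X c" "singular_chain p X d"
        by (auto simp: G_def)
      then have d: "x - y = chain_boundary p (c - d)" "singular_chain p X (c - d)"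
        by (simp_all add: chain_boundary_diff singular_chain_diff)
      show "x - y \<in> G" using d by (auto simp: G_def)
      show "h (x - y) = h x - h y" unfolding d(1) using h[OF d(2)] h * by (simp add: chain_pairing_diff)
    qed
    then obtain H where H: "\<And>x y. H (x + y) = H x + H y" "\<And>x. x \<in> G \<Longrightarrow> H x = h x" by blast
    define \<psi> where "\<psi> = (\<lambda>\<sigma>\<in>{\<sigma>. singular_simplex q X \<sigma>}. H (frag_of \<sigma>))"
    have "coboundary q X \<psi> = \<phi>"
    proof
      fix \<sigma>
      show "coboundary q X \<psi> \<sigma> = \<phi> \<sigma>"
      proof (cases "singular_simplex p X \<sigma>")
        case True
        then have c: "singular_chain (Suc q) X (frag_of \<sigma>)" by (simp add: singular_chain_of Suc)
        have "coboundary q X \<psi> \<sigma> = chain_pairing \<psi> (chain_boundary (Suc q) (frag_of \<sigma>))"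
          using chain_pairing_coboundary[OF c, of \<psi>] by simp
        also have "\<dots> = chain_pairing (\<lambda>\<sigma>. H (frag_of \<sigma>)) (chain_boundary (Suc q) (frag_of \<sigma>))"
          by (rule chain_pairing_cong[OF singular_chain_boundary_alt[OF c]]) (simp add: \<psi>_def)
        also have "\<dots> = H (chain_boundary p (frag_of \<sigma>))"
          using H(1) by (simp add: chain_pairing_of_additive Suc)
        also have "\<dots> = \<phi> \<sigma>" using c H(2) h[of "frag_of \<sigma>"] by (auto simp: G_def Suc)
        finally show ?thesis .
      next
        case False
        then show ?thesis using r by (simp add: coboundary_def Suc cocycles_iff extensional_def)
      qed
    qed
    then show "\<phi> \<in> coboundaries p X"
      by (auto simp: coboundaries_def Suc carrier_cochains \<psi>_def intro!: image_eqI[of _ _ \<psi>])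
  qed
qed

abbreviation functionals :: "nat \<Rightarrow> 'x topology \<Rightarrow> ('x chain set \<Rightarrow> real) set" where
  "functionals p X \<equiv> hom (homology_group (int p) X) real_group"

text \<open>
  The class in \<open>H\<^sup>p(X)\<close> that corresponds to \<open>h\<close> under \<open>H\<^sup>p(X) \<cong> Hom(H\<^sub>p(X), \<real>)\<close>.
\<close>

definition coclass :: "nat \<Rightarrow> 'x topology \<Rightarrow> ('x chain set \<Rightarrow> real) \<Rightarrow> 'x cochain set" where
  "coclass p X h = {\<phi> \<in> cocycles p X. \<forall>c. singular_relcycle p X {} c \<longrightarrow>
     chain_pairing \<phi> c = h (homologous_rel_set p X {} c)}"

section \<open>Cohomology as the dual of integral homology\<close>

lemma homologous_rel_set_hom:
  "homologous_rel_set p X S \<in> hom (relcycle_group p X S) (relative_homology_group (int p) X S)"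
  using normal.r_coset_hom_Mod[OF normal_subgroup_singular_relboundary_relcycle[of p X S]]
  by (simp add: right_coset_singular_relboundary nontrivial_relative_homology_group)

lemma homologous_rel_set_carrier:
  "singular_relcycle p X S c \<Longrightarrow> homologous_rel_set p X S c \<in> carrier (relative_homology_group (int p) X S)"
  by (simp add: carrier_relative_homology_group)

lemma homologous_rel_set_add:
  assumes "singular_relcycle p X S c" "singular_relcycle p X S d"
  shows "homologous_rel_set p X S (c + d) =
    homologous_rel_set p X S c \<otimes>\<^bsub>relative_homology_group (int p) X S\<^esub> homologous_rel_set p X S d"
  using hom_mult[OF homologous_rel_set_hom, of c p X S d] assms by simp

lemma hom_real_homologous_add:
  assumes "h \<in> functionals p X" "singular_relcycle p X {} c" "singular_relcycle p X {} d"
  shows "h (homologous_rel_set p X {} (c + d)) = h (homologous_rel_set p X {} c) + h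
      (homologous_rel_set p X {} d)"
  using assms hom_mult[OF assms(1)] by (simp add: homologous_rel_set_add homologous_rel_set_carrier)

lemma hom_real_homologous_diff:
  assumes "h \<in> functionals p X" "singular_relcycle p X {} c" "singular_relcycle p X {} d"
  shows "h (homologous_rel_set p X {} (c - d)) = h (homologous_rel_set p X {} c) - h
      (homologous_rel_set p X {} d)"
  using hom_real_homologous_add[OF assms(1), of "c - d" d] assms by (simp add: singular_relcycle_diff)

lemma hom_real_homologous_boundary:
  assumes "h \<in> functionals p X" "singular_relboundary p X {} c"
  shows "h (homologous_rel_set p X {} c) = 0"
proof -
  have "homologous_rel_set p X {} c = \<one>\<^bsub>homology_group (int p) X\<^esub>"
    using assms(2) by (simp add: homologous_rel_set_eq_relboundary)
  then show ?thesis using hom_one[OF assms(1)] by simp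
qed

text \<open>The functional, viewed on cycles, extends to all chains by divisibility. The extension
  is a cocycle since boundaries represent the neutral element of homology.\<close>

lemma ex_coclass:
  assumes h: "h \<in> functionals p X"
  shows "\<exists>\<phi>. \<phi> \<in> coclass p X h"
proof -
  have "\<exists>H. (\<forall>x y. H (x + y) = H x + H y) \<and>
      (\<forall>c\<in>singular_relcycle_set p X {}. H c = h (homologous_rel_set p X {} c))"
    by (rule additive_extension) (auto simp: singular_relcycle_diff hom_real_homologous_diff[OF h])
  then obtain H where H: "\<And>x y. H (x + y) = H x + H y"
    "\<And>c. singular_relcycle p X {} c \<Longrightarrow> H c = h (homologous_rel_set p X {} c)" by auto
  define \<phi> where "\<phi> = (\<lambda>\<sigma>\<in>{\<sigma>. singular_simplex p X \<sigma>}. H (frag_of \<sigma>))"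
  have \<phi>: "chain_pairing \<phi> c = H c" if "singular_chain p X c" for c
    using chain_pairing_cong[OF that, of \<phi> "\<lambda>\<sigma>. H (frag_of \<sigma>)"] chain_pairing_of_additive[of H c] H(1)
    by (simp add: \<phi>_def)
  have "chain_pairing \<phi> (chain_boundary (Suc p) c) = 0" if "singular_chain (Suc p) X c" for c
  proof -
    have b: "singular_relboundary p X {} (chain_boundary (Suc p) c)"
      using that by (auto simp: singular_boundary)
    then have "singular_relcycle p X {} (chain_boundary (Suc p) c)" by
        (rule singular_relboundary_imp_relcycle)
    then show ?thesis
      using H(2) \<phi>[OF singular_chain_boundary_alt[OF that]] hom_real_homologous_boundary[OF h b] by simp
  qed
  then have "\<phi> \<in> cocycles p X" by (simp add: cocycles_iff \<phi>_def)
  then have "\<phi> \<in> coclass p X h" using \<phi> H(2) by (auto simp: coclass_def singular_cycle)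
  then show ?thesis by blast
qed

text \<open>A cocycle is constant on homologous cycles, so it descends to homology classes.\<close>

lemma coclass_of_cocycle:
  assumes \<phi>: "\<phi> \<in> cocycles p X"
  shows "\<exists>h\<in>functionals p X. \<phi> \<in> coclass p X h"
proof -
  have well: "chain_pairing \<phi> c = chain_pairing \<phi> d" if cd: "homologous_rel p X {} c d" for c d
  proof -
    obtain e where "singular_chain (Suc p) X e" "chain_boundary (Suc p) e = c - d"
      using cd by (auto simp: homologous_rel_def singular_boundary)
    then have "chain_pairing \<phi> (c - d) = 0" using \<phi> by (metis cocycles_iff)
    then show ?thesis by (simp add: chain_pairing_diff)
  qed
  define h where "h A = chain_pairing \<phi> (SOME c. c \<in> A)" for A
  have h: "h (homologous_rel_set p X {} c) = chain_pairing \<phi> c" for c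
    unfolding h_def by (rule someI2[of _ c]) (auto intro: well[symmetric])
  have "h \<in> functionals p X"
  proof (rule homI)
    fix A B assume "A \<in> carrier (homology_group (int p) X)" "B \<in> carrier (homology_group (int p) X)"
    then obtain c d where cd: "A = homologous_rel_set p X {} c" "singular_relcycle p X {} c"
        "B = homologous_rel_set p X {} d" "singular_relcycle p X {} d"
      by (auto simp: carrier_relative_homology_group)
    then have "A \<otimes>\<^bsub>homology_group (int p) X\<^esub> B = homologous_rel_set p X {} (c + d)"
      by (simp add: homologous_rel_set_add)
    then show "h (A \<otimes>\<^bsub>homology_group (int p) X\<^esub> B) = h A \<otimes>\<^bsub>real_group\<^esub> h B"
      using cd by (simp add: h chain_pairing_add)
  qed simp
  moreover have "\<phi> \<in> coclass p X h" using \<phi> by (simp add: coclass_def h)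
  ultimately show ?thesis by blast
qed

lemma chain_pairing_add_cochains:
  assumes "singular_chain p X c"
  shows "chain_pairing (\<phi> \<oplus>\<^bsub>cochains p X\<^esub> \<psi>) c = chain_pairing \<phi> c + chain_pairing \<psi> c"
proof -
  have "chain_pairing (\<phi> \<oplus>\<^bsub>cochains p X\<^esub> \<psi>) c = chain_pairing (\<lambda>\<sigma>. \<phi> \<sigma> + \<psi> \<sigma>) c"
    using assms by (rule chain_pairing_cong) (simp add: add_cochains)
  then show ?thesis by (simp add: chain_pairing_def algebra_simps sum.distrib)
qed

lemma chain_pairing_smult_cochains:
  assumes "singular_chain p X c"
  shows "chain_pairing (k \<odot>\<^bsub>cochains p X\<^esub> \<phi>) c = k * chain_pairing \<phi> c"
proof -
  have "chain_pairing (k \<odot>\<^bsub>cochains p X\<^esub> \<phi>) c = chain_pairing (\<lambda>\<sigma>. k * \<phi> \<sigma>) c"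
    using assms by (rule chain_pairing_cong) (simp add: smult_cochains)
  then show ?thesis by (simp add: chain_pairing_def algebra_simps sum_distrib_left)
qed

lemma cocycles_add: "\<phi> \<in> cocycles p X \<Longrightarrow> \<psi> \<in> cocycles p X \<Longrightarrow> \<phi> \<oplus>\<^bsub>cochains p X\<^esub> \<psi> \<in> cocycles p X"
  by (simp add: cocycles_iff chain_pairing_add_cochains[OF singular_chain_boundary_alt])
     (simp add: add_cochains)

lemma cocycles_smult: "\<phi> \<in> cocycles p X \<Longrightarrow> k \<odot>\<^bsub>cochains p X\<^esub> \<phi> \<in> cocycles p X"
  by (simp add: cocycles_iff chain_pairing_smult_cochains[OF singular_chain_boundary_alt])
     (simp add: smult_cochains)

lemma singular_cycle_imp_chain: "singular_relcycle p X {} c \<Longrightarrow> singular_chain p X c"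
  by (simp add: singular_cycle)

lemma coclass_add:
  assumes "\<phi> \<in> coclass p X h" "\<psi> \<in> coclass p X h'"
  shows "\<phi> \<oplus>\<^bsub>cochains p X\<^esub> \<psi> \<in> coclass p X (\<lambda>A. h A + h' A)"
  using assms by (auto simp: coclass_def cocycles_add chain_pairing_add_cochains[OF
      singular_cycle_imp_chain])

lemma coclass_smult:
  assumes "\<phi> \<in> coclass p X h"
  shows "k \<odot>\<^bsub>cochains p X\<^esub> \<phi> \<in> coclass p X (\<lambda>A. k * h A)"
  using assms by (auto simp: coclass_def cocycles_smult chain_pairing_smult_cochains[OF
      singular_cycle_imp_chain])

lemma coboundaries_eq_coclass: "coboundaries p X = coclass p X (\<lambda>_. 0)"
  by (auto simp: coclass_def coboundaries_iff)

lemma coclass_cong: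
  assumes "\<And>A. A \<in> carrier (homology_group (int p) X) \<Longrightarrow> h A = h' A"
  shows "coclass p X h = coclass p X h'"
  using assms by (auto simp: coclass_def homologous_rel_set_carrier)

text \<open>A common representative evaluates to both functionals on every cycle; it exists because
  the coclass of a functional is non-empty.\<close>

lemma coclass_eq_iff:
  assumes h: "h \<in> functionals p X"
  shows "coclass p X h = coclass p X h' \<longleftrightarrow> (\<forall>A\<in>carrier (homology_group (int p) X). h A = h' A)"
proof
  assume eq: "coclass p X h = coclass p X h'"
  obtain \<phi> where \<phi>: "\<phi> \<in> coclass p X h" using ex_coclass[OF h] by (rule exE)
  then have "\<phi> \<in> coclass p X h'" using eq by simp
  with \<phi> show "\<forall>A\<in>carrier (homology_group (int p) X). h A = h' A"
    by (auto simp: coclass_def carrier_relative_homology_group)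
qed (rule coclass_cong, simp)

abbreviation coboundary_coset :: "nat \<Rightarrow> 'x topology \<Rightarrow> 'x cochain \<Rightarrow> 'x cochain set" where
  "coboundary_coset p X \<phi> \<equiv> (\<Union>\<psi>\<in>coboundaries p X. {\<psi> \<oplus>\<^bsub>cochains p X\<^esub> \<phi>})"

text \<open>Two cocycles inducing the same functional differ by a cocycle vanishing on all cycles,
  hence by a coboundary.\<close>

lemma coboundaries_coset:
  assumes \<phi>: "\<phi> \<in> coclass p X h"
  shows "coboundary_coset p X \<phi> = coclass p X h"
proof (intro equalityI subsetI)
  fix \<kappa> assume "\<kappa> \<in> coboundary_coset p X \<phi>"
  then obtain \<psi> where "\<psi> \<in> coclass p X (\<lambda>_. 0)" "\<kappa> = \<psi> \<oplus>\<^bsub>cochains p X\<^esub> \<phi>"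
    by (auto simp: coboundaries_eq_coclass)
  then show "\<kappa> \<in> coclass p X h" using coclass_add[OF _ \<phi>] by fastforce
next
  fix \<kappa> assume \<kappa>: "\<kappa> \<in> coclass p X h"
  define \<psi> where "\<psi> = \<kappa> \<oplus>\<^bsub>cochains p X\<^esub> ((-1) \<odot>\<^bsub>cochains p X\<^esub> \<phi>)"
  have "\<psi> \<in> coclass p X (\<lambda>A. h A + (-1) * h A)"
    unfolding \<psi>_def by (intro coclass_add coclass_smult \<kappa> \<phi>)
  then have "\<psi> \<in> coboundaries p X" by (simp add: coboundaries_eq_coclass)
  moreover have "\<kappa> = \<psi> \<oplus>\<^bsub>cochains p X\<^esub> \<phi>"
    using \<kappa> by (auto simp: \<psi>_def add_cochains smult_cochains coclass_def cocycles_iff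
        extensional_def fun_eq_iff)
  ultimately show "\<kappa> \<in> coboundary_coset p X \<phi>" by blast
qed

text \<open>The universal coefficient theorem for real coefficients; the following lemmas make the
  identification linear and compatible with restriction.\<close>

lemma carrier_cohomology:
  "carrier (cohomology p X) = coclass p X ` functionals p X"
proof -
  have "carrier (cohomology p X) = (\<Union>\<phi>\<in>cocycles p X. {coboundary_coset p X \<phi>})"
    by (simp add: cohomology_def quotient_space_def A_RCOSETS_def' a_r_coset_def')
  also have "\<dots> = coclass p X ` functionals p X"
  proof (intro equalityI subsetI)
    fix A assume "A \<in> (\<Union>\<phi>\<in>cocycles p X. {coboundary_coset p X \<phi>})"
    then obtain \<phi> where "\<phi> \<in> cocycles p X" "A = coboundary_coset p X \<phi>" by blast
    moreover from this obtain h where "h \<in> functionals p X" "\<phi> \<in> coclass p X h"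
      using coclass_of_cocycle by blast
    ultimately show "A \<in> coclass p X ` functionals p X"
      using coboundaries_coset by blast
  next
    fix A assume "A \<in> coclass p X ` functionals p X"
    then obtain h where h: "h \<in> functionals p X" "A = coclass p X h" by blast
    obtain \<phi> where \<phi>: "\<phi> \<in> coclass p X h" using ex_coclass[OF h(1)] by (rule exE)
    then have "\<phi> \<in> cocycles p X" by (simp add: coclass_def)
    then show "A \<in> (\<Union>\<phi>\<in>cocycles p X. {coboundary_coset p X \<phi>})"
      using coboundaries_coset[OF \<phi>] h(2) by blast
  qed
  finally show ?thesis .
qed

lemma zero_cohomology: "\<zero>\<^bsub>cohomology p X\<^esub> = coclass p X (\<lambda>_. 0)"
  by (simp add: cohomology_def quotient_space_def coboundaries_eq_coclass)

text \<open>The sum of cosets is a set of sums. To reach every representative of the sum, a fixed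
  representative of the first summand is subtracted.\<close>

lemma add_cohomology:
  assumes h: "h \<in> functionals p X"
  shows "coclass p X h \<oplus>\<^bsub>cohomology p X\<^esub> coclass p X h' = coclass p X (\<lambda>A. h A + h' A)"
proof -
  obtain \<phi> where \<phi>: "\<phi> \<in> coclass p X h" using ex_coclass[OF h] by (rule exE)
  have "\<kappa> \<in> (\<Union>\<phi>\<in>coclass p X h. \<Union>\<psi>\<in>coclass p X h'. {\<phi> \<oplus>\<^bsub>cochains p X\<^esub> \<psi>})"
    if \<kappa>: "\<kappa> \<in> coclass p X (\<lambda>A. h A + h' A)" for \<kappa>
  proof -
    define \<psi> where "\<psi> = \<kappa> \<oplus>\<^bsub>cochains p X\<^esub> ((-1) \<odot>\<^bsub>cochains p X\<^esub> \<phi>)"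
    have "\<psi> \<in> coclass p X (\<lambda>A. (h A + h' A) + (-1) * h A)"
      unfolding \<psi>_def by (intro coclass_add coclass_smult \<kappa> \<phi>)
    then have "\<psi> \<in> coclass p X h'" by simp
    moreover have "\<kappa> = \<phi> \<oplus>\<^bsub>cochains p X\<^esub> \<psi>"
      using \<kappa> by (auto simp: \<psi>_def add_cochains smult_cochains coclass_def cocycles_iff
          extensional_def fun_eq_iff)
    ultimately show ?thesis using \<phi> by blast
  qed
  then have "(\<Union>\<phi>\<in>coclass p X h. \<Union>\<psi>\<in>coclass p X h'. {\<phi> \<oplus>\<^bsub>cochains p X\<^esub> \<psi>}) = coclass p X (\<lambda>A. h A + h' A)"
    using coclass_add by blast
  then show ?thesis by (simp add: cohomology_def quotient_space_def set_add_def')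
qed

text \<open>The defining union runs over the representatives, all of which contribute the same
  coset; there is at least one.\<close>

lemma smult_cohomology:
  assumes h: "h \<in> functionals p X"
  shows "k \<odot>\<^bsub>cohomology p X\<^esub> coclass p X h = coclass p X (\<lambda>A. k * h A)"
proof -
  have "coboundary_coset p X (k \<odot>\<^bsub>cochains p X\<^esub> \<phi>) = coclass p X (\<lambda>A. k * h A)"
    if "\<phi> \<in> coclass p X h" for \<phi>
    using that by (intro coboundaries_coset coclass_smult)
  moreover have "coclass p X h \<noteq> {}" using ex_coclass[OF h] by blast
  ultimately show ?thesis
    by (simp add: cohomology_def quotient_space_def a_r_coset_def')
qed

text \<open>The inclusion sends the class of a cycle to the class of the same cycle, so restricting
  a cocycle composes its functional with the inclusion in homology.\<close>

lemma restrict_coclass: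
  assumes h: "h \<in> functionals p X"
  shows "restrict_class p X V (coclass p X h) =
    coclass p (subtopology X V) (h \<circ> homology_inclusion (int p) X V)"
proof -
  let ?V = "subtopology X V" and ?i = "homology_inclusion (int p) X V"
  have "restrict \<phi> {\<sigma>. singular_simplex p ?V \<sigma>} \<in> coclass p ?V (h \<circ> ?i)"
    if \<phi>: "\<phi> \<in> coclass p X h" for \<phi>
  proof -
    let ?\<psi> = "restrict \<phi> {\<sigma>. singular_simplex p ?V \<sigma>}"
    have sub: "singular_chain q X c" if "singular_chain q ?V c" for q c
      using that by (simp add: singular_chain_subtopology)
    have e: "chain_pairing ?\<psi> c = chain_pairing \<phi> c" if "singular_chain p ?V c" for c
      using that by (rule chain_pairing_cong) simp
    have "chain_pairing ?\<psi> (chain_boundary (Suc p) c) = 0" if c: "singular_chain (Suc p) ?V c" for c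
      using e[OF singular_chain_boundary_alt[OF c]] sub[OF c] \<phi> by (simp add: coclass_def cocycles_iff)
    moreover have "chain_pairing ?\<psi> c = (h \<circ> ?i) (homologous_rel_set p ?V {} c)"
      if c: "singular_relcycle p ?V {} c" for c
    proof -
      have cX: "singular_relcycle p X {} c" using c sub by (simp add: singular_cycle)
      have "chain_map p id c = c"
        using chain_map_id_gen[OF singular_cycle_imp_chain[OF cX], of id] by simp
      then have "?i (homologous_rel_set p ?V {} c) = homologous_rel_set p X {} c"
        using c by (simp add: hom_induced_chain_map continuous_map_id_subtopology)
      then show ?thesis using \<phi> cX e[OF singular_cycle_imp_chain[OF c]] by (simp add: coclass_def)
    qed
    ultimately show ?thesis by (simp add: coclass_def cocycles_iff)
  qed
  then have "coboundary_coset p ?V (restrict \<phi> {\<sigma>. singular_simplex p ?V \<sigma>}) = coclass p ?V (h \<circ> ?i)"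
    if "\<phi> \<in> coclass p X h" for \<phi>
    using that by (intro coboundaries_coset)
  moreover have "coclass p X h \<noteq> {}" using ex_coclass[OF h] by blast
  ultimately show ?thesis
    by (simp add: restrict_class_def a_r_coset_def')
qed

section \<open>Dimension of the sublevel quotients\<close>

text \<open>\<open>\<Psi>\<close> parametrizes \<open>Q\<close> by functions and forgets exactly the
  values outside \<open>I\<close>. The vector space axioms are inherited from pointwise operations,
  and enumerating \<open>I\<close> gives an isomorphism with real vectors of length
  \<open>card I\<close>.\<close>

lemma vectorspace_coordinates:
  fixes Q :: "(real, 'v, 'm) module_scheme" and \<Psi> :: "('s \<Rightarrow> real) \<Rightarrow> 'v"
  assumes I: "finite I"
    and carrier: "carrier Q = range \<Psi>" and zero: "\<zero>\<^bsub>Q\<^esub> = \<Psi> (\<lambda>_. 0)"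
    and add: "\<And>a b. \<Psi> a \<oplus>\<^bsub>Q\<^esub> \<Psi> b = \<Psi> (\<lambda>s. a s + b s)"
    and smult: "\<And>k a. k \<odot>\<^bsub>Q\<^esub> \<Psi> a = \<Psi> (\<lambda>s. k * a s)"
    and eq: "\<And>a b. \<Psi> a = \<Psi> b \<longleftrightarrow> (\<forall>s\<in>I. a s = b s)"
  shows "vectorspace.dim class_ring Q = card I"
proof -
  have "abelian_group Q"
  proof (rule abelian_groupI)
    fix x assume "x \<in> carrier Q"
    then obtain a where "x = \<Psi> a" by (auto simp: carrier)
    then have "\<Psi> (\<lambda>s. - a s) \<oplus>\<^bsub>Q\<^esub> x = \<zero>\<^bsub>Q\<^esub>" by (simp add: add zero)
    then show "\<exists>y\<in>carrier Q. y \<oplus>\<^bsub>Q\<^esub> x = \<zero>\<^bsub>Q\<^esub>" by (auto simp: carrier)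
  qed (auto simp: carrier zero add algebra_simps)
  then have "Module.module class_ring Q"
    by (intro Module.module.intro module_axioms.intro)
       (auto simp: carrier add smult algebra_simps class_cring.cring_axioms)
  then have vs: "vectorspace class_ring Q"
    by (simp add: vectorspace_def class_field.field_axioms)
  obtain f where f: "bij_betw f {..<card I} I"
    using ex_bij_betw_nat_finite[OF I] by (auto simp: atLeast0LessThan)
  interpret V: vec_space "TYPE(real)" "card I" .
  define T where "T v = \<Psi> (\<lambda>s. v $ inv_into {..<card I} f s)" for v
  have inv: "inv_into {..<card I} f (f j) = j" if "j < card I" for j
    using f that by (simp add: bij_betw_def)
  have inv_less: "inv_into {..<card I} f s < card I" if "s \<in> I" for s
    using f that by (metis bij_betw_imp_surj_on inv_into_into lessThan_iff)
  have "linear_map class_ring V.V Q T"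
    unfolding linear_map_def mod_hom_def mod_hom_axioms_def
  proof (intro conjI)
    show "vectorspace class_ring V.V" by (rule V.vectorspace_axioms)
    show "vectorspace class_ring Q" by (rule vs)
    then show "Module.module class_ring Q" by (simp add: vectorspace_def)
    show "Module.module class_ring V.V" by (rule V.module_axioms)
    show "T \<in> module_hom class_ring V.V Q"
      unfolding module_hom_def using inv_less
      by (auto simp: T_def carrier module_vec_simps add smult eq)
  qed
  then interpret T: linear_map class_ring V.V Q T .
  have "V.dim = T.W.dim"
  proof (rule T.dim_eq)
    show "inj_on T (carrier V.V)"
    proof (rule inj_onI)
      fix v w assume vw: "v \<in> carrier V.V" "w \<in> carrier V.V" "T v = T w"
      then have "\<forall>s\<in>I. v $ inv_into {..<card I} f s = w $ inv_into {..<card I} f s"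
        by (simp add: T_def eq)
      then have "v $ j = w $ j" if "j < card I" for j
        using bij_betwE[OF f] that inv[OF that] by (metis lessThan_iff)
      then show "v = w" using vw by (auto simp: module_vec_simps intro: eq_vecI)
    qed
    show "T ` carrier V.V = carrier Q"
    proof (intro equalityI subsetI)
      fix x assume "x \<in> carrier Q"
      then obtain a where a: "x = \<Psi> a" by (auto simp: carrier)
      have "T (vec (card I) (\<lambda>j. a (f j))) = x"
        unfolding T_def a eq using inv_less f by (auto simp: bij_betw_inv_into_right)
      then show "x \<in> T ` carrier V.V" by (auto simp: module_vec_simps)
    qed (auto simp: T_def carrier)
  qed simp
  then show ?thesis by (simp add: V.dim_is_n)
qed

text \<open>A coset of \<open>W\<close> leaves the coordinates in \<open>I\<close> free and fixes
  those in \<open>J - I\<close>; \<open>\<Psi> a\<close> is this coset.\<close>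

lemma dim_quotient_space_coordinates:
  fixes V :: "(real, 'v, 'm) module_scheme" and \<Phi> :: "('s \<Rightarrow> real) \<Rightarrow> 'v"
  assumes J: "finite J"
    and carrier: "carrier V = \<Phi> ` {a. \<forall>s. s \<notin> J \<longrightarrow> a s = 0}"
    and W: "W = \<Phi> ` {a. \<forall>s. s \<notin> I \<longrightarrow> a s = 0}" and "I \<subseteq> J"
    and add: "\<And>a b. \<Phi> a \<oplus>\<^bsub>V\<^esub> \<Phi> b = \<Phi> (\<lambda>s. a s + b s)"
    and smult: "\<And>k a. k \<odot>\<^bsub>V\<^esub> \<Phi> a = \<Phi> (\<lambda>s. k * a s)"
    and inj: "\<And>a b. \<Phi> a = \<Phi> b \<Longrightarrow> \<forall>s\<in>J. a s = b s"
  shows "vectorspace.dim class_ring (quotient_space V W) = card (J - I)"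
proof -
  define \<Psi> where "\<Psi> a = \<Phi> ` {b. (\<forall>s. s \<notin> J \<longrightarrow> b s = 0) \<and> (\<forall>s\<in>J - I. b s = a s)}" for a
  have coset: "(\<Union>w\<in>W. {w \<oplus>\<^bsub>V\<^esub> \<Phi> a}) = \<Psi> a" if a: "\<forall>s. s \<notin> J \<longrightarrow> a s = 0" for a
  proof (intro equalityI subsetI)
    fix x assume "x \<in> (\<Union>w\<in>W. {w \<oplus>\<^bsub>V\<^esub> \<Phi> a})"
    then obtain b where b: "\<forall>s. s \<notin> I \<longrightarrow> b s = 0" "x = \<Phi> (\<lambda>s. b s + a s)" by (auto simp: W add)
    moreover have "(\<forall>s. s \<notin> J \<longrightarrow> b s + a s = 0) \<and> (\<forall>s\<in>J - I. b s + a s = a s)"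
      using a b \<open>I \<subseteq> J\<close> by auto
    ultimately show "x \<in> \<Psi> a" by (auto simp: \<Psi>_def)
  next
    fix x assume "x \<in> \<Psi> a"
    then obtain b where b: "\<forall>s. s \<notin> J \<longrightarrow> b s = 0" "\<forall>s\<in>J - I. b s = a s" "x = \<Phi> b" by (auto simp: \<Psi>_def)
    then have "\<forall>s. s \<notin> I \<longrightarrow> b s - a s = 0" using a by (metis DiffI diff_self)
    then have "\<Phi> (\<lambda>s. b s - a s) \<in> W" by (auto simp: W)
    moreover have "x = \<Phi> (\<lambda>s. b s - a s) \<oplus>\<^bsub>V\<^esub> \<Phi> a" by (simp add: add b)
    ultimately show "x \<in> (\<Union>w\<in>W. {w \<oplus>\<^bsub>V\<^esub> \<Phi> a})" by blast
  qed
  \<comment> \<open>\<open>\<Psi>\<close> accepts all functions, whereas elements of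
    \<open>V\<close> have coordinates vanishing outside \<open>J\<close>; truncation supplies a
    representative in \<open>\<Psi> a\<close>.\<close>
  define cut where "cut a = (\<lambda>s. if s \<in> J then a s else 0)" for a :: "'s \<Rightarrow> real"
  have cut: "\<forall>s. s \<notin> J \<longrightarrow> cut a s = 0" "\<Psi> (cut a) = \<Psi> a" "\<Phi> (cut a) \<in> \<Psi> a" for a
    by (auto simp: cut_def \<Psi>_def)
  have \<Psi>_cong: "\<Psi> a = \<Psi> b" if "\<forall>s\<in>J - I. a s = b s" for a b using that by (simp add: \<Psi>_def)
  let ?Q = "quotient_space V W"
  show ?thesis
  proof (rule vectorspace_coordinates[where \<Psi> = \<Psi>])
    show "finite (J - I)" using J by simp
    have "carrier ?Q = \<Psi> ` {a. \<forall>s. s \<notin> J \<longrightarrow> a s = 0}"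
      by (auto simp: quotient_space_def A_RCOSETS_def' a_r_coset_def' carrier coset image_iff)
    also have "\<dots> = range \<Psi>"
    proof (intro equalityI subsetI)
      fix x assume "x \<in> range \<Psi>"
      then obtain a where "x = \<Psi> (cut a)" by (auto simp: cut)
      then show "x \<in> \<Psi> ` {a. \<forall>s. s \<notin> J \<longrightarrow> a s = 0}" using cut(1) by blast
    qed auto
    finally show "carrier ?Q = range \<Psi>" .
    have "(\<forall>s. s \<notin> J \<longrightarrow> b s = 0) \<and> (\<forall>s\<in>J - I. b s = 0) \<longleftrightarrow> (\<forall>s. s \<notin> I \<longrightarrow> b s = 0)" for b :: "'s \<Rightarrow> real"
      using \<open>I \<subseteq> J\<close> by blast
    then show "\<zero>\<^bsub>?Q\<^esub> = \<Psi> (\<lambda>_. 0)" by (simp add: quotient_space_def \<Psi>_def W)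
    show "\<Psi> a = \<Psi> b \<longleftrightarrow> (\<forall>s\<in>J - I. a s = b s)" for a b
    proof
      assume "\<Psi> a = \<Psi> b"
      then have "\<Phi> (cut a) \<in> \<Psi> b" using cut(3) by blast
      then obtain d where d: "\<forall>s\<in>J - I. d s = b s" "\<Phi> (cut a) = \<Phi> d" by (auto simp: \<Psi>_def)
      from inj[OF d(2)] d(1) show "\<forall>s\<in>J - I. a s = b s" by (simp add: cut_def)
    qed (rule \<Psi>_cong)
    show "\<Psi> a \<oplus>\<^bsub>?Q\<^esub> \<Psi> b = \<Psi> (\<lambda>s. a s + b s)" for a b
    proof -
      have "(\<Union>x\<in>\<Psi> a. \<Union>y\<in>\<Psi> b. {x \<oplus>\<^bsub>V\<^esub> y}) = \<Psi> (\<lambda>s. a s + b s)"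
      proof (intro equalityI subsetI)
        fix x assume "x \<in> (\<Union>x\<in>\<Psi> a. \<Union>y\<in>\<Psi> b. {x \<oplus>\<^bsub>V\<^esub> y})"
        then obtain d e where "\<forall>s. s \<notin> J \<longrightarrow> d s = 0" "\<forall>s\<in>J - I. d s = a s"
          "\<forall>s. s \<notin> J \<longrightarrow> e s = 0" "\<forall>s\<in>J - I. e s = b s" "x = \<Phi> (\<lambda>s. d s + e s)"
          by (auto simp: \<Psi>_def add)
        then show "x \<in> \<Psi> (\<lambda>s. a s + b s)" by (auto simp: \<Psi>_def intro!: imageI)
      next
        fix x assume "x \<in> \<Psi> (\<lambda>s. a s + b s)"
        then obtain d where d: "\<forall>s. s \<notin> J \<longrightarrow> d s = 0" "\<forall>s\<in>J - I. d s = a s + b s" "x = \<Phi> d"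
          by (auto simp: \<Psi>_def)
        have "\<Phi> (\<lambda>s. d s - cut a s) \<in> \<Psi> b"
          unfolding \<Psi>_def using d by (intro imageI) (auto simp: cut_def)
        moreover have "x = \<Phi> (cut a) \<oplus>\<^bsub>V\<^esub> \<Phi> (\<lambda>s. d s - cut a s)" by (simp add: add d)
        ultimately show "x \<in> (\<Union>x\<in>\<Psi> a. \<Union>y\<in>\<Psi> b. {x \<oplus>\<^bsub>V\<^esub> y})" using cut(3) by blast
      qed
      then show ?thesis by (simp add: quotient_space_def set_add_def')
    qed
    show "k \<odot>\<^bsub>?Q\<^esub> \<Psi> a = \<Psi> (\<lambda>s. k * a s)" for k a
    proof -
      have "(\<Union>w\<in>W. {w \<oplus>\<^bsub>V\<^esub> (k \<odot>\<^bsub>V\<^esub> x)}) = \<Psi> (\<lambda>s. k * a s)" if "x \<in> \<Psi> a" for x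
      proof -
        obtain d where d: "\<forall>s. s \<notin> J \<longrightarrow> d s = 0" "\<forall>s\<in>J - I. d s = a s" "x = \<Phi> d" using \<open>x \<in> \<Psi> a\<close> by
            (auto simp: \<Psi>_def)
        then have "(\<Union>w\<in>W. {w \<oplus>\<^bsub>V\<^esub> (k \<odot>\<^bsub>V\<^esub> x)}) = \<Psi> (\<lambda>s. k * d s)" unfolding d(3) smult by (intro coset) simp
        also have "\<dots> = \<Psi> (\<lambda>s. k * a s)" using d by (intro \<Psi>_cong) simp
        finally show ?thesis .
      qed
      moreover have "\<Psi> a \<noteq> {}" using cut(3) by blast
      ultimately show ?thesis by (simp add: quotient_space_def a_r_coset_def')
    qed
  qed
qed

lemma continuous_map_openin_not_eq:
  fixes g :: "'x \<Rightarrow> 'm::t1_space"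
  assumes "continuous_map X (top_of_set M) g"
  shows "openin X {x \<in> topspace X. g x \<noteq> a}"
proof -
  have "openin X {x \<in> topspace X. g x \<in> M - {a}}"
    using assms by (rule openin_continuous_map_preimage) (auto simp: openin_delete)
  moreover have "{x \<in> topspace X. g x \<in> M - {a}} = {x \<in> topspace X. g x \<noteq> a}"
    using continuous_map_image_subset_topspace[OF assms] by auto
  ultimately show ?thesis by simp
qed

lemma hom_real_sum:
  assumes "finite I" "\<And>i. i \<in> I \<Longrightarrow> f i \<in> hom G real_group"
  shows "(\<lambda>x. \<Sum>i\<in>I. k i * f i x) \<in> hom G real_group"
proof (rule homI)
  fix x y assume xy: "x \<in> carrier G" "y \<in> carrier G"
  have "k i * f i (x \<otimes>\<^bsub>G\<^esub> y) = k i * f i x + k i * f i y" if "i \<in> I" for i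
    using hom_mult[OF assms(2)[OF that] xy] by (simp add: algebra_simps)
  then show "(\<Sum>i\<in>I. k i * f i (x \<otimes>\<^bsub>G\<^esub> y)) = (\<Sum>i\<in>I. k i * f i x) \<otimes>\<^bsub>real_group\<^esub> (\<Sum>i\<in>I. k i * f i y)"
    by (simp add: sum.distrib)
qed simp

lemma hom_real_diff:
  assumes "f \<in> hom G real_group" "g \<in> hom G real_group"
  shows "(\<lambda>x. f x - g x) \<in> hom G real_group"
  using assms by (auto simp: hom_def)

section \<open>Supports of cohomology classes in the coordinates of a dual basis\<close>

context
  fixes r :: nat and X :: "'x topology" and \<Omega> :: "'i set" and \<pi> :: "'i \<Rightarrow> 'x \<Rightarrow> 'm::t1_space"
    and M :: "'m set" and a b :: 'm and z e
  assumes basis: "homology_dual_basis r X \<Omega> \<pi> M a b z e" and fin: "finite \<Omega>" and r: "r \<ge> 1"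
begin

text \<open>The component of degree \<open>p\<close> of the combination of the \<open>e S\<close>
  with coefficients \<open>k S\<close>; the index set keeps exactly those \<open>e S\<close> that
  are functionals in degree \<open>p\<close>.\<close>

definition dual_class :: "('i set \<Rightarrow> real) \<Rightarrow> nat \<Rightarrow> 'x chain set \<Rightarrow> real" where
  "dual_class k p A = (\<Sum>S\<in>{S. S \<subseteq> \<Omega> \<and> r * card S = p}. k S * e S A)"

lemma finite_degree: "finite {S. S \<subseteq> \<Omega> \<and> r * card S = p}"
  by (rule finite_subset[of _ "Pow \<Omega>"]) (use fin in auto)

lemma dual_class_hom: "dual_class k p \<in> functionals p X"
  unfolding dual_class_def[abs_def]
  using homology_dual_basis_hom[OF basis] by (intro hom_real_sum finite_degree) auto

text \<open>As \<open>r\<close> is positive, subsets of equal degree have equal cardinality, the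
  case covered by duality.\<close>

lemma dual_class_z:
  assumes "T \<subseteq> \<Omega>"
  shows "dual_class k (r * card T) (z T) = k T"
proof -
  have "dual_class k (r * card T) (z T) = (\<Sum>S\<in>{S. S \<subseteq> \<Omega> \<and> r * card S = r * card T}. if S
      = T then k T else 0)"
    unfolding dual_class_def
    using r homology_dual_basis_dual[OF basis _ assms] by (intro sum.cong) auto
  also have "\<dots> = k T" using assms finite_degree[of "r * card T"] by (simp add: sum.delta)
  finally show ?thesis .
qed

definition dual_cohomology :: "('i set \<Rightarrow> real) \<Rightarrow> nat \<Rightarrow> 'x cochain set" where
  "dual_cohomology k p = coclass p X (dual_class k p)"

text \<open>The difference vanishes on every \<open>z S\<close> of degree \<open>p\<close>, hence
  everywhere.\<close>

lemma hom_eq_dual_class: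
  assumes h: "h \<in> functionals p X"
    and z: "\<And>S. S \<subseteq> \<Omega> \<Longrightarrow> r * card S = p \<Longrightarrow> h (z S) = k S"
    and A: "A \<in> carrier (homology_group (int p) X)"
  shows "h A = dual_class k p A"
proof -
  have "h (z S) - dual_class k p (z S) = 0" if "S \<subseteq> \<Omega>" "int (r * card S) = int p" for S
  proof -
    have "r * card S = p" using that(2) by (simp only: of_nat_eq_iff)
    then show ?thesis using z[OF that(1)] dual_class_z[OF that(1), of k] by simp
  qed
  then show ?thesis
    using homology_dual_basis_zero[OF basis hom_real_diff[OF h dual_class_hom[of k p]] _ A] by auto
qed

lemma dual_cohomology_add:
  "dual_cohomology k \<oplus>\<^bsub>total_cohomology X\<^esub> dual_cohomology l = dual_cohomology (\<lambda>S. k S + l S)"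
proof -
  have "dual_class (\<lambda>S. k S + l S) p = (\<lambda>A. dual_class k p A + dual_class l p A)" for p
    by (auto simp: dual_class_def algebra_simps sum.distrib)
  then show ?thesis
    by (auto simp: total_cohomology_def dual_cohomology_def add_cohomology[OF dual_class_hom])
qed

lemma dual_cohomology_smult:
  "c \<odot>\<^bsub>total_cohomology X\<^esub> dual_cohomology k = dual_cohomology (\<lambda>S. c * k S)"
proof -
  have "dual_class (\<lambda>S. c * k S) p = (\<lambda>A. c * dual_class k p A)" for p
    by (auto simp: dual_class_def algebra_simps sum_distrib_left)
  then show ?thesis
    by (auto simp: total_cohomology_def dual_cohomology_def smult_cohomology[OF dual_class_hom])
qed

lemma dual_cohomology_inj:
  assumes "dual_cohomology k = dual_cohomology l" "S \<subseteq> \<Omega>"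
  shows "k S = l S"
proof -
  have "coclass (r * card S) X (dual_class k (r * card S)) = coclass (r * card S) X (dual_class l
      (r * card S))"
    using fun_cong[OF assms(1), of "r * card S"] by (simp add: dual_cohomology_def)
  then have "dual_class k (r * card S) (z S) = dual_class l (r * card S) (z S)"
    using homology_dual_basis_carrier[OF basis assms(2)] by (subst
        (asm) coclass_eq_iff[OF dual_class_hom]) blast
  then show ?thesis by (simp add: dual_class_z assms)
qed

lemma dual_cohomology_carrier: "dual_cohomology k \<in> carrier (total_cohomology X)"
proof -
  have "{p. dual_cohomology k p \<noteq> \<zero>\<^bsub>cohomology p X\<^esub>} \<subseteq> (\<lambda>S. r * card S) ` Pow \<Omega>"
  proof
    fix p assume p: "p \<in> {p. dual_cohomology k p \<noteq> \<zero>\<^bsub>cohomology p X\<^esub>}"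
    show "p \<in> (\<lambda>S. r * card S) ` Pow \<Omega>"
    proof (rule ccontr)
      assume "p \<notin> (\<lambda>S. r * card S) ` Pow \<Omega>"
      then have "{S. S \<subseteq> \<Omega> \<and> r * card S = p} = {}" by auto
      then have "dual_class k p = (\<lambda>_. 0)" by (simp add: dual_class_def fun_eq_iff del: Collect_empty_eq)
      then show False using p by (simp add: dual_cohomology_def zero_cohomology)
    qed
  qed
  then have "finite {p. dual_cohomology k p \<noteq> \<zero>\<^bsub>cohomology p X\<^esub>}"
    by (rule finite_subset) (use fin in auto)
  moreover have "dual_cohomology k p \<in> carrier (cohomology p X)" for p
    using dual_class_hom by (simp add: dual_cohomology_def carrier_cohomology)
  ultimately show ?thesis by (simp add: total_cohomology_def)
qed

lemma restrict_dual_cohomology_eq_zero_iff: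
  "restrict_class p X V (dual_cohomology k p) = \<zero>\<^bsub>cohomology p (subtopology X V)\<^esub> \<longleftrightarrow>
    (\<forall>A\<in>carrier (homology_group (int p) (subtopology X V)).
       dual_class k p (homology_inclusion (int p) X V A) = 0)"
  unfolding dual_cohomology_def restrict_coclass[OF dual_class_hom] zero_cohomology
  by (subst coclass_eq_iff[OF hom_compose[OF hom_induced_hom dual_class_hom]]) simp

text \<open>The coefficient at \<open>S\<close> is the value on \<open>z S\<close> of the functional
  in degree \<open>r * card S\<close>; coefficients outside the powerset are normalized to
  0.\<close>

lemma total_cohomology_cases:
  assumes x: "x \<in> carrier (total_cohomology X)"
  obtains k where "x = dual_cohomology k" "\<And>S. \<not> S \<subseteq> \<Omega> \<Longrightarrow> k S = 0"
proof -
  have "\<exists>h. h \<in> functionals p X \<and> x p = coclass p X h" for p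
    using x by (auto simp: total_cohomology_def carrier_cohomology image_iff)
  then obtain h where h: "\<And>p. h p \<in> functionals p X" "\<And>p. x p = coclass p X (h p)"
    by metis
  define k where "k S = (if S \<subseteq> \<Omega> then h (r * card S) (z S) else 0)" for S
  have "x p = dual_cohomology k p" for p
    unfolding h(2) dual_cohomology_def
    by (rule coclass_cong, rule hom_eq_dual_class[OF h(1)]) (auto simp: k_def)
  then show thesis by (intro that[of k]) (auto simp: k_def)
qed

text \<open>For \<open>S\<close> outside \<open>J\<close>, the set carrying \<open>z S\<close>
  avoids \<open>U\<close>; a class supported in \<open>U\<close> is zero on an open set containing
  it, so its coefficient at \<open>S\<close> is 0. For \<open>S\<close> in \<open>J\<close>, the
  complement of \<open>U\<close> lies in the open set on which \<open>e S\<close> vanishes. The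
  intersection of these finitely many open sets is a witness for all combinations over
  \<open>J\<close> at once.\<close>

lemma supported_cohomology_eq:
  assumes U: "U \<subseteq> topspace X" and J: "J \<subseteq> Pow \<Omega>"
    and notJ: "\<And>S x. S \<subseteq> \<Omega> \<Longrightarrow> S \<notin> J \<Longrightarrow> x \<in> topspace X \<Longrightarrow> \<forall>i\<in>\<Omega> - S. \<pi> i x = b \<Longrightarrow> x \<notin> U"
    and inJ: "\<And>S x. S \<in> J \<Longrightarrow> x \<in> topspace X \<Longrightarrow> x \<notin> U \<Longrightarrow> \<exists>i\<in>S. \<pi> i x \<noteq> a"
  shows "supported_cohomology X U = dual_cohomology ` {k. \<forall>S. S \<notin> J \<longrightarrow> k S = 0}"
proof (intro equalityI subsetI)
  fix x assume "x \<in> supported_cohomology X U"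
  then obtain V where x: "x \<in> carrier (total_cohomology X)" and V: "openin X V" "topspace X = U \<union> V"
    and zero: "\<And>p. restrict_class p X V (x p) = \<zero>\<^bsub>cohomology p (subtopology X V)\<^esub>"
    by (auto simp: supported_cohomology_def)
  obtain k where k: "x = dual_cohomology k" "\<And>S. \<not> S \<subseteq> \<Omega> \<Longrightarrow> k S = 0"
    using total_cohomology_cases[OF x] by blast
  have "k S = 0" if S: "S \<notin> J" for S
  proof (cases "S \<subseteq> \<Omega>")
    case True
    let ?W = "{x. \<forall>i\<in>\<Omega> - S. \<pi> i x = b}" and ?q = "int (r * card S)"
    have "topspace X \<inter> ?W \<subseteq> V" using notJ[OF True S] V by blast
    then have c: "continuous_map (subtopology X ?W) (subtopology X V) id"
      by (auto simp: continuous_map_in_subtopology continuous_map_id_subtopology)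
    obtain w where w: "z S = homology_inclusion ?q X ?W w"
      using homology_dual_basis_carrier_image[OF basis True] by (elim imageE)
    have "z S = homology_inclusion ?q X V (homology_map ?q (subtopology X ?W) (subtopology X V) id w)"
      by (simp add: hom_induced_compose' c continuous_map_id_subtopology w)
    moreover have "dual_class k (r * card S) (homology_inclusion ?q X V A) = 0"
      if "A \<in> carrier (homology_group ?q (subtopology X V))" for A
      using zero[of "r * card S"] that unfolding k(1) restrict_dual_cohomology_eq_zero_iff by (rule bspec)
    ultimately have "dual_class k (r * card S) (z S) = 0" by (simp add: hom_induced_carrier)
    then show ?thesis by (simp add: dual_class_z True)
  qed (rule k(2))
  then show "x \<in> dual_cohomology ` {k. \<forall>S. S \<notin> J \<longrightarrow> k S = 0}" using k(1) by blast
next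
  fix x assume "x \<in> dual_cohomology ` {k. \<forall>S. S \<notin> J \<longrightarrow> k S = 0}"
  then obtain k where k: "x = dual_cohomology k" "\<And>S. S \<notin> J \<Longrightarrow> k S = 0" by blast
  define V where "V = (\<Inter>S\<in>J. \<Union>i\<in>S. {x \<in> topspace X. \<pi> i x \<noteq> a}) \<inter> topspace X"
  have finJ: "finite J" using J fin by (meson finite_Pow_iff finite_subset)
  have "openin X V"
    unfolding V_def
  proof (rule openin_INT[OF finJ])
    fix S assume "S \<in> J"
    then have "openin X {x \<in> topspace X. \<pi> i x \<noteq> a}" if "i \<in> S" for i
      using J that homology_dual_basis_continuous[OF basis, of i] by
          (intro continuous_map_openin_not_eq) auto
    then show "openin X (\<Union>i\<in>S. {x \<in> topspace X. \<pi> i x \<noteq> a})" by (auto intro!: openin_Union)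
  qed
  moreover have "topspace X = U \<union> V"
  proof -
    have "x \<in> V" if "x \<in> topspace X" "x \<notin> U" for x
      unfolding V_def using inJ[OF _ that] that(1) by auto
    then show ?thesis using U by (auto simp: V_def)
  qed
  moreover have "restrict_class p X V (x p) = \<zero>\<^bsub>cohomology p (subtopology X V)\<^esub>" for p
    unfolding k(1) restrict_dual_cohomology_eq_zero_iff
  proof
    fix A assume A: "A \<in> carrier (homology_group (int p) (subtopology X V))"
    let ?A = "homology_inclusion (int p) X V A"
    have "k S * e S ?A = 0" if S: "S \<subseteq> \<Omega>" "r * card S = p" for S
    proof (cases "S \<in> J")
      case True
      let ?V = "{x. \<exists>i\<in>S. \<pi> i x \<noteq> a}"
      have "V \<subseteq> ?V" using True by (auto simp: V_def)
      then have c: "continuous_map (subtopology X V) (subtopology X ?V) id"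
        by (auto simp: continuous_map_in_subtopology continuous_map_id_subtopology)
      have "?A = homology_inclusion (int p) X ?V (homology_map (int p) (subtopology X V)
          (subtopology X ?V) id A)"
        by (simp add: hom_induced_compose' c continuous_map_id_subtopology)
      also have "e S \<dots> = 0"
        using homology_dual_basis_vanish[OF basis S(1)] unfolding S(2) by (simp add: hom_induced_carrier)
      finally show ?thesis by simp
    qed (simp add: k(2))
    then show "dual_class k p ?A = 0" unfolding dual_class_def by (intro sum.neutral) blast
  qed
  ultimately show "x \<in> supported_cohomology X U"
    using dual_cohomology_carrier[of k] by (auto simp: supported_cohomology_def k(1))
qed

lemma dim_supported_cohomology_quotient:
  assumes U: "U \<subseteq> topspace X" "J \<subseteq> Pow \<Omega>"
      "\<And>S x. S \<subseteq> \<Omega> \<Longrightarrow> S \<notin> J \<Longrightarrow> x \<in> topspace X \<Longrightarrow> \<forall>i\<in>\<Omega> - S. \<pi> i x = b \<Longrightarrow> x \<notin> U"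
      "\<And>S x. S \<in> J \<Longrightarrow> x \<in> topspace X \<Longrightarrow> x \<notin> U \<Longrightarrow> \<exists>i\<in>S. \<pi> i x \<noteq> a"
    and U': "U' \<subseteq> topspace X" "J' \<subseteq> Pow \<Omega>"
      "\<And>S x. S \<subseteq> \<Omega> \<Longrightarrow> S \<notin> J' \<Longrightarrow> x \<in> topspace X \<Longrightarrow> \<forall>i\<in>\<Omega> - S. \<pi> i x = b \<Longrightarrow> x \<notin> U'"
      "\<And>S x. S \<in> J' \<Longrightarrow> x \<in> topspace X \<Longrightarrow> x \<notin> U' \<Longrightarrow> \<exists>i\<in>S. \<pi> i x \<noteq> a"
    and "J' \<subseteq> J"
  shows "vectorspace.dim class_ring (quotient_space
      (total_cohomology X\<lparr>carrier := supported_cohomology X U\<rparr>) (supported_cohomology X U')) = card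
          (J - J')"
proof -
  have supp: "supported_cohomology X U = dual_cohomology ` {k. \<forall>S. S \<notin> J \<longrightarrow> k S = 0}"
    by (rule supported_cohomology_eq) (fact U)+
  have supp': "supported_cohomology X U' = dual_cohomology ` {k. \<forall>S. S \<notin> J' \<longrightarrow> k S = 0}"
    by (rule supported_cohomology_eq) (fact U')+
  show ?thesis
  proof (rule dim_quotient_space_coordinates[where \<Phi> = dual_cohomology])
    show "finite J" using U(2) fin by (auto intro: finite_subset)
    show "carrier (total_cohomology X\<lparr>carrier := supported_cohomology X U\<rparr>)
        = dual_cohomology ` {k. \<forall>S. S \<notin> J \<longrightarrow> k S = 0}"
      using supp by simp
    show "supported_cohomology X U' = dual_cohomology ` {k. \<forall>S. S \<notin> J' \<longrightarrow> k S = 0}"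
      by (rule supp')
    show "J' \<subseteq> J" by fact
    fix k l :: "'i set \<Rightarrow> real"
    show "dual_cohomology k \<oplus>\<^bsub>total_cohomology X\<lparr>carrier := supported_cohomology X U\<rparr>\<^esub>
        dual_cohomology l = dual_cohomology (\<lambda>S. k S + l S)"
      using dual_cohomology_add[of k l] by simp
    show "c \<odot>\<^bsub>total_cohomology X\<lparr>carrier := supported_cohomology X U\<rparr>\<^esub> dual_cohomology k
        = dual_cohomology (\<lambda>S. c * k S)" for c
      using dual_cohomology_smult[of c k] by simp
    show "\<forall>S\<in>J. k S = l S" if "dual_cohomology k = dual_cohomology l"
      using dual_cohomology_inj[OF that] subsetD[OF U(2)] by auto
  qed
qed

end

section \<open>Sublevel sets and critical points of averages\<close>

lemma card_subsets_by_card: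
  assumes "finite A"
  shows "card {S. S \<subseteq> A \<and> P (card S)} = (\<Sum>k | k \<le> card A \<and> P k. card A choose k)"
proof -
  have "{S. S \<subseteq> A \<and> P (card S)} = (\<Union>k\<in>{k. k \<le> card A \<and> P k}. {S. S \<subseteq> A \<and> card S = k})"
    using assms by (auto intro: card_mono)
  also have "card \<dots> = (\<Sum>k | k \<le> card A \<and> P k. card {S. S \<subseteq> A \<and> card S = k})"
    using assms by (intro card_UN_disjoint) auto
  finally show ?thesis using assms by (simp add: n_subsets)
qed

lemma card_subsets_complement:
  assumes "finite A"
  shows "card {S. S \<subseteq> A \<and> P (card A - card S)} = (\<Sum>k | k \<le> card A \<and> P k. card A choose k)"
proof -
  have "bij_betw (\<lambda>S. A - S) {S. S \<subseteq> A \<and> P (card S)} {S. S \<subseteq> A \<and> P (card A - card S)}"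
    by (rule bij_betw_byWitness[where f' = "\<lambda>S. A - S"])
       (use assms in \<open>auto simp: card_Diff_subset finite_subset double_diff card_mono\<close>)
  then show ?thesis using card_subsets_by_card[OF assms, of P] by (simp add: bij_betw_same_card)
qed

text \<open>The summation index \<open>k\<close> is the number of coordinates outside
  \<open>S\<close>. The window is half-open because both sublevel sets are strict: a value
  \<open>k / card \<Omega>\<close> equal to \<open>c - \<delta>\<close> is not removed by the
  quotient, one equal to \<open>c + \<delta>\<close> never enters.\<close>

lemma sublevel_betti_average:
  fixes f0 :: "'b::euclidean_space \<times> real \<Rightarrow> real"
  assumes \<Omega>: "finite \<Omega>" "\<Omega> \<noteq> {}" and f0: "f0 ` unit_sphere \<subseteq> {0..1}"
    and ab: "a \<in> unit_sphere" "b \<in> unit_sphere" "f0 a = 0" "f0 b = 1" and \<delta>: "\<delta> > 0"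
  shows "sublevel_betti (sphere_power \<Omega>) (average f0 \<Omega>) c \<delta> =
    (\<Sum>k | k \<le> card \<Omega> \<and> c - \<delta> \<le> real k / real (card \<Omega>) \<and> real k / real (card \<Omega>) < c + \<delta>. card \<Omega> choose k)"
proof -
  let ?X = "sphere_power \<Omega> :: ('a \<Rightarrow> 'b \<times> real) topology" and ?N = "card \<Omega>"
  have N: "?N > 0" using \<Omega> by (simp add: card_gt_0_iff)
  have "a \<noteq> b" using ab by auto
  then obtain z e where basis: "homology_dual_basis DIM('b) ?X \<Omega> (\<lambda>g x. x g) unit_sphere a b z e"
    using homology_dual_basis_sphere_power[OF ab(1,2) _ \<Omega>(1)] by blast
  define J where "J t = {S. S \<subseteq> \<Omega> \<and> real (?N - card S) / real ?N < t}" for t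
  define U where "U t = {x \<in> topspace ?X. average f0 \<Omega> x < t}" for t
  have sphere: "x g \<in> unit_sphere" if "x \<in> topspace ?X" "g \<in> \<Omega>" for x g
    using that by (auto simp: sphere_power_def)
  have f01: "0 \<le> f0 (x g)" "f0 (x g) \<le> 1" if "x \<in> topspace ?X" "g \<in> \<Omega>" for x g
    using subsetD[OF f0 imageI[OF sphere[OF that]]] by auto
  have cardS: "real (?N - card S) = (\<Sum>g\<in>\<Omega>. of_bool (g \<notin> S))" if "S \<subseteq> \<Omega>" for S
  proof -
    have "?N - card S = card (\<Omega> - S)" using that \<Omega> by (simp add: card_Diff_subset finite_subset)
    also have "real \<dots> = (\<Sum>g\<in>\<Omega>. of_bool (g \<notin> S))"
      using \<Omega> by (simp add: of_bool_def sum.If_cases Diff_eq Collect_neg_eq Int_commute)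
    finally show ?thesis by simp
  qed
  have notJ: "x \<notin> U t" if S: "S \<subseteq> \<Omega>" "S \<notin> J t" and x: "x \<in> topspace ?X" "\<forall>g\<in>\<Omega> - S. x g = b" for S t x
  proof -
    have "real (?N - card S) \<le> (\<Sum>g\<in>\<Omega>. f0 (x g))"
      unfolding cardS[OF S(1)] using f01[OF x(1)] x(2) ab by (intro sum_mono) (auto simp: of_bool_def)
    then have "real (?N - card S) / real ?N \<le> average f0 \<Omega> x"
      using N by (simp add: average_def field_simps)
    then show ?thesis using S by (simp add: J_def U_def)
  qed
  have inJ: "\<exists>g\<in>S. x g \<noteq> a" if S: "S \<in> J t" and x: "x \<in> topspace ?X" "x \<notin> U t" for S t x
  proof (rule ccontr)
    assume "\<not> (\<exists>g\<in>S. x g \<noteq> a)"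
    then have "(\<Sum>g\<in>\<Omega>. f0 (x g)) \<le> real (?N - card S)"
      using S f01[OF x(1)] ab by (subst cardS) (auto simp: J_def intro!: sum_mono)
    then have "average f0 \<Omega> x \<le> real (?N - card S) / real ?N"
      using N by (simp add: average_def field_simps)
    then show False using S x by (simp add: J_def U_def)
  qed
  have "sublevel_betti ?X (average f0 \<Omega>) c \<delta> = card (J (c + \<delta>) - J (c - \<delta>))"
    unfolding sublevel_betti_def U_def[symmetric]
  proof (rule dim_supported_cohomology_quotient[OF basis \<Omega>(1)])
    show "1 \<le> DIM('b)" using DIM_positive[where 'a = 'b] by linarith
  qed (use \<delta> notJ inJ in \<open>auto simp: U_def J_def\<close>)
  also have "J (c + \<delta>) - J (c - \<delta>) = {S. S \<subseteq> \<Omega> \<and> (c - \<delta> \<le> real (?N - card S) / real ?N \<and> real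
      (?N - card S) / real ?N < c + \<delta>)}"
    by (auto simp: J_def)
  also have "card \<dots> = (\<Sum>k | k \<le> ?N \<and> c - \<delta> \<le> real k / real ?N \<and> real k / real ?N < c + \<delta>. ?N choose k)"
    by (rule card_subsets_complement[OF \<Omega>(1)])
  finally show ?thesis .
qed

section \<open>Stereographic charts and critical points\<close>

lemma stereo_in_unit_sphere: "s \<in> {-1, 1} \<Longrightarrow> stereo s y \<in> unit_sphere"
proof -
  assume s: "s \<in> {-1, 1}"
  have n: "(norm y)\<^sup>2 + 1 > 0" by (simp add: add_nonneg_pos)
  have "(norm (stereo s y))\<^sup>2 = (2 / ((norm y)\<^sup>2 + 1))\<^sup>2 * (norm y)\<^sup>2 + (((norm y)\<^sup>2 - 1) /
      ((norm y)\<^sup>2 + 1))\<^sup>2"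
  proof -
    define k q where "k = 2 / ((norm y)\<^sup>2 + 1)" and "q = ((norm y)\<^sup>2 - 1) / ((norm y)\<^sup>2 + 1)"
    have "(s * q)\<^sup>2 = q\<^sup>2" using s by auto
    then have "(norm (k *\<^sub>R y, s * q))\<^sup>2 = k\<^sup>2 * (norm y)\<^sup>2 + q\<^sup>2"
      by (simp add: norm_Pair power_mult_distrib)
    then show ?thesis by (simp add: stereo_def k_def q_def)
  qed
  also have "\<dots> = 1" using n by (simp add: power_divide field_simps)
      (simp add: power2_eq_square algebra_simps)
  finally have "norm (stereo s y) = 1" using norm_ge_zero[of "stereo s y"] by (simp add: power2_eq_1_iff)
  then show ?thesis by simp
qed

lemma unit_sphere_stereo:
  fixes x :: "'b::euclidean_space \<times> real"
  assumes "x \<in> unit_sphere"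
  obtains s y where "s \<in> {-1, 1}" "x = stereo s y"
proof -
  obtain u t where x: "x = (u, t)" by (cases x)
  have ut: "(norm u)\<^sup>2 + t\<^sup>2 = 1" using assms by (simp add: x norm_Pair)
  show thesis
  proof (cases "t = 1")
    case True
    then have "u = 0" using ut by simp
    \<comment> \<open>The pole missed by \<open>stereo 1\<close> is the image of 0 in the other
      chart.\<close>
    then have "x = stereo (-1) 0" using True by (simp add: x stereo_def)
    then show thesis using that by blast
  next
    case False
    have t: "1 - t > 0"
    proof -
      have "t\<^sup>2 \<le> 1" using ut zero_le_power2[of "norm u"] by linarith
      then have "t \<le> 1" by (rule power2_le_imp_le[of t 1, simplified])
      then show ?thesis using False by simp
    qed
    \<comment> \<open>Stereographic projection of \<open>x\<close> from the pole
      \<open>(0, 1)\<close>.\<close>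
    define y where "y = (1 / (1 - t)) *\<^sub>R u"
    have "(norm y)\<^sup>2 = (1 - t\<^sup>2) / (1 - t)\<^sup>2" using ut by (simp add: y_def power_mult_distrib power_divide)
    also have "1 - t\<^sup>2 = (1 - t) * (1 + t)" by (simp add: power2_eq_square algebra_simps)
    also have "(1 - t) * (1 + t) / (1 - t)\<^sup>2 = (1 + t) / (1 - t)"
      using t unfolding power2_eq_square by (intro mult_divide_mult_cancel_left) simp
    finally have ny: "(norm y)\<^sup>2 = (1 + t) / (1 - t)" .
    have "(norm y)\<^sup>2 + 1 = 2 / (1 - t)" "(norm y)\<^sup>2 - 1 = 2 * t / (1 - t)" using t unfolding ny by
        (simp_all add: field_simps)
    then have "x = stereo 1 y" using t unfolding x stereo_def by (simp add: y_def)
    then show thesis using that by blast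
  qed
qed

lemma smooth_on_sphere_differentiable:
  assumes "smooth_on_sphere f" "s \<in> {-1, 1}"
  shows "(f \<circ> stereo s) differentiable at y"
proof -
  have "Ck (Suc 0) (f \<circ> stereo s)" using assms unfolding smooth_on_sphere_def by blast
  then show ?thesis by simp
qed

text \<open>Fermat's theorem in a chart around \<open>x\<close>.\<close>

lemma sphere_critical_extremum:
  assumes smooth: "smooth_on_sphere f" and x: "x \<in> unit_sphere"
    and ext: "(\<forall>y\<in>unit_sphere. f y \<le> f x) \<or> (\<forall>y\<in>unit_sphere. f x \<le> f y)"
  shows "sphere_critical f x"
proof -
  obtain s y where s: "s \<in> {-1, 1}" and xy: "x = stereo s y" using unit_sphere_stereo[OF x] .
  obtain D where D: "((f \<circ> stereo s) has_derivative D) (at y)"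
    using smooth_on_sphere_differentiable[OF smooth s] unfolding differentiable_def by blast
  have "(\<forall>z\<in>UNIV. (f \<circ> stereo s) z \<le> (f \<circ> stereo s) y) \<or> (\<forall>z\<in>UNIV. (f \<circ> stereo s) y \<le> (f \<circ> stereo s) z)"
    using ext stereo_in_unit_sphere[OF s] unfolding xy comp_def by blast
  then have "D = (\<lambda>v. 0)" by (intro differential_zero_maxmin[OF _ _ D, of UNIV]) auto
  then show ?thesis using D s xy unfolding sphere_critical_def by blast
qed

lemma has_real_derivative_along_line:
  fixes F :: "'b::real_normed_vector \<Rightarrow> real"
  assumes "(F has_derivative D) (at y)"
  shows "((\<lambda>t. F (y + t *\<^sub>R w)) has_real_derivative D w) (at 0)"
proof -
  have "((\<lambda>t. y + t *\<^sub>R w) has_derivative (\<lambda>t. t *\<^sub>R w)) (at 0)" by (auto intro!: derivative_eq_intros)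
  from has_derivative_compose[OF this, of F D] assms
  have "((\<lambda>t. F (y + t *\<^sub>R w)) has_derivative (\<lambda>t. D (t *\<^sub>R w))) (at 0)" by simp
  moreover have "(\<lambda>t. D (t *\<^sub>R w)) = (*) (D w)"
    using has_derivative_bounded_linear[OF assms] by (auto simp: linear_simps fun_eq_iff)
  ultimately show ?thesis by (simp add: has_field_derivative_def)
qed

text \<open>The average is a sum of functions of separate coordinates, so its directional
  derivatives are sums of those of \<open>f0\<close>. Both notions of criticality ask for some
  chart, and the charts are matched coordinate by coordinate.\<close>

lemma power_critical_average_iff:
  assumes smooth: "smooth_on_sphere f0" and \<Omega>: "finite \<Omega>" "\<Omega> \<noteq> {}" and x: "x \<in> extensional \<Omega>"
  shows "power_critical \<Omega> (average f0 \<Omega>) x \<longleftrightarrow> (\<forall>g\<in>\<Omega>. sphere_critical f0 (x g))"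
proof
  have N: "card \<Omega> > 0" using \<Omega> by (simp add: card_gt_0_iff)
  assume "power_critical \<Omega> (average f0 \<Omega>) x"
  then obtain s y where s: "s \<in> \<Omega> \<rightarrow> {-1, 1}" and xy: "x = (\<lambda>g\<in>\<Omega>. stereo (s g) (y g))"
    and d: "\<And>v. ((\<lambda>t. average f0 \<Omega> (\<lambda>g\<in>\<Omega>. stereo (s g) (y g + t *\<^sub>R v g))) has_real_derivative 0) (at 0)"
    unfolding power_critical_def by blast
  show "\<forall>g\<in>\<Omega>. sphere_critical f0 (x g)"
  proof
    fix g assume g: "g \<in> \<Omega>"
    then have sg: "s g \<in> {-1, 1}" using s by blast
    obtain D where D: "((f0 \<circ> stereo (s g)) has_derivative D) (at (y g))"
      using smooth_on_sphere_differentiable[OF smooth sg] unfolding differentiable_def by blast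
    have "D w = 0" for w
    proof -
      \<comment> \<open>Only the coordinate \<open>g\<close> is moved, so the other summands form
        the constant \<open>R\<close>.\<close>
      define v where "v h = (if h = g then w else 0)" for h
      define R where "R = (\<Sum>h\<in>\<Omega> - {g}. f0 (stereo (s h) (y h)))"
      have "average f0 \<Omega> (\<lambda>g\<in>\<Omega>. stereo (s g) (y g + t *\<^sub>R v g)) =
          1 / real (card \<Omega>) * ((f0 \<circ> stereo (s g)) (y g + t *\<^sub>R w) + R)" for t
      proof -
        have "(\<Sum>h\<in>\<Omega>. f0 (stereo (s h) (y h + t *\<^sub>R v h))) =
            f0 (stereo (s g) (y g + t *\<^sub>R w)) + (\<Sum>h\<in>\<Omega> - {g}. f0 (stereo (s h) (y h + t *\<^sub>R v h)))"
          using sum.remove[OF \<Omega>(1) g, of "\<lambda>h. f0 (stereo (s h) (y h + t *\<^sub>R v h))"] by (simp add: v_def)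
        also have "(\<Sum>h\<in>\<Omega> - {g}. f0 (stereo (s h) (y h + t *\<^sub>R v h))) = R"
          unfolding R_def by (intro sum.cong) (auto simp: v_def)
        finally show ?thesis by (simp add: average_def)
      qed
      then have "((\<lambda>t. 1 / real (card \<Omega>) * ((f0 \<circ> stereo (s g))
          (y g + t *\<^sub>R w) + R)) has_real_derivative 0) (at 0)"
        using d[of v] by simp
      moreover have "((\<lambda>t. 1 / real (card \<Omega>) * ((f0 \<circ> stereo (s g))
          (y g + t *\<^sub>R w) + R)) has_real_derivative 1 / real (card \<Omega>) * (D w + 0)) (at 0)"
        by (intro DERIV_cmult DERIV_add has_real_derivative_along_line[OF D] DERIV_const)
      ultimately show "D w = 0" using N DERIV_unique by fastforce
    qed
    then have "D = (\<lambda>v. 0)" by auto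
    then show "sphere_critical f0 (x g)"
      using D sg g unfolding sphere_critical_def xy by auto
  qed
next
  assume "\<forall>g\<in>\<Omega>. sphere_critical f0 (x g)"
  then have "\<forall>g\<in>\<Omega>. \<exists>s y. s \<in> {-1, 1} \<and> x g = stereo s y \<and> ((f0 \<circ> stereo s) has_derivative (\<lambda>v. 0)) (at y)"
    unfolding sphere_critical_def by blast
  then obtain s y where sy: "\<And>g. g \<in> \<Omega> \<Longrightarrow> s g \<in> {-1, 1}" "\<And>g. g \<in> \<Omega> \<Longrightarrow> x g = stereo (s g) (y g)"
      "\<And>g. g \<in> \<Omega> \<Longrightarrow> ((f0 \<circ> stereo (s g)) has_derivative (\<lambda>v. 0)) (at (y g))"
    by metis
  have "((\<lambda>t. average f0 \<Omega> (\<lambda>g\<in>\<Omega>. stereo (s g) (y g + t *\<^sub>R v g))) has_real_derivative 0) (at 0)" for v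
  proof -
    have "((\<lambda>t. 1 / real (card \<Omega>) * (\<Sum>g\<in>\<Omega>. (f0 \<circ> stereo (s g)) (y g + t *\<^sub>R v g))) has_real_derivative
        1 / real (card \<Omega>) * (\<Sum>g\<in>\<Omega>. 0)) (at 0)"
      by (intro DERIV_cmult DERIV_sum has_real_derivative_along_line[OF sy(3)])
    then show ?thesis by (simp add: average_def)
  qed
  moreover have "x = (\<lambda>g\<in>\<Omega>. stereo (s g) (y g))" using x sy(2) by (auto simp: extensional_def fun_eq_iff)
  moreover have "s \<in> \<Omega> \<rightarrow> {-1, 1}" using sy(1) by blast
  ultimately show "power_critical \<Omega> (average f0 \<Omega>) x" unfolding power_critical_def by blast
qed

text \<open>By surjectivity the values 0 and 1 are attained. Points attaining them are extrema,
  hence critical, and distinct; with only two critical points these are all.\<close>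

lemma two_critical_points:
  assumes morse: "morse_on_sphere f0" and img: "f0 ` unit_sphere = {0..1}"
    and card2: "card {x \<in> unit_sphere. sphere_critical f0 x} = 2"
  obtains a b where "a \<in> unit_sphere" "b \<in> unit_sphere" "f0 a = 0" "f0 b = 1"
    "{x \<in> unit_sphere. sphere_critical f0 x} = {a, b}"
proof -
  have "0 \<in> f0 ` unit_sphere" "1 \<in> f0 ` unit_sphere" using img by auto
  then obtain a b where ab: "a \<in> unit_sphere" "b \<in> unit_sphere" "f0 a = 0" "f0 b = 1" by (metis imageE)
  have bound: "0 \<le> f0 x" "f0 x \<le> 1" if "x \<in> unit_sphere" for x using imageI[OF that, of f0] img by auto
  have "smooth_on_sphere f0" using morse by (simp add: morse_on_sphere_def)
  then have "sphere_critical f0 a" "sphere_critical f0 b"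
    using ab bound by (auto intro!: sphere_critical_extremum)
  then have "{a, b} \<subseteq> {x \<in> unit_sphere. sphere_critical f0 x}" using ab by auto
  moreover have "card {a, b} = 2" using ab by (metis card_2_iff zero_neq_one)
  ultimately have "{x \<in> unit_sphere. sphere_critical f0 x} = {a, b}"
    using card2 by (metis card_subset_eq card.infinite zero_neq_numeral)
  then show thesis using that ab by blast
qed

text \<open>A critical point is coded by the set of coordinates equal to \<open>b\<close>, and its
  value is the cardinality of that set divided by \<open>card \<Omega>\<close>. This is the
  complement of the indexing on the Betti side, with the same binomial counts.\<close>

lemma card_power_critical_average:
  fixes f0 :: "'b::euclidean_space \<times> real \<Rightarrow> real"
  assumes smooth: "smooth_on_sphere f0" and \<Omega>: "finite \<Omega>" "\<Omega> \<noteq> {}"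
    and ab: "a \<in> unit_sphere" "b \<in> unit_sphere" "f0 a = 0" "f0 b = 1"
    and crit: "{x \<in> unit_sphere. sphere_critical f0 x} = {a, b}"
  shows "card {x \<in> topspace (sphere_power \<Omega>). power_critical \<Omega> (average f0 \<Omega>) x \<and> average f0 \<Omega> x
      \<in> {c - \<delta>..c + \<delta>}} =
    (\<Sum>k | k \<le> card \<Omega> \<and> c - \<delta> \<le> real k / real (card \<Omega>) \<and> real k / real (card \<Omega>) \<le> c + \<delta>. card \<Omega> choose k)"
proof -
  let ?C = "{x \<in> topspace (sphere_power \<Omega>). power_critical \<Omega> (average f0 \<Omega>) x \<and> average f0 \<Omega> x
      \<in> {c - \<delta>..c + \<delta>}}"
  let ?P = "\<lambda>k. c - \<delta> \<le> real k / real (card \<Omega>) \<and> real k / real (card \<Omega>) \<le> c + \<delta>"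
  let ?S = "{S. S \<subseteq> \<Omega> \<and> ?P (card S)}"
  have top: "topspace (sphere_power \<Omega> :: ('a \<Rightarrow> 'b \<times> real) topology) = (\<Pi>\<^sub>E g\<in>\<Omega>. unit_sphere)"
    by (simp add: sphere_power_def)
  have crit': "x \<in> unit_sphere \<and> sphere_critical f0 x \<longleftrightarrow> x = a \<or> x = b" for x using crit by blast
  define V where "V S = (\<lambda>g\<in>\<Omega>. if g \<in> S then b else a)" for S
  have ne: "a \<noteq> b" using ab by auto
  have avg: "average f0 \<Omega> (V S) = real (card S) / real (card \<Omega>)" if "S \<subseteq> \<Omega>" for S
  proof -
    have "(\<Sum>g\<in>\<Omega>. f0 (V S g)) = (\<Sum>g\<in>\<Omega>. if g \<in> S then 1 else 0)"
      using ab by (intro sum.cong) (auto simp: V_def)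
    also have "\<dots> = real (card S)" using \<Omega> that by (simp add: sum.If_cases Int_absorb1)
    finally show ?thesis by (simp add: average_def)
  qed
  have "bij_betw V ?S
    ?C"
  proof (rule bij_betw_imageI)
    show "inj_on V ?S"
    proof (rule inj_onI)
      fix S T assume S: "S \<in> ?S" and T: "T \<in> ?S" and "V S = V T"
      then have "V S g = V T g" for g by simp
      then have "g \<in> S \<longleftrightarrow> g \<in> T" if "g \<in> \<Omega>" for g using that ne by (force simp: V_def split: if_splits)
      then show "S = T" using S T by blast
    qed
    show "V ` ?S =
      ?C"
    proof (intro equalityI subsetI)
      fix x assume "x \<in> V ` ?S"
      then obtain S where S: "S \<subseteq> \<Omega>" "?P (card S)" "x = V S" by blast
      have "x \<in> topspace (sphere_power \<Omega>)" using ab by (auto simp: top S(3) V_def PiE_def)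
      moreover have "power_critical \<Omega> (average f0 \<Omega>) x"
        by (subst power_critical_average_iff[OF smooth \<Omega>]) (use crit'[of a] crit'[of b] in \<open>auto
            simp: S(3) V_def\<close>)
      ultimately show "x \<in> ?C"
        using S avg by simp
    next
      fix x :: "'a \<Rightarrow> 'b \<times> real"
      assume x: "x \<in> ?C"
      then have xx: "x \<in> extensional \<Omega>" "\<And>g. g \<in> \<Omega> \<Longrightarrow> x g \<in> unit_sphere"
        by (auto simp: top PiE_iff simp del: mem_sphere_0)
      then have c: "x g = a \<or> x g = b" if "g \<in> \<Omega>" for g
        using x that crit'[of "x g"] by (simp add: power_critical_average_iff[OF smooth \<Omega>])
      define S where "S = {g \<in> \<Omega>. x g = b}"
      have "x = V S" using xx(1) c by (auto simp: V_def S_def extensional_def fun_eq_iff)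
      moreover have "S \<subseteq> \<Omega>" by (auto simp: S_def)
      ultimately show "x \<in> V ` ?S" using x avg[of S] by auto
    qed
  qed
  then show ?thesis
    using card_subsets_by_card[OF \<Omega>(1), of ?P] by (simp add: bij_betw_same_card)
qed

section \<open>Asymptotics of binomial coefficients\<close>

text \<open>At 0 and 1 the factor 0 realises the convention 0 log 0 = 0.\<close>

definition binary_entropy :: "real \<Rightarrow> real" where
  "binary_entropy x = - x * ln x - (1 - x) * ln (1 - x)"

lemma continuous_on_x_ln_x: "continuous_on {0..} (\<lambda>x::real. x * ln x)"
  unfolding continuous_on_def
proof
  fix x :: real assume x: "x \<in> {0..}"
  show "((\<lambda>x. x * ln x) \<longlongrightarrow> x * ln x) (at x within {0..})"
  proof (cases "x = 0")
    case True
    have "((\<lambda>x::real. x * ln x) \<longlongrightarrow> 0) (at_right 0)" by real_asymp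
    then show ?thesis by (simp add: True at_within_Ici_at_right)
  next
    case False
    then have "((\<lambda>x. x * ln x) \<longlongrightarrow> x * ln x) (at x)" using x by (intro tendsto_intros) auto
    then show ?thesis by (rule tendsto_within_subset) simp
  qed
qed

lemma continuous_on_binary_entropy: "continuous_on {0..1} binary_entropy"
proof -
  have "continuous_on {0..1} (\<lambda>x::real. x * ln x)"
    by (rule continuous_on_subset[OF continuous_on_x_ln_x]) auto
  moreover have "continuous_on {0..1} (\<lambda>x::real. (1 - x) * ln (1 - x))"
    by (rule continuous_on_compose2[OF continuous_on_x_ln_x]) (auto intro!: continuous_intros)
  ultimately have "continuous_on {0..1} (\<lambda>x::real. - (x * ln x) - (1 - x) * ln (1 - x))"
    by (intro continuous_on_diff continuous_on_minus)
  then show ?thesis by (simp add: binary_entropy_def[abs_def])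
qed

text \<open>The quotient of the two factorials is a product of consecutive integers, all above
  \<open>k\<close> if k \<le> j and all at most \<open>k\<close> otherwise. Equivalently, the
  Poisson weights \<open>k ^ j / fact j\<close> are largest at \<open>j = k\<close>.\<close>

lemma fact_mult_power_le: "fact k * k ^ j \<le> fact j * (k ^ k :: nat)"
proof (cases "k \<le> j")
  case True
  have "fact k * k ^ (k + d) \<le> fact (k + d) * (k ^ k :: nat)" for d
  proof (induction d)
    case (Suc d)
    have "fact k * k ^ (k + Suc d) = k * (fact k * k ^ (k + d))" by simp
    also have "\<dots> \<le> Suc (k + d) * (fact (k + d) * k ^ k)" by (rule mult_mono[OF _ Suc]) auto
    also have "\<dots> = fact (k + Suc d) * k ^ k" by (simp add: algebra_simps)
    finally show ?case .
  qed simp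
  then show ?thesis using True by (metis le_add_diff_inverse)
next
  case False
  have *: "fact (j + d) \<le> fact j * ((j + d) ^ d :: nat)" for d
  proof (induction d)
    case (Suc d)
    have "fact (j + Suc d) = Suc (j + d) * fact (j + d)" by simp
    also have "\<dots> \<le> Suc (j + d) * (fact j * (j + d) ^ d)" by (rule mult_left_mono[OF Suc]) simp
    also have "\<dots> \<le> Suc (j + d) * (fact j * (j + Suc d) ^ d)"
      by (intro mult_left_mono power_mono) auto
    also have "\<dots> = fact j * (j + Suc d) ^ Suc d" by (simp add: algebra_simps)
    finally show ?case .
  qed simp
  have k: "k = j + (k - j)" using False by simp
  have "fact k \<le> fact j * (k ^ (k - j) :: nat)" using *[of "k - j"] k by simp
  then have "fact k * k ^ j \<le> fact j * k ^ (k - j) * (k ^ j :: nat)" by (rule mult_right_mono) simp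
  also have "\<dots> = fact j * k ^ k" using k by (metis mult.assoc power_add add.commute)
  finally show ?thesis .
qed

lemma power_div_fact_le: "real k ^ j / fact j \<le> real k ^ k / fact k"
proof -
  have "real (fact k * k ^ j) \<le> real (fact j * k ^ k)" using fact_mult_power_le[of k j] by
      (simp only: of_nat_le_iff)
  then show ?thesis by (simp add: field_simps)
qed

text \<open>With success probability k/N, a binomial weight is a constant times a product of two
  Poisson-type weights, with parameters \<open>k\<close> and \<open>N - k\<close>; both are largest
  at \<open>j = k\<close>.\<close>

lemma binomial_term_le:
  assumes "j \<le> N" "k \<le> N" "N > 0"
  defines "x \<equiv> real k / real N"
  shows "real (N choose j) * x ^ j * (1 - x) ^ (N - j) \<le> real (N choose k) * x ^ k * (1 - x) ^ (N - k)"
proof -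
  have x: "x = real k / real N" "1 - x = real (N - k) / real N"
    using assms by (auto simp: x_def field_simps of_nat_diff)
  have t: "real (N choose i) * x ^ i * (1 - x) ^ (N - i) =
      fact N / real N ^ N * (real k ^ i / fact i * (real (N - k) ^ (N - i) / fact (N - i)))" if "i
          \<le> N" for i
  proof -
    have "real N ^ N = real N ^ i * real N ^ (N - i)" using that by (simp flip: power_add)
    moreover have "x ^ i = real k ^ i / real N ^ i" by (simp only: x(1) power_divide)
    moreover have "(1 - x) ^ (N - i) = real (N - k) ^ (N - i) / real N ^ (N - i)" by
        (simp only: x(2) power_divide)
    ultimately show ?thesis using that by (simp add: binomial_fact mult_ac)
  qed
  have "real k ^ j / fact j * (real (N - k) ^ (N - j) / fact (N - j)) \<le>
      real k ^ k / fact k * (real (N - k) ^ (N - k) / fact (N - k))"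
    by (intro mult_mono power_div_fact_le) auto
  then show ?thesis unfolding t[OF assms(1)] t[OF assms(2)] by (intro mult_left_mono) auto
qed

lemma binomial_weight_eq_exp:
  assumes "k \<le> N" "N > 0"
  defines "x \<equiv> real k / real N"
  shows "x ^ k * (1 - x) ^ (N - k) = exp (- (real N * binary_entropy x))"
proof -
  \<comment> \<open>For \<open>m = 0\<close> both sides are 1 whatever \<open>y\<close> is; this
    covers \<open>k = 0\<close> and \<open>k = N\<close>, where \<open>x\<close> or
    \<open>1 - x\<close> is 0.\<close>
  have pow: "y ^ m = exp (real m * ln y)" if "m = 0 \<or> y > 0" for y :: real and m
    using that by (auto simp: exp_of_nat_mult)
  have x: "1 - x = real (N - k) / real N" using assms by (simp add: x_def field_simps of_nat_diff)
  have "x ^ k = exp (real k * ln x)" using assms(1,2) by (intro pow) (auto simp: x_def zero_less_divide_iff)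
  moreover have "(1 - x) ^ (N - k) = exp (real (N - k) * ln (1 - x))"
    using assms(1,2) by (intro pow) (auto simp: x zero_less_divide_iff)
  moreover have "real N * binary_entropy x = - (real k * ln x) - real (N - k) * ln (1 - x)"
  proof -
    have "real N * binary_entropy x = - ((real N * x) * ln x) - (real N * (1 - x)) * ln (1 - x)"
      by (simp add: binary_entropy_def algebra_simps)
    moreover have "real N * x = real k" "real N * (1 - x) = real (N - k)" using assms(2) by
        (simp_all only: x) (auto simp: x_def)
    ultimately show ?thesis by (simp only:)
  qed
  ultimately show ?thesis by (simp flip: exp_add)
qed

text \<open>The N + 1 binomial weights with success probability k/N sum to 1. The weight at
  \<open>k\<close> is thus at most 1, and being the largest it is at least 1/(N + 1).\<close>

lemma binomial_entropy_bounds: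
  assumes "k \<le> N" "N > 0"
  shows "real (N choose k) \<le> exp (real N * binary_entropy (real k / real N))"
    and "exp (real N * binary_entropy (real k / real N)) \<le> (real N + 1) * real (N choose k)"
proof -
  define x where "x = real k / real N"
  let ?t = "\<lambda>j. real (N choose j) * x ^ j * (1 - x) ^ (N - j)"
  let ?e = "exp (real N * binary_entropy x)"
  have x: "0 \<le> x" "x \<le> 1" using assms by (auto simp: x_def)
  have sum: "(\<Sum>j\<le>N. ?t j) = 1" using binomial_ring[of x "1 - x" N] by simp
  have tk: "?t k = real (N choose k) / ?e"
    using binomial_weight_eq_exp[OF assms, folded x_def] by (simp add: exp_minus divide_inverse mult.assoc)
  have "?t k \<le> (\<Sum>j\<le>N. ?t j)"
    using assms x by (intro member_le_sum) auto
  then show "real (N choose k) \<le> exp (real N * binary_entropy (real k / real N))"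
    unfolding sum tk x_def[symmetric] by (simp add: field_simps)
  have "(\<Sum>j\<le>N. ?t j) \<le> (\<Sum>j\<le>N. ?t k)"
    unfolding x_def using assms by (intro sum_mono binomial_term_le) auto
  then have "1 \<le> (real N + 1) * (real (N choose k) / ?e)" unfolding sum tk
    by (simp add: add.commute[of "real N"])
  then have "1 \<le> ((real N + 1) * real (N choose k)) / ?e" by (simp only: times_divide_eq_right)
  then have "1 * ?e \<le> (real N + 1) * real (N choose k)" 
    by (rule pos_le_divide_eq[THEN iffD1, OF exp_gt_zero])
  then show "exp (real N * binary_entropy (real k / real N)) \<le> (real N + 1) * real (N choose k)"
    unfolding x_def[symmetric] by (simp only: mult_1)
qed

text \<open>
  The windows of the two entropies differ only at the right end point, so it suffices to bound the
  counts by the closed window from above and by the terms of the open window from below.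
\<close>

lemma exponential_rate_binomial:
  fixes \<Omega> :: "nat \<Rightarrow> 'g set" and M :: "nat \<Rightarrow> real \<Rightarrow> nat"
  assumes lim: "filterlim (\<lambda>i. card (\<Omega> i)) at_top sequentially" and c: "0 \<le> c" "c \<le> 1"
    and upper: "\<And>i \<delta>. \<delta> > 0 \<Longrightarrow> card (\<Omega> i) > 0 \<Longrightarrow>
      M i \<delta> \<le> (\<Sum>k | k \<le> card (\<Omega> i) \<and> \<bar>real k / real (card (\<Omega> i)) - c\<bar> \<le> \<delta>. card (\<Omega> i) choose k)"
    and lower: "\<And>i k \<delta>. \<delta> > 0 \<Longrightarrow> card (\<Omega> i) > 0 \<Longrightarrow> k \<le> card (\<Omega> i) \<Longrightarrow>
      \<bar>real k / real (card (\<Omega> i)) - c\<bar> < \<delta> \<Longrightarrow> card (\<Omega> i) choose k \<le> M i \<delta>"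
  shows "exponential_rate \<Omega> M = ereal (binary_entropy c)"
proof -
  define N where "N i = card (\<Omega> i)" for i
  have N_top: "filterlim (\<lambda>i. real (N i)) at_top sequentially"
    unfolding N_def by (rule filterlim_compose[OF filterlim_real_sequentially lim])
  have N_pos: "eventually (\<lambda>i. N i > 0) sequentially"
    using filterlim_at_top_dense[THEN iffD1, OF N_top, rule_format, of 0] by (simp add: eventually_mono)
  have lnN: "(\<lambda>i. ln (real (N i) + 1) / real (N i)) \<longlonglongrightarrow> 0"
  proof -
    have "((\<lambda>x::real. ln (x + 1) / x) \<longlongrightarrow> 0) at_top" by real_asymp
    from filterlim_compose[OF this N_top] show ?thesis .
  qed
  have div_low: "h - u / n \<le> v / n" if "n > 0" "n * h \<le> u + v" for n h u v :: real
  proof -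
    have "h - u / n = (n * h - u) / n" using that by (simp add: diff_divide_distrib)
    also have "\<dots> \<le> v / n" using that by (intro divide_right_mono) auto
    finally show ?thesis .
  qed
  have div_up: "v / n \<le> h + u / n" if "n > 0" "v \<le> u + n * h" for n h u v :: real
  proof -
    have "v / n \<le> (u + n * h) / n" using that by (intro divide_right_mono) auto
    also have "\<dots> = h + u / n" using that by (simp add: add_divide_distrib)
    finally show ?thesis .
  qed
  let ?L = "\<lambda>\<delta>. liminf (\<lambda>i. log_nat (M i \<delta>) / ereal (real (card (\<Omega> i))))"
  have low: "ereal (binary_entropy c) \<le> ?L \<delta>" if \<delta>: "\<delta> > 0" for \<delta>
  proof -
    \<comment> \<open>The floor gives a ratio within 1/N of \<open>c\<close>, so this single
      binomial coefficient eventually belongs to every window and already has the right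
      growth.\<close>
    define k where "k i = nat \<lfloor>c * real (N i)\<rfloor>" for i
    have k: "real (k i) \<le> c * real (N i)" "c * real (N i) < real (k i) + 1" for i
      using c by (auto simp: k_def)
    have kN: "k i \<le> N i" for i
    proof -
      have "c * real (N i) \<le> real (N i)" using c by (simp add: mult_left_le_one_le)
      then show ?thesis using k(1)[of i] by simp
    qed
    have dist: "\<bar>real (k i) / real (N i) - c\<bar> \<le> 1 / real (N i)" if "N i > 0" for i
    proof -
      have "real (k i) / real (N i) \<le> c" using k(1)[of i] that by (simp add: divide_le_eq)
      moreover have "c \<le> (real (k i) + 1) / real (N i)" using k(2)[of i] that by (simp add: le_divide_eq)
      ultimately show ?thesis unfolding add_divide_distrib by linarith
    qed
    have invN: "(\<lambda>i. 1 / real (N i)) \<longlonglongrightarrow> 0"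
      using tendsto_divide_0[OF tendsto_const filterlim_at_top_imp_at_infinity[OF N_top]] .
    have "(\<lambda>i. real (k i) / real (N i) - c) \<longlonglongrightarrow> 0"
      by (rule Lim_null_comparison[OF _ invN]) (use N_pos in eventually_elim, use dist in simp)
    then have "(\<lambda>i. real (k i) / real (N i)) \<longlonglongrightarrow> c" by (simp add: LIM_zero_iff)
    then have ent: "(\<lambda>i. binary_entropy (real (k i) / real (N i))) \<longlonglongrightarrow> binary_entropy c"
    proof (rule continuous_on_tendsto_compose[OF continuous_on_binary_entropy])
      show "eventually (\<lambda>i. real (k i) / real (N i) \<in> {0..1}) sequentially"
        using N_pos by eventually_elim (use kN in \<open>simp add: field_simps\<close>)
    qed (use c in simp)
    \<comment> \<open>The subtracted term is the loss of the factor N + 1 in the lower entropy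
      bound.\<close>
    define l where "l i = binary_entropy (real (k i) / real (N i)) - ln (real (N i) + 1) / real (N i)" for i
    have "l \<longlonglongrightarrow> binary_entropy c - 0" unfolding l_def[abs_def] by (intro tendsto_diff ent lnN)
    then have "(\<lambda>i. ereal (l i)) \<longlonglongrightarrow> ereal (binary_entropy c)" by simp
    then have "ereal (binary_entropy c) = liminf (\<lambda>i. ereal (l i))"
      by (intro lim_imp_Liminf[symmetric]) auto
    also have "\<dots> \<le> ?L \<delta>"
    proof (rule Liminf_mono)
      have "eventually (\<lambda>i. 1 / real (N i) < \<delta>) sequentially" by (rule order_tendstoD(2)[OF invN \<delta>])
      with N_pos show "eventually (\<lambda>i. ereal (l i) \<le> log_nat (M i \<delta>) / ereal (real (card
          (\<Omega> i)))) sequentially"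
      proof eventually_elim
        case (elim i)
        have "N i choose k i \<le> M i \<delta>"
          using lower[OF \<delta>, of i "k i"] dist[OF elim(1)] elim kN[of i] unfolding N_def by simp
        moreover have "N i choose k i > 0" using kN[of i] by (rule zero_less_binomial)
        ultimately have M: "M i \<delta> > 0" "real (N i choose k i) \<le> real (M i \<delta>)" by linarith+
        have "exp (real (N i) * binary_entropy (real (k i) / real (N i))) \<le> (real (N i) + 1) * real (M i \<delta>)"
          by (rule order_trans[OF binomial_entropy_bounds(2)[OF kN elim(1)] mult_left_mono[OF M(2)]]) simp
        then have "real (N i) * binary_entropy (real (k i) / real (N i)) \<le> ln ((real
            (N i) + 1) * real (M i \<delta>))"
          using M(1) by (subst ln_ge_iff) auto
        also have "\<dots> = ln (real (N i) + 1) + ln (real (M i \<delta>))" using M(1) by (subst ln_mult) auto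
        finally have "l i \<le> ln (real (M i \<delta>)) / real (N i)"
          unfolding l_def using elim(1) by (intro div_low) simp_all
        then show ?case using M(1) elim(1) by (simp add: log_nat_def N_def)
      qed
    qed
    finally show ?thesis .
  qed
  have up: "?L \<delta> \<le> ereal B"
    if \<delta>: "\<delta> > 0" and B: "\<And>x. x \<in> {0..1} \<Longrightarrow> \<bar>x - c\<bar> \<le> \<delta> \<Longrightarrow> binary_entropy x \<le> B" for \<delta> B
  proof -
    \<comment> \<open>At most N + 1 coefficients, each bounded by exp (N B), lie in the window;
      their number costs the second term.\<close>
    define u where "u i = B + ln (real (N i) + 1) / real (N i)" for i
    have "u \<longlonglongrightarrow> B + 0" unfolding u_def[abs_def] by (intro tendsto_add tendsto_const lnN)
    then have "(\<lambda>i. ereal (u i)) \<longlonglongrightarrow> ereal B" by simp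
    then have "liminf (\<lambda>i. ereal (u i)) = ereal B" by (intro lim_imp_Liminf) auto
    moreover have "?L \<delta> \<le> liminf (\<lambda>i. ereal (u i))"
    proof (rule Liminf_mono)
      show "eventually (\<lambda>i. log_nat (M i \<delta>) / ereal (real (card (\<Omega> i))) \<le> ereal (u i)) sequentially"
        using N_pos
      proof eventually_elim
        case (elim i)
        show ?case
        proof (cases "M i \<delta> = 0")
          case True
          then show ?thesis using elim by (simp add: log_nat_def N_def)
        next
          case False
          let ?K = "{k. k \<le> N i \<and> \<bar>real k / real (N i) - c\<bar> \<le> \<delta>}"
          have "real (M i \<delta>) \<le> (\<Sum>k\<in>?K. real (N i choose k))"
            using upper[OF \<delta>, of i] elim by (simp add: N_def flip: of_nat_sum)
          also have "\<dots> \<le> (\<Sum>k\<in>?K. exp (real (N i) * B))"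
          proof (rule sum_mono)
            fix k assume k: "k \<in> ?K"
            then have "binary_entropy (real k / real (N i)) \<le> B" using elim by (intro B)
                (auto simp: field_simps)
            then have "exp (real (N i) * binary_entropy (real k / real (N i))) \<le> exp (real (N i) * B)"
              using elim by simp
            then show "real (N i choose k) \<le> exp (real (N i) * B)"
              using binomial_entropy_bounds(1)[of k "N i"] k elim by (auto intro: order_trans)
          qed
          also have "\<dots> \<le> (real (N i) + 1) * exp (real (N i) * B)"
          proof -
            have "card ?K \<le> card {..N i}" by (intro card_mono) auto
            then show ?thesis by simp
          qed
          finally have "ln (real (M i \<delta>)) \<le> ln ((real (N i) + 1) * exp (real (N i) * B))"
            using False by (subst ln_le_cancel_iff) auto
          also have "\<dots> = ln (real (N i) + 1) + real (N i) * B" by (subst ln_mult) auto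
          finally have "ln (real (M i \<delta>)) / real (N i) \<le> u i"
            unfolding u_def using elim by (intro div_up) simp_all
          then show ?thesis using False elim by (simp add: log_nat_def N_def)
        qed
      qed
    qed
    ultimately show ?thesis by simp
  qed
  \<comment> \<open>The lower bound holds for every positive \<delta>. For the upper bound,
    \<open>B\<close> is put between the entropy at \<open>c\<close> and \<open>t\<close>, and
    continuity keeps the entropy below \<open>B\<close> on all sufficiently small windows.\<close>
  have "(?L \<longlongrightarrow> ereal (binary_entropy c)) (at_right 0)"
  proof (rule order_tendstoI)
    fix t assume "t < ereal (binary_entropy c)"
    then have "t < ?L \<delta>" if "\<delta> > 0" for \<delta> using low[OF that] by (rule less_le_trans)
    then show "eventually (\<lambda>\<delta>. t < ?L \<delta>) (at_right 0)"
      by (intro eventually_at_right_less[THEN eventually_mono])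
  next
    fix t assume "ereal (binary_entropy c) < t"
    then obtain B where B: "binary_entropy c < B" "ereal B < t"
      using ereal_dense2[of "ereal (binary_entropy c)" t] by auto
    have "eventually (\<lambda>x. binary_entropy x < B) (at c within {0..1})"
      using continuous_on_binary_entropy c B(1) by (intro order_tendstoD(2)) (auto simp: continuous_on_def)
    then obtain d where d: "d > 0" "\<And>x. x \<in> {0..1} \<Longrightarrow> x \<noteq> c \<Longrightarrow> dist x c < d \<Longrightarrow> binary_entropy x < B"
      unfolding eventually_at by blast
    have "?L \<delta> < t" if \<delta>: "0 < \<delta>" "\<delta> < d" for \<delta>
    proof -
      have "?L \<delta> \<le> ereal B"
      proof (rule up[OF \<delta>(1)])
        fix x assume "x \<in> {0..1}" "\<bar>x - c\<bar> \<le> \<delta>"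
        then show "binary_entropy x \<le> B" using d(2)[of x] \<delta> B(1) by (cases "x = c")
            (auto simp: dist_real_def)
      qed
      then show ?thesis using B(2) by (rule le_less_trans)
    qed
    then show "eventually (\<lambda>\<delta>. ?L \<delta> < t) (at_right 0)"
      unfolding eventually_at_right_field using d(1) by blast
  qed
  then show ?thesis unfolding exponential_rate_def by (intro tendsto_Lim)
      (auto simp: trivial_limit_at_right_real)
qed

section \<open>The two entropies\<close>

lemma card_box_set:
  assumes "free_abelian_basis \<Gamma> n \<gamma>"
  shows "card (box_set \<Gamma> n \<gamma> i) = (2 * i + 1) ^ n"
proof -
  interpret comm_group \<Gamma> using assms by (simp add: free_abelian_basis_def)
  have \<gamma>: "\<gamma> j \<in> carrier \<Gamma>" if "j \<in> {1..n}" for j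
    using assms that by (auto simp: free_abelian_basis_def)
  \<comment> \<open>In \<open>box_set\<close> the coefficient functions are arbitrary outside
    \<open>{1..n}\<close>; injectivity of \<open>int_combination\<close> is only available for
    extensional ones.\<close>
  have restrict: "int_combination \<Gamma> n \<gamma> (restrict a {1..n}) = int_combination \<Gamma> n \<gamma> a" for a
    unfolding int_combination_def using \<gamma> by (intro finprod_cong') auto
  have "box_set \<Gamma> n \<gamma> i = int_combination \<Gamma> n \<gamma> ` ({1..n} \<rightarrow>\<^sub>E {- int i..int i})"
  proof (intro equalityI subsetI)
    fix x assume "x \<in> box_set \<Gamma> n \<gamma> i"
    then obtain a where a: "x = int_combination \<Gamma> n \<gamma> a" "\<forall>j\<in>{1..n}. \<bar>a j\<bar> \<le> int i"
      by (auto simp: box_set_def)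
    have "restrict a {1..n} \<in> {1..n} \<rightarrow>\<^sub>E {- int i..int i}" using a(2) by (auto simp: abs_le_iff)
    then show "x \<in> int_combination \<Gamma> n \<gamma> ` ({1..n} \<rightarrow>\<^sub>E {- int i..int i})"
      using restrict[of a] a(1) by (metis imageI)
  next
    fix x assume "x \<in> int_combination \<Gamma> n \<gamma> ` ({1..n} \<rightarrow>\<^sub>E {- int i..int i})"
    then obtain a where "x = int_combination \<Gamma> n \<gamma> a" "a \<in> {1..n} \<rightarrow>\<^sub>E {- int i..int i}" by blast
    then show "x \<in> box_set \<Gamma> n \<gamma> i" unfolding box_set_def by (auto simp: abs_le_iff PiE_iff intro!:
        exI[of _ a])
  qed
  moreover have "inj_on (int_combination \<Gamma> n \<gamma>) ({1..n} \<rightarrow>\<^sub>E {- int i..int i})"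
    using assms unfolding free_abelian_basis_def bij_betw_def by (auto intro: inj_on_subset)
  ultimately have "card (box_set \<Gamma> n \<gamma> i) = card ({1..n} \<rightarrow>\<^sub>E {- int i..int i})" by (simp add: card_image)
  also have "\<dots> = (2 * i + 1) ^ n" by (simp add: card_PiE nat_add_distrib nat_mult_distrib)
  finally show ?thesis .
qed

text \<open>Since the rank is positive, the boxes grow at least linearly.\<close>

lemma filterlim_card_box_set:
  assumes "free_abelian_basis \<Gamma> n \<gamma>" "n \<ge> 1"
  shows "filterlim (\<lambda>i. card (box_set \<Gamma> n \<gamma> i)) at_top sequentially"
proof (rule filterlim_at_top_mono[OF filterlim_ident])
  have "i \<le> card (box_set \<Gamma> n \<gamma> i)" for i
  proof -
    have "i \<le> (2 * i + 1) ^ 1" by simp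
    also have "\<dots> \<le> (2 * i + 1) ^ n" using assms(2) by (intro power_increasing) auto
    finally show ?thesis by (simp add: card_box_set[OF assms(1)])
  qed
  then show "eventually (\<lambda>i. i \<le> card (box_set \<Gamma> n \<gamma> i)) sequentially" by simp
qed

theorem proposition34:
  fixes f0 :: "'b::euclidean_space \<times> real \<Rightarrow> real"
    and \<Gamma> :: "('g, 'z) monoid_scheme"
    and \<gamma> :: "nat \<Rightarrow> 'g"
    and n :: nat
    and c :: real
  assumes "n \<ge> 1"
    and "free_abelian_basis \<Gamma> n \<gamma>"
    and "morse_on_sphere f0"
    and "f0 ` unit_sphere = {0..1}"
    and "card {x \<in> unit_sphere. sphere_critical f0 x} = 2"
    and "0 \<le> c" and "c \<le> 1"
  shows "morse_entropy \<Gamma> n \<gamma> f0 c = betti_entropy \<Gamma> n \<gamma> f0 c \<and>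
         betti_entropy \<Gamma> n \<gamma> f0 c = ereal (- c * ln c - (1 - c) * ln (1 - c))"
proof -
  obtain a b where ab: "a \<in> unit_sphere" "b \<in> unit_sphere" "f0 a = 0" "f0 b = 1"
    and crit: "{x \<in> unit_sphere. sphere_critical f0 x} = {a, b}"
    using two_critical_points[OF assms(3-5)] by blast
  have smooth: "smooth_on_sphere f0" using assms(3) by (simp add: morse_on_sphere_def)
  define \<Omega> where "\<Omega> = box_set \<Gamma> n \<gamma>"
  let ?morse = "\<lambda>i \<delta>. (\<Sum>k | k \<le> card (\<Omega> i) \<and> c - \<delta> \<le> real k / real (card (\<Omega> i)) \<and> real k / real
      (card (\<Omega> i)) \<le> c + \<delta>. card (\<Omega> i) choose k)"
  let ?window = "\<lambda>i \<delta>. (\<Sum>k | k \<le> card (\<Omega> i) \<and> \<bar>real k / real (card (\<Omega> i)) - c\<bar> \<le> \<delta>. card (\<Omega> i) choose k)"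
  have card: "card (\<Omega> i) > 0" for i by (simp add: \<Omega>_def card_box_set[OF assms(2)])
  then have \<Omega>: "finite (\<Omega> i)" "\<Omega> i \<noteq> {}" for i
    using card_gt_0_iff by blast+
  have lim: "filterlim (\<lambda>i. card (\<Omega> i)) at_top sequentially"
    unfolding \<Omega>_def by (rule filterlim_card_box_set[OF assms(2,1)])
  have le_sum: "N choose k \<le> (\<Sum>k | k \<le> N \<and> P k. N choose k)" if "k \<le> N" "P k" for N k :: nat and P
    using that by (intro member_le_sum[of k _ "\<lambda>k. N choose k"]) auto
  have sum_le: "(\<Sum>k | k \<le> N \<and> P k. N choose k) \<le> (\<Sum>k | k \<le> N \<and> Q k. N choose k)"
    if "\<And>k. P k \<Longrightarrow> Q k" for N :: nat and P Q
    using that by (intro sum_mono2) auto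
  have "morse_entropy \<Gamma> n \<gamma> f0 c = ereal (binary_entropy c)"
    unfolding morse_entropy_def Let_def \<Omega>_def[symmetric]
      card_power_critical_average[OF smooth \<Omega> ab crit]
  proof (rule exponential_rate_binomial[OF lim assms(6,7)])
    fix i :: nat and \<delta> :: real
    show "?morse i \<delta>
      \<le> ?window i \<delta>"
      by (rule sum_le) (simp add: abs_le_iff)
  next
    fix i k :: nat and \<delta> :: real
    assume "k \<le> card (\<Omega> i)" "\<bar>real k / real (card (\<Omega> i)) - c\<bar> < \<delta>"
    then show "card (\<Omega> i) choose k \<le> ?morse i \<delta>"
      by (intro le_sum) (auto simp: abs_less_iff)
  qed
  moreover have "betti_entropy \<Gamma> n \<gamma> f0 c = ereal (binary_entropy c)"
    unfolding betti_entropy_def Let_def \<Omega>_def[symmetric]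
  proof (rule exponential_rate_binomial[OF lim assms(6,7)])
    fix i :: nat and \<delta> :: real assume "\<delta> > 0"
    then show "sublevel_betti (sphere_power (\<Omega> i)) (average f0 (\<Omega> i)) c \<delta>
      \<le> ?window i \<delta>"
      using assms(4) by (subst sublevel_betti_average[OF \<Omega> _ ab]) (auto simp: abs_le_iff intro!: sum_le)
  next
    fix i k :: nat and \<delta> :: real
    assume "\<delta> > 0" "k \<le> card (\<Omega> i)" "\<bar>real k / real (card (\<Omega> i)) - c\<bar> < \<delta>"
    then show "card (\<Omega> i) choose k \<le> sublevel_betti (sphere_power (\<Omega> i)) (average f0 (\<Omega> i)) c \<delta>"
      using assms(4) by (subst sublevel_betti_average[OF \<Omega> _ ab]) (auto simp: abs_less_iff intro!: le_sum)
  qed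
  ultimately show ?thesis by (simp add: binary_entropy_def)
qed

end
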